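(* Let $H$ be a graph with $\chi(H)=p+1\ge3$ and $\vec H$ an orientation of $H$. Suppose that for some $t\ge1$, $S_{t+1}\in\mathcal{M}(H)$ and $\mathcal{M}(\vec H)$ contains both pure orientations of $S_{t+1}$. Suppose further that there is a constant $a$ such that $\mathrm{ex}(n,\mathcal{M}'(\vec H))=a$ for all sufficiently large $n$. Then for all sufficiently large $n$, if $G$ is an $n$-vertex graph with $D(G,\vec H)=D(n,\vec H)$ and $V(G)=V_1\cup\dots\cup V_p$ is an optimal $p$-partition of $V(G)$, then $$\sum_{i=1}^p |E(V_i)|\le pa.$$
   Context: All graphs are finite and simple; directed graphs have no loops, multiple edges or pairs of opposite edges. For a directed graph $\vec H$, $H$ is its underlying graph. A directed graph is $\vec H$-free if it contains no copy of $\vec H$. $D(G,\vec H)$ is the number of $\vec H$-free orientations of $G$ and $D(n,\vec H)$ its maximum over $n$-vertex graphs $G$. $\mathrm{ex}(n,\mathcal{L})$ is the maximum number of edges of an $n$-vertex graph with no member of $\mathcal{L}$ as a subgraph. $E(V_i)$ denotes the set of edges of $G$ with both ends in $V_i$. A $p$-partition $V_1\cup\dots\cup V_p$ of $V(G)$ is optimal if it minimizes $\sum_i|E(V_i)|$ over all $p$-partitions. $G\otimes F$ is the disjoint union of $G$ and $F$ with all edges between them; $K_{p-1}(t)$ is the complete $(p-1)$-partite graph with parts of size $t$. $\mathcal{M}(H)$ (for $\chi(H)=p+1$) is the family of subgraph-minimal graphs $M$ such that for some $t$, $M'\otimes K_{p-1}(t)\supseteq H$, where $M'$ is $M$ plus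 $t$ isolated vertices. $\mathcal{M}(\vec H)$ is the family of directed graphs $\vec M$ with underlying graph $M\in\mathcal{M}(H)$ such that for some $t\ge1$ there exist an orientation $\vec G_M$ of $G_M=M'\otimes K_{p-1}(t)$ and a set $W$, $V(M)\subseteq W\subseteq V(G_M)$, with $\vec H\subseteq \vec G_M[W]$ and $\vec G_M[V(M)]\cong\vec M$. $\mathcal{M}'(\vec H)$ is the set of $M\in\mathcal{M}(H)$ all of whose orientations lie in $\mathcal{M}(\vec H)$. $S_{t+1}$ is the star with center and $t$ leaves; its pure orientations are the two orientations with all edges towards, respectively all away from, the center. *)

theory Defs
  imports Main
begin

type_synonym 'a graph = "'a set \<times> 'a set set"
type_synonym 'a digraph = "'a set \<times> ('a \<times> 'a) set"

definition graph :: "'a graph \<Rightarrow> bool" where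
  "graph G \<longleftrightarrow> finite (fst G) \<and>
     (\<forall>e\<in>snd G. \<exists>x y. x \<noteq> y \<and> x \<in> fst G \<and> y \<in> fst G \<and> e = {x, y})"

definition digraph :: "'a digraph \<Rightarrow> bool" where
  "digraph D \<longleftrightarrow> finite (fst D) \<and> snd D \<subseteq> fst D \<times> fst D \<and>
     (\<forall>(x, y)\<in>snd D. x \<noteq> y \<and> (y, x) \<notin> snd D)"

definition underlying :: "'a digraph \<Rightarrow> 'a graph" where
  "underlying D = (fst D, {{x, y} | x y. (x, y) \<in> snd D})"

definition orientation :: "'a digraph \<Rightarrow> 'a graph \<Rightarrow> bool" where
  "orientation D G \<longleftrightarrow> digraph D \<and> underlying D = G"

definition subgraph_of :: "'a graph \<Rightarrow> 'a graph \<Rightarrow> bool" where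
  "subgraph_of H G \<longleftrightarrow> graph H \<and> fst H \<subseteq> fst G \<and> snd H \<subseteq> snd G"

definition contains :: "'b graph \<Rightarrow> 'a graph \<Rightarrow> bool" where
  "contains G H \<longleftrightarrow> (\<exists>f. inj_on f (fst H) \<and> f ` fst H \<subseteq> fst G \<and>
                          (\<forall>e\<in>snd H. f ` e \<in> snd G))"

definition dcontains :: "'b digraph \<Rightarrow> 'a digraph \<Rightarrow> bool" where
  "dcontains G H \<longleftrightarrow> (\<exists>f. inj_on f (fst H) \<and> f ` fst H \<subseteq> fst G \<and>
                          (\<forall>(x, y)\<in>snd H. (f x, f y) \<in> snd G))"

definition diso :: "'b digraph \<Rightarrow> 'a digraph \<Rightarrow> bool" where
  "diso D1 D2 \<longleftrightarrow> (\<exists>f. bij_betw f (fst D1) (fst D2) \<and>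
      (\<forall>x\<in>fst D1. \<forall>y\<in>fst D1. (x, y) \<in> snd D1 \<longleftrightarrow> (f x, f y) \<in> snd D2))"

definition induce :: "'a digraph \<Rightarrow> 'a set \<Rightarrow> 'a digraph" where
  "induce D W = (W, snd D \<inter> (W \<times> W))"

definition chi :: "'a graph \<Rightarrow> nat" where
  "chi H = (LEAST k. \<exists>c :: 'a \<Rightarrow> nat. (\<forall>v\<in>fst H. c v < k) \<and>
              (\<forall>e\<in>snd H. \<forall>x\<in>e. \<forall>y\<in>e. x \<noteq> y \<longrightarrow> c x \<noteq> c y))"

text \<open>\<open>gm M p t\<close> is \<open>M' \<otimes> K_{p-1}(t)\<close>: M (vertices Inl (Inl v)) plus t isolated
  vertices (Inl (Inr i)), joined to the complete (p-1)-partite graph with parts of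
  size t (vertices Inr (j, i), j < p-1, i < t).\<close>
definition gm :: "'a graph \<Rightarrow> nat \<Rightarrow> nat \<Rightarrow> (('a + nat) + nat \<times> nat) graph" where
  "gm M p t =
    (Inl ` (Inl ` fst M \<union> Inr ` {..<t}) \<union> Inr ` ({..<p-1} \<times> {..<t}),
     (\<lambda>e. (Inl \<circ> Inl) ` e) ` snd M
     \<union> {{Inl u, Inr w} | u w. u \<in> Inl ` fst M \<union> Inr ` {..<t} \<and> w \<in> {..<p-1} \<times> {..<t}}
     \<union> {{Inr (j, i), Inr (j', i')} | j i j' i'. j < p-1 \<and> j' < p-1 \<and> j \<noteq> j' \<and> i < t \<and> i' < t})"

definition M_prop :: "'a graph \<Rightarrow> nat graph \<Rightarrow> bool" where
  "M_prop H M \<longleftrightarrow> (\<exists>t. contains (gm M (chi H - 1) t) H)"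

definition M_fam :: "'a graph \<Rightarrow> nat graph set" where
  "M_fam H = {M. graph M \<and> M_prop H M \<and>
                 (\<forall>M0. subgraph_of M0 M \<and> M0 \<noteq> M \<longrightarrow> \<not> M_prop H M0)}"

definition M_dfam :: "'a digraph \<Rightarrow> nat digraph set" where
  "M_dfam vH = {vM. digraph vM \<and> underlying vM \<in> M_fam (underlying vH) \<and>
     (\<exists>t\<ge>1. \<exists>vG W. orientation vG (gm (underlying vM) (chi (underlying vH) - 1) t) \<and>
        (Inl \<circ> Inl) ` fst vM \<subseteq> W \<and> W \<subseteq> fst vG \<and>
        dcontains (induce vG W) vH \<and>
        diso (induce vG ((Inl \<circ> Inl) ` fst vM)) vM)}"

definition M'_fam :: "'a digraph \<Rightarrow> nat graph set" where
  "M'_fam vH = {M \<in> M_fam (underlying vH). \<forall>vM. orientation vM M \<longrightarrow> vM \<in> M_dfam vH}"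

definition ex :: "nat \<Rightarrow> 'b graph set \<Rightarrow> nat" where
  "ex n L = Max {card (snd G) | G :: nat graph. graph G \<and> fst G = {..<n} \<and>
                                                (\<forall>F\<in>L. \<not> contains G F)}"

definition Dg :: "'b graph \<Rightarrow> 'a digraph \<Rightarrow> nat" where
  "Dg G vH = card {A. orientation (fst G, A) G \<and> \<not> dcontains (fst G, A) vH}"

definition Dn :: "nat \<Rightarrow> 'a digraph \<Rightarrow> nat" where
  "Dn n vH = Max {Dg G vH | G :: nat graph. graph G \<and> fst G = {..<n}}"

text \<open>The star \<open>S_{t+1}\<close>: centre 0, leaves 1..t, and its two pure orientations.\<close>
definition star :: "nat \<Rightarrow> nat graph" where
  "star t = ({..t}, {{0, i} | i. i \<in> {1..t}})"

definition in_star :: "nat \<Rightarrow> nat digraph" where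
  "in_star t = ({..t}, {(i, 0) | i. i \<in> {1..t}})"

definition out_star :: "nat \<Rightarrow> nat digraph" where
  "out_star t = ({..t}, {(0, i) | i. i \<in> {1..t}})"

definition E_in :: "'a graph \<Rightarrow> 'a set \<Rightarrow> 'a set set" where
  "E_in G X = {e \<in> snd G. e \<subseteq> X}"

text \<open>A p-partition \<open>V_1 \<union> \<dots> \<union> V_p\<close> indexed by \<open>0..<p\<close> (parts may be empty).\<close>
definition is_partition :: "'a graph \<Rightarrow> nat \<Rightarrow> (nat \<Rightarrow> 'a set) \<Rightarrow> bool" where
  "is_partition G p P \<longleftrightarrow> (\<Union>i<p. P i) = fst G \<and>
      (\<forall>i<p. \<forall>j<p. i \<noteq> j \<longrightarrow> P i \<inter> P j = {})"

definition part_cost :: "'a graph \<Rightarrow> nat \<Rightarrow> (nat \<Rightarrow> 'a set) \<Rightarrow> nat" where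
  "part_cost G p P = (\<Sum>i<p. card (E_in G (P i)))"

definition optimal_partition :: "'a graph \<Rightarrow> nat \<Rightarrow> (nat \<Rightarrow> 'a set) \<Rightarrow> bool" where
  "optimal_partition G p P \<longleftrightarrow> is_partition G p P \<and>
      (\<forall>Q. is_partition G p Q \<longrightarrow> part_cost G p P \<le> part_cost G p Q)"

end

(*
Let beta = 1 - 1/p and compare log2 D(n) with the Turan number t_p(n). By progressive induction one may
assume that n is good: deleting a bounded number s of vertices lowers D by a factor of at least about
2^(beta s n). Then, for a small vertex set S of an extremal graph, some 2^(beta s n - O(1)) of the
H-free orientations agree away from the edges between S and the other vertices; by the Sauer-Shelah
lemma they shatter a set of that many such edges. Almost all orientations are universal with respect
to any large disjoint sets (they contain every coloured pattern across them), so shattered edges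
together with universal parts would produce copies of H. Applied to a universal p-partite piece S, with
the pure stars excluding vertices of large degree inside their own class, this gives a p-partition
with o(n^2) inner edges. In an optimal partition no class then contains a copy of a member of M'(H):
every orientation of such a copy would be completed to H by generic vertices of the other classes, so
that the fibre over its vertex set would be too small. Hence every class spans at most a edges.
*)
theory Submission
  imports Defs Complex_Main "HOL-Library.FuncSet" "HOL-Combinatorics.Transposition"
begin

section \<open>Shattered sets, exponential moments and small subsets\<close>

section \<open>Counting\<close>

text \<open>The counts compare exponential rates per vertex outside the universal piece S. With
  \<open>N = p * m\<close> one has \<beta> N = N - m, so the traces of an outside vertex on S must
  range over about 2^(N - m) values. A trace large on all p parts would complete H, so each trace is
  small on some part, and this leaves about 2^(N - m) of them. The count is thus nearly tight: any
  further restriction on many vertices contradicts it, and the part with small trace tells the class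
  of a vertex. S has bounded size, so equal traces come from the pigeonhole principle, and losses
  such as n^N and 2^(O(N^2)) vanish against 2^(c n). The pure stars enter only as p-colourings of H
  whose monochromatic arcs all leave, or all enter, one vertex. Both are used because the direction
  that prevails at a vertex with many inner neighbours cannot be foreseen. Goodness of n is itself a
  consequence of the structure: at a good n the excess of log2 D(n) over t_p(n) is at most p a,
  while at a bad n this nonnegative excess lies more than p a + 1 below an earlier value. That
  earlier n is then bad as well, and the chain cannot continue.\<close>

lemma pigeonhole_fibre:
  assumes "finite A" "finite C" "f ` A \<subseteq> C" "C \<noteq> {}"
  shows "\<exists>y\<in>C. card A \<le> card C * card {x \<in> A. f x = y}"
proof (rule ccontr)
  assume "\<not> ?thesis"
  then have less: "card C * card {x \<in> A. f x = y} < card A" if "y \<in> C" for y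
    using that by (auto simp: not_le)
  have "card A = (\<Sum>y\<in>C. card {x \<in> A. f x = y})"
    using sum.group[OF assms(1,2,3), of "\<lambda>_. 1::nat"] by simp
  then have "card C * card A = (\<Sum>y\<in>C. card C * card {x \<in> A. f x = y})"
    by (simp add: sum_distrib_left)
  also have "\<dots> < (\<Sum>y\<in>C. card A)"
    by (rule sum_strict_mono) (use assms less in auto)
  finally show False by simp
qed

definition shatters :: "'b set set \<Rightarrow> 'b set \<Rightarrow> bool" where
  "shatters \<F> Y \<longleftrightarrow> (\<forall>Z\<subseteq>Y. \<exists>F\<in>\<F>. F \<inter> Y = Z)"

text \<open>Pajor's form of the Sauer-Shelah lemma. The family is split into its members without
  \<open>a\<close> and its members with \<open>a\<close>, stripped of it. A set shattered by either
  half is shattered by the family, and a set shattered by both stays shattered after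
  \<open>a\<close> is added, so the overlap of the two counts is recovered.\<close>

lemma card_le_card_shattered:
  assumes "finite X" "\<F> \<subseteq> Pow X"
  shows "card \<F> \<le> card {Y. Y \<subseteq> X \<and> shatters \<F> Y}"
  using assms
proof (induction X arbitrary: \<F> rule: finite_induct)
  case empty
  then have "\<F> = {} \<or> \<F> = {{}}" by auto
  then show ?case
  proof
    assume "\<F> = {{}}"
    then have "{Y. Y \<subseteq> {} \<and> shatters \<F> Y} = {{}}" by (auto simp: shatters_def)
    then show ?thesis using \<open>\<F> = {{}}\<close> by simp
  qed simp
next
  case (insert a X)
  define A where "A = {F \<in> \<F>. a \<notin> F}"
  define B where "B = (\<lambda>F. F - {a}) ` {F \<in> \<F>. a \<in> F}"
  let ?sh = "\<lambda>\<G>. {Y. Y \<subseteq> X \<and> shatters \<G> Y}"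
  have finF: "finite \<F>" using insert.prems insert.hyps(1) by (meson finite.insertI finite_Pow_iff finite_subset)
  have AB: "A \<subseteq> Pow X" "B \<subseteq> Pow X" using insert.prems by (auto simp: A_def B_def)
  have inj: "inj_on (\<lambda>F. F - {a}) {F \<in> \<F>. a \<in> F}"
    by (rule inj_onI) (metis (mono_tags, lifting) insert_Diff mem_Collect_eq)
  have "card \<F> = card A + card {F \<in> \<F>. a \<in> F}"
    unfolding A_def using finF
    by (subst card_Un_disjoint[symmetric]) (auto intro: arg_cong[where f=card])
  then have cF: "card \<F> = card A + card B" unfolding B_def by (simp add: card_image inj)
  have ft: "finite (?sh \<G>)" for \<G> using insert.hyps(1) by simp
  have "card \<F> \<le> card (?sh A) + card (?sh B)"
    using insert.IH[OF AB(1)] insert.IH[OF AB(2)] cF by simp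
  also have "\<dots> = card (?sh A \<union> ?sh B) + card (?sh A \<inter> ?sh B)"
    by (rule card_Un_Int[OF ft ft])
  also have "\<dots> = card ((?sh A \<union> ?sh B) \<union> insert a ` (?sh A \<inter> ?sh B))"
  proof -
    have "card (insert a ` (?sh A \<inter> ?sh B)) = card (?sh A \<inter> ?sh B)"
      by (rule card_image) (use insert.hyps(2) in \<open>auto simp: inj_on_def\<close>)
    moreover have "card ((?sh A \<union> ?sh B) \<union> insert a ` (?sh A \<inter> ?sh B))
      = card (?sh A \<union> ?sh B) + card (insert a ` (?sh A \<inter> ?sh B))"
      by (rule card_Un_disjoint) (use ft insert.hyps in auto)
    ultimately show ?thesis by simp
  qed
  also have "\<dots> \<le> card {Y. Y \<subseteq> insert a X \<and> shatters \<F> Y}"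
  proof (rule card_mono)
    show "finite {Y. Y \<subseteq> insert a X \<and> shatters \<F> Y}" using insert.hyps(1) by simp
    have sA: "shatters \<F> Y" if "shatters A Y" for Y
      using that unfolding shatters_def A_def by blast
    have sB: "shatters \<F> Y" if YX: "Y \<subseteq> X" and YB: "shatters B Y" for Y
      unfolding shatters_def
    proof (intro allI impI)
      fix Z assume "Z \<subseteq> Y"
      then obtain F where "F \<in> \<F>" "a \<in> F" "(F - {a}) \<inter> Y = Z"
        using YB unfolding shatters_def B_def by blast
      moreover have "a \<notin> Y" using YX insert.hyps(2) by auto
      ultimately show "\<exists>F\<in>\<F>. F \<inter> Y = Z" by auto
    qed
    have sAB: "shatters \<F> (insert a Y)" if Y: "Y \<subseteq> X" "shatters A Y" "shatters B Y" for Y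
      unfolding shatters_def
    proof (intro allI impI)
      fix Z assume Z: "Z \<subseteq> insert a Y"
      have aY: "a \<notin> Y" using Y insert.hyps(2) by auto
      show "\<exists>F\<in>\<F>. F \<inter> insert a Y = Z"
      proof (cases "a \<in> Z")
        case True
        have "Z - {a} \<subseteq> Y" using Z by auto
        then obtain F where "F \<in> \<F>" "a \<in> F" "(F - {a}) \<inter> Y = Z - {a}"
          using Y(3) unfolding shatters_def B_def by blast
        then show ?thesis using True aY by (intro bexI[of _ F]) auto
      next
        case False
        then have "Z \<subseteq> Y" using Z by auto
        then obtain F where "F \<in> \<F>" "a \<notin> F" "F \<inter> Y = Z"
          using Y(2) unfolding shatters_def A_def by blast
        then show ?thesis by (intro bexI[of _ F]) auto
      qed
    qed
    show "(?sh A \<union> ?sh B) \<union> insert a ` (?sh A \<inter> ?sh B)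
        \<subseteq> {Y. Y \<subseteq> insert a X \<and> shatters \<F> Y}"
      using sA sB sAB by auto
  qed
  finally show ?case .
qed

text \<open>Exponential-moment bound: weight each function by \<open>\<mu>\<close> to the number of its hits.\<close>
lemma card_PiE_hits_le:
  fixes \<mu> :: real
  assumes "finite W" "\<And>v. v \<in> W \<Longrightarrow> finite (R v)" "\<And>v. v \<in> W \<Longrightarrow> B v \<subseteq> R v" "\<mu> \<ge> 1"
  shows "card {g \<in> PiE W R. u \<le> card {v \<in> W. g v \<in> B v}} * \<mu> ^ u
    \<le> (\<Prod>v\<in>W. card (R v) + (\<mu> - 1) * card (B v))"
proof -
  let ?w = "\<lambda>v r. if r \<in> B v then \<mu> else 1"
  let ?H = "{g \<in> PiE W R. u \<le> card {v \<in> W. g v \<in> B v}}"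
  have fin: "finite (PiE W R)" using assms by (intro finite_PiE) auto
  have w: "(\<Prod>v\<in>W. ?w v (g v)) = \<mu> ^ card {v \<in> W. g v \<in> B v}" for g
    using assms(1) by (simp add: prod.If_cases Int_def)
  have "card ?H * \<mu> ^ u = (\<Sum>g\<in>?H. \<mu> ^ u)" by simp
  also have "\<dots> \<le> (\<Sum>g\<in>?H. \<Prod>v\<in>W. ?w v (g v))"
    unfolding w by (rule sum_mono) (use assms(4) in \<open>auto intro: power_increasing\<close>)
  also have "\<dots> \<le> (\<Sum>g\<in>PiE W R. \<Prod>v\<in>W. ?w v (g v))"
    by (rule sum_mono2) (use fin assms(4) in \<open>auto intro!: prod_nonneg\<close>)
  \<comment> \<open>The sum over all functions of a product of weights factorises over the
    coordinates.\<close>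
  also have "\<dots> = (\<Prod>v\<in>W. \<Sum>r\<in>R v. ?w v r)"
    using assms by (subst prod_sum_PiE) auto
  also have "\<dots> = (\<Prod>v\<in>W. card (R v) + (\<mu> - 1) * card (B v))"
  proof (rule prod.cong[OF refl])
    fix v assume v: "v \<in> W"
    have "(\<Sum>r\<in>R v. ?w v r) = (\<Sum>r\<in>R v. 1 + (\<mu> - 1) * (if r \<in> B v then 1 else 0))"
      by (intro sum.cong) auto
    also have "\<dots> = card (R v) + (\<mu> - 1) * card (R v \<inter> B v)"
      using assms(2)[OF v]
      by (simp add: sum.distrib sum_distrib_left[symmetric] sum.If_cases Int_def)
    also have "R v \<inter> B v = B v" using assms(3)[OF v] by auto
    finally show "(\<Sum>r\<in>R v. ?w v r) = card (R v) + (\<mu> - 1) * card (B v)" .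
  qed
  finally show ?thesis .
qed

text \<open>Each subset \<open>r\<close> is weighted by \<open>lam ^ card r\<close>. The total
  weight is \<open>(1 + lam) ^ card A\<close>, and a subset with fewer than \<delta> card A elements
  weighs at least \<open>lam\<close> to that power. First \<open>lam\<close> is chosen with
  \<open>1 + lam\<close> at most 2^(\<epsilon>/2), then \<delta> so small that undoing the weight
  costs at most another 2^(\<epsilon>/2) per element.\<close>

lemma card_small_subsets_le:
  fixes \<epsilon> :: real
  assumes "\<epsilon> > 0"
  obtains \<delta> :: real where "\<delta> > 0" "\<delta> \<le> 1" "\<And>A :: 'b set. finite A \<Longrightarrow>
    card {r. r \<subseteq> A \<and> real (card r) < \<delta> * card A} \<le> 2 powr (\<epsilon> * card A)"
proof -
  define x where "x = 2 powr (\<epsilon> / 2) - 1"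
  define lam where "lam = min x (1/2)"
  have x: "x > 0" unfolding x_def using assms by simp
  have l: "lam > 0" "lam < 1" "1 + lam \<le> 2 powr (\<epsilon> / 2)"
    using x unfolding lam_def by (auto simp: x_def)
  define \<delta> where "\<delta> = min 1 (\<epsilon> / 2 / (- log 2 lam))"
  have ll: "log 2 lam < 0" using l by simp
  have d: "\<delta> > 0" "\<delta> \<le> 1" unfolding \<delta>_def using assms ll by (auto simp: divide_pos_pos divide_pos_neg)
  have "\<delta> * (- log 2 lam) \<le> \<epsilon> / 2 / (- log 2 lam) * (- log 2 lam)"
    by (rule mult_right_mono) (use ll in \<open>auto simp: \<delta>_def\<close>)
  also have "\<dots> = \<epsilon> / 2" using ll by simp
  finally have dl: "- (\<delta> * log 2 lam) \<le> \<epsilon> / 2" by simp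
  have main: "card {r. r \<subseteq> A \<and> real (card r) < \<delta> * card A} \<le> 2 powr (\<epsilon> * card A)"
    if fA: "finite A" for A :: "'b set"
  proof -
    let ?m = "real (card A)"
    let ?S = "{r. r \<subseteq> A \<and> real (card r) < \<delta> * ?m}"
    have "card ?S * lam powr (\<delta> * ?m) = (\<Sum>r\<in>?S. lam powr (\<delta> * ?m))" by simp
    also have "\<dots> \<le> (\<Sum>r\<in>?S. lam ^ card r)"
    proof (rule sum_mono)
      fix r assume "r \<in> ?S"
      then have "lam powr (\<delta> * ?m) \<le> lam powr (card r)"
        using l by (intro powr_mono') auto
      then show "lam powr (\<delta> * ?m) \<le> lam ^ card r" using l by (simp add: powr_realpow)
    qed
    also have "\<dots> \<le> (\<Sum>r\<in>Pow A. lam ^ card r)"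
      by (rule sum_mono2) (use fA l in auto)
    also have "\<dots> = (1 + lam) ^ card A"
      using fA
    proof (induction A rule: finite_induct)
      case (insert a A)
      have "(\<Sum>r\<in>Pow (insert a A). lam ^ card r)
          = (\<Sum>r\<in>Pow A. lam ^ card r) + (\<Sum>r\<in>insert a ` Pow A. lam ^ card r)"
        unfolding Pow_insert using insert.hyps by (intro sum.union_disjoint) auto
      also have "(\<Sum>r\<in>insert a ` Pow A. lam ^ card r) = (\<Sum>r\<in>Pow A. lam * lam ^ card r)"
      proof (subst sum.reindex)
        show "inj_on (insert a) (Pow A)" using insert.hyps(2) by (auto simp: inj_on_def)
        show "sum ((\<lambda>r. lam ^ card r) \<circ> insert a) (Pow A) = (\<Sum>r\<in>Pow A. lam * lam ^ card r)"
        proof (rule sum.cong[OF refl])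
          fix r assume "r \<in> Pow A"
          then have "finite r" "a \<notin> r" using insert.hyps finite_subset by auto
          then show "((\<lambda>r. lam ^ card r) \<circ> insert a) r = lam * lam ^ card r" by simp
        qed
      qed
      finally show ?case using insert by (simp add: sum_distrib_left[symmetric] algebra_simps)
    qed simp
    also have "\<dots> = (1 + lam) powr ?m" using l by (simp add: powr_realpow)
    also have "\<dots> \<le> (2 powr (\<epsilon> / 2)) powr ?m" using l by (intro powr_mono2) auto
    finally have 1: "card ?S * lam powr (\<delta> * ?m) \<le> 2 powr (\<epsilon> / 2 * ?m)" by (simp add: powr_powr)
    have lp: "lam = 2 powr (log 2 lam)" using l by simp
    have "lam powr (\<delta> * ?m) = 2 powr (log 2 lam * (\<delta> * ?m))"
      by (subst lp) (simp only: powr_powr)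
    also have "\<dots> \<ge> 2 powr (- (\<epsilon> / 2 * ?m))"
      using mult_right_mono[OF dl, of ?m] by (intro powr_mono) (auto simp: algebra_simps)
    finally have "card ?S * 2 powr (- (\<epsilon> / 2 * ?m)) \<le> 2 powr (\<epsilon> / 2 * ?m)"
      using 1 by (meson mult_left_mono of_nat_0_le_iff order_trans)
    then have "card ?S \<le> 2 powr (\<epsilon> / 2 * ?m) / 2 powr (- (\<epsilon> / 2 * ?m))"
      by (simp add: pos_le_divide_eq)
    also have "\<dots> = 2 powr (\<epsilon> * ?m)" by (simp add: powr_diff[symmetric])
    finally show ?thesis .
  qed
  show ?thesis by (rule that[OF d main])
qed

section \<open>Most orientations contain every coloured pattern across large sets\<close>

section \<open>Universal orientations\<close>

text \<open>An orientation of a graph on natural numbers with edge set \<open>E\<close> is encoded by the set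
  \<open>F \<subseteq> E\<close> of the edges that are directed from their smaller to their larger end.\<close>
definition arc :: "nat set set \<Rightarrow> nat set set \<Rightarrow> nat \<Rightarrow> nat \<Rightarrow> bool" where
  "arc E F x y \<longleftrightarrow> {x, y} \<in> E \<and> x \<noteq> y \<and> ({x, y} \<in> F \<longleftrightarrow> x < y)"

definition emb :: "nat set \<Rightarrow> nat set set \<Rightarrow> nat set set \<Rightarrow> 'l set \<Rightarrow> ('l \<times> 'l) set \<Rightarrow> bool" where
  "emb V E F VL AL \<longleftrightarrow> (\<exists>f. inj_on f VL \<and> f ` VL \<subseteq> V \<and> (\<forall>(x, y)\<in>AL. arc E F (f x) (f y)))"

text \<open>Each label \<open>l\<close> may be confined to an arbitrary set \<open>X l\<close> of at
  least \<open>d\<close> vertices in its part. Arcs inside a part are not asked for; wherever the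
  pattern has some, they are supplied separately.\<close>

definition univ :: "'l set \<Rightarrow> ('l \<times> 'l) set \<Rightarrow> nat \<Rightarrow> (nat \<Rightarrow> nat set) \<Rightarrow> nat set set \<Rightarrow> nat
    \<Rightarrow> nat set set \<Rightarrow> bool" where
  "univ VL AL k P E d F \<longleftrightarrow> (\<forall>c X. (\<forall>l\<in>VL. c l < k \<and> X l \<subseteq> P (c l) \<and> d \<le> card (X l)) \<longrightarrow>
     (\<exists>f. inj_on f VL \<and> (\<forall>l\<in>VL. f l \<in> X l) \<and>
          (\<forall>(x, y)\<in>AL. c x \<noteq> c y \<longrightarrow> arc E F (f x) (f y))))"

lemma arc_flip:
  assumes "{x, y} \<in> E" "x \<noteq> y"
  shows "arc E F x y \<longleftrightarrow> \<not> arc E F y x"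
  using assms by (auto simp: arc_def insert_commute)

text \<open>On \<open>Y\<close> the set \<open>F\<close> is exactly the code of the arcs in
  \<open>A\<close>. The only danger is that the image of one arc is the image of another one read
  backwards; injectivity of \<open>g\<close> and antisymmetry of \<open>AL\<close> exclude
  this.\<close>

lemma arcs_of_pattern:
  assumes inj: "inj_on g VL" and AL: "AL \<subseteq> VL \<times> VL" "\<And>x y. (x, y) \<in> AL \<Longrightarrow> (y, x) \<notin> AL"
    and A: "A \<subseteq> AL" "\<And>x y. (x, y) \<in> A \<Longrightarrow> {g x, g y} \<in> E \<and> {g x, g y} \<in> Y"
    and F: "F \<inter> Y = {{g x, g y} | x y. (x, y) \<in> A \<and> g x < g y}"
    and xy: "(x, y) \<in> A"
  shows "arc E F (g x) (g y)"
proof -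
  have V: "x \<in> VL" "y \<in> VL" using A(1) AL(1) xy by auto
  have ne: "x \<noteq> y" using AL(2)[of x x] A(1) xy by auto
  then have gne: "g x \<noteq> g y" using inj V by (auto dest: inj_onD)
  have "{g x, g y} \<in> F \<longleftrightarrow> g x < g y"
  proof
    assume "{g x, g y} \<in> F"
    then have "{g x, g y} \<in> F \<inter> Y" using A(2)[OF xy] by simp
    then obtain u v where uv: "(u, v) \<in> A" "g u < g v" "{g x, g y} = {g u, g v}"
      unfolding F by auto
    have "u \<in> VL" "v \<in> VL" using A(1) AL(1) uv by auto
    from uv(3) consider "g x = g u" "g y = g v" | "g x = g v" "g y = g u"
      by (auto simp: doubleton_eq_iff)
    then show "g x < g y"
    proof cases
      case 2
      then have "x = v" "y = u" using inj V \<open>u \<in> VL\<close> \<open>v \<in> VL\<close> by (auto dest: inj_onD)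
      then show ?thesis using uv(1) xy AL(2) A(1) by blast
    qed (use uv in simp)
  next
    assume "g x < g y"
    then have "{g x, g y} \<in> F \<inter> Y" unfolding F using xy by auto
    then show "{g x, g y} \<in> F" by simp
  qed
  then show ?thesis using A(2)[OF xy] gne by (simp add: arc_def)
qed

text \<open>Shattered edges can be directed at will by choosing the member of the family, so a copy
  appears as soon as each arc of the pattern lies on a shattered edge or has the right direction in
  all members.\<close>

lemma emb_of_shattered:
  assumes sh: "shatters \<E> Y" "Y \<subseteq> E"
    and g: "inj_on g VL" "g ` VL \<subseteq> V"
    and AL: "AL \<subseteq> VL \<times> VL" "\<And>x y. (x, y) \<in> AL \<Longrightarrow> (y, x) \<notin> AL"
    and arcs: "\<And>x y. (x, y) \<in> AL \<Longrightarrow> {g x, g y} \<in> Y \<or> (\<forall>F\<in>\<E>. arc E F (g x) (g y))"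
  shows "\<exists>F\<in>\<E>. emb V E F VL AL"
proof -
  let ?A = "{(x, y) \<in> AL. {g x, g y} \<in> Y}"
  let ?Z = "{{g x, g y} | x y. (x, y) \<in> ?A \<and> g x < g y}"
  have "?Z \<subseteq> Y" by auto
  then have "\<exists>F\<in>\<E>. F \<inter> Y = ?Z" using sh(1) unfolding shatters_def by (elim allE impE)
  then obtain F where F: "F \<in> \<E>" "F \<inter> Y = ?Z" by (elim bexE)
  have "arc E F (g x) (g y)" if "(x, y) \<in> AL" for x y
  proof (cases "{g x, g y} \<in> Y")
    case True
    show ?thesis
      by (rule arcs_of_pattern[OF g(1) AL(1) AL(2), of "?A" E Y F]) (use sh(2) F(2) True that in auto)
  qed (use arcs[OF that] F(1) in auto)
  then show ?thesis unfolding emb_def using F(1) g by blast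
qed

text \<open>Independence by counting: on one block \<open>D r\<close> all choices but
  \<open>Q r\<close> remain, a fraction of at most 1 - 2^(-w), and the other blocks are untouched by
  this choice.\<close>

lemma card_avoid_patterns_le:
  assumes "finite E" "\<And>a. a < r \<Longrightarrow> D a \<subseteq> E \<and> Q a \<subseteq> D a \<and> card (D a) \<le> w"
    and "\<And>a b. a < r \<Longrightarrow> b < r \<Longrightarrow> a \<noteq> b \<Longrightarrow> D a \<inter> D b = {}"
  shows "real (card {F. F \<subseteq> E \<and> (\<forall>a<r. F \<inter> D a \<noteq> Q a)}) \<le> 2 ^ card E * (1 - 1 / 2 ^ w) ^ r"
  using assms
proof (induction r arbitrary: E)
  case 0
  then show ?case by (simp add: card_Pow[symmetric] Pow_def)
next
  case (Suc r)
  let ?E = "E - D r"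
  let ?L = "{F. F \<subseteq> E \<and> (\<forall>a<Suc r. F \<inter> D a \<noteq> Q a)}"
  let ?S = "{F. F \<subseteq> ?E \<and> (\<forall>a<r. F \<inter> D a \<noteq> Q a)}"
  have Dr: "D r \<subseteq> E" "Q r \<subseteq> D r" "card (D r) \<le> w" using Suc.prems(2) by auto
  have fD: "finite (D r)" using Dr Suc.prems(1) finite_subset by auto
  have disj: "D a \<inter> D r = {}" if "a < r" for a using Suc.prems(3)[of a r] that by auto
  have IH: "real (card ?S) \<le> 2 ^ card ?E * (1 - 1 / 2 ^ w) ^ r"
  proof (rule Suc.IH)
    show "D a \<subseteq> ?E \<and> Q a \<subseteq> D a \<and> card (D a) \<le> w" if "a < r" for a
      using Suc.prems(2)[of a] disj[OF that] that by auto
  qed (use Suc.prems in auto)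
  have "card ?L \<le> card ((Pow (D r) - {Q r}) \<times> ?S)"
  proof (rule card_inj_on_le)
    show "inj_on (\<lambda>F. (F \<inter> D r, F - D r)) ?L" by (rule inj_onI) auto
    show "(\<lambda>F. (F \<inter> D r, F - D r)) ` ?L \<subseteq> (Pow (D r) - {Q r}) \<times> ?S"
    proof safe
      fix F a assume F: "F \<subseteq> E" "\<forall>a<Suc r. F \<inter> D a \<noteq> Q a" and a: "a < r" "(F - D r) \<inter> D a = Q a"
      have "(F - D r) \<inter> D a = F \<inter> D a" using disj[OF a(1)] by auto
      then show False using F(2)[rule_format, of a] a by simp
    qed auto
    show "finite ((Pow (D r) - {Q r}) \<times> ?S)" using fD Suc.prems(1) by auto
  qed
  also have "\<dots> = (2 ^ card (D r) - 1) * card ?S"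
    using fD Dr by (simp add: card_cartesian_product card_Pow)
  finally have "real (card ?L) \<le> real ((2 ^ card (D r) - 1) * card ?S)" by (simp only: of_nat_le_iff)
  also have "\<dots> = (2 ^ card (D r) - 1) * real (card ?S)" by (simp add: of_nat_diff)
  also have "\<dots> \<le> (2 ^ card (D r) * (1 - 1 / 2 ^ w)) * (2 ^ card ?E * (1 - 1 / 2 ^ w) ^ r)"
  proof (rule mult_mono)
    have "(1::real) / 2 ^ w \<le> 1 / 2 ^ card (D r)"
      using Dr(3) by (intro divide_left_mono power_increasing) auto
    then have "(2::real) ^ card (D r) * (1 / 2 ^ w) \<le> 2 ^ card (D r) * (1 / 2 ^ card (D r))"
      by (intro mult_left_mono) auto
    then show "(2::real) ^ card (D r) - 1 \<le> 2 ^ card (D r) * (1 - 1 / 2 ^ w)"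
      by (simp add: right_diff_distrib)
  qed (use IH in \<open>auto simp: field_simps\<close>)
  also have "\<dots> = 2 ^ (card (D r) + card ?E) * (1 - 1 / 2 ^ w) ^ Suc r"
    by (simp add: power_add)
  also have "card (D r) + card ?E = card E"
    using fD Dr Suc.prems(1) by (metis card_Diff_subset card_mono le_add_diff_inverse)
  finally show ?case .
qed

lemma card_PiE_pair_le:
  assumes "finite I" "l \<in> I" "l' \<in> I" "l \<noteq> l'" "\<And>i. i \<in> I \<Longrightarrow> finite (X i) \<and> card (X i) = d" "finite B"
  shows "card {g \<in> PiE I X. (g l, g l') \<in> B} \<le> card B * d ^ (card I - 2)"
proof -
  let ?J = "I - {l, l'}"
  have "card {g \<in> PiE I X. (g l, g l') \<in> B} \<le> card (B \<times> PiE ?J X)"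
  proof (rule card_inj_on_le)
    show "inj_on (\<lambda>g. ((g l, g l'), restrict g ?J)) {g \<in> PiE I X. (g l, g l') \<in> B}"
    proof (rule inj_onI)
      fix g h assume gh: "g \<in> {g \<in> PiE I X. (g l, g l') \<in> B}" "h \<in> {g \<in> PiE I X. (g l, g l') \<in> B}"
        and eq: "((g l, g l'), restrict g ?J) = ((h l, h l'), restrict h ?J)"
      show "g = h"
      proof (rule PiE_ext)
        show "g \<in> PiE I X" "h \<in> PiE I X" using gh by auto
        show "g i = h i" if "i \<in> I" for i
          using eq that by (cases "i \<in> {l, l'}") (auto dest!: fun_cong[of _ _ i])
      qed
    qed
    show "(\<lambda>g. ((g l, g l'), restrict g ?J)) ` {g \<in> PiE I X. (g l, g l') \<in> B} \<subseteq> B \<times> PiE ?J X"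
      by (auto dest: PiE_mem split: if_split_asm)
    show "finite (B \<times> PiE ?J X)" using assms by (auto intro!: finite_PiE)
  qed
  also have "\<dots> = card B * (\<Prod>i\<in>?J. card (X i))"
    using assms(1) by (simp add: card_cartesian_product card_PiE)
  also have "(\<Prod>i\<in>?J. card (X i)) = (\<Prod>i\<in>?J. d)" by (rule prod.cong) (use assms in auto)
  also have "\<dots> = d ^ card ?J" by simp
  also have "card ?J = card I - 2" using assms(1-4) by (simp add: card_Diff_subset)
  finally show ?thesis .
qed

text \<open>Union bound: a transversal chosen uniformly at random avoids few bad pairs with positive
  probability.\<close>
lemma ex_transversal:
  assumes "finite I" "card I \<le> w" "\<And>i. i \<in> I \<Longrightarrow> finite (X i) \<and> card (X i) = d" "finite B"
    and "card B \<le> b" "w ^ 2 * b < d ^ 2"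
  shows "\<exists>g. (\<forall>i\<in>I. g i \<in> X i) \<and> (\<forall>i\<in>I. \<forall>j\<in>I. i \<noteq> j \<longrightarrow> (g i, g j) \<notin> B)"
proof (rule ccontr)
  assume no: "\<not> ?thesis"
  have d0: "d > 0" using assms(6) by (cases d) auto
  let ?P = "{(i, j). i \<in> I \<and> j \<in> I \<and> i \<noteq> j}"
  have fP: "finite ?P" by (rule finite_subset[of _ "I \<times> I"]) (use assms(1) in auto)
  have cP: "card ?P \<le> w ^ 2"
  proof -
    have "card ?P \<le> card (I \<times> I)" by (rule card_mono) (use assms(1) in auto)
    also have "\<dots> \<le> w ^ 2" using assms(2) by (simp add: card_cartesian_product power2_eq_square mult_mono)
    finally show ?thesis .
  qed
  have fin: "finite (PiE I X)" using assms by (auto intro!: finite_PiE)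
  have "PiE I X \<subseteq> (\<Union>(i, j)\<in>?P. {g \<in> PiE I X. (g i, g j) \<in> B})"
  proof
    fix g assume g: "g \<in> PiE I X"
    then have "\<forall>i\<in>I. g i \<in> X i" by auto
    then obtain i j where "i \<in> I" "j \<in> I" "i \<noteq> j" "(g i, g j) \<in> B" using no by blast
    then show "g \<in> (\<Union>(i, j)\<in>?P. {g \<in> PiE I X. (g i, g j) \<in> B})" using g by blast
  qed
  then have "card (PiE I X) \<le> card (\<Union>(i, j)\<in>?P. {g \<in> PiE I X. (g i, g j) \<in> B})"
    by (intro card_mono) (use fP fin in auto)
  also have "\<dots> \<le> (\<Sum>e\<in>?P. card (case e of (i, j) \<Rightarrow> {g \<in> PiE I X. (g i, g j) \<in> B}))"
    by (rule card_UN_le[OF fP])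
  also have "\<dots> \<le> (\<Sum>e\<in>?P. b * d ^ (card I - 2))"
  proof (rule sum_mono)
    fix e assume "e \<in> ?P"
    then obtain i j where e: "e = (i, j)" "i \<in> I" "j \<in> I" "i \<noteq> j" by auto
    have "card {g \<in> PiE I X. (g i, g j) \<in> B} \<le> card B * d ^ (card I - 2)"
      by (rule card_PiE_pair_le) (use assms e in auto)
    also have "\<dots> \<le> b * d ^ (card I - 2)" using assms(5) by simp
    finally show "card (case e of (i, j) \<Rightarrow> {g \<in> PiE I X. (g i, g j) \<in> B}) \<le> b * d ^ (card I - 2)"
      using e by simp
  qed
  also have "\<dots> = card ?P * b * d ^ (card I - 2)" by simp
  finally have le: "card (PiE I X) \<le> card ?P * b * d ^ (card I - 2)" .
  have "card (PiE I X) = d ^ card I" using assms(1,3) by (simp add: card_PiE)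
  then have le': "d ^ card I \<le> card ?P * b * d ^ (card I - 2)" using le by simp
  show False
  proof (cases "card I \<ge> 2")
    case True
    have "card ?P * b \<le> w ^ 2 * b" using cP by simp
    also have "\<dots> < d ^ 2" by (rule assms(6))
    finally have "card ?P * b * d ^ (card I - 2) < d ^ 2 * d ^ (card I - 2)" using d0 by simp
    also have "\<dots> = d ^ card I" using True by (metis le_add_diff_inverse power_add)
    finally show False using le' by simp
  next
    case False
    have "?P = {}"
    proof (rule ccontr)
      assume "?P \<noteq> {}"
      then obtain i j where "{i, j} \<subseteq> I" "i \<noteq> j" by auto
      then have "card {i, j} \<le> card I" using assms(1) by (intro card_mono) auto
      then show False using False \<open>i \<noteq> j\<close> by simp
    qed
    then have "card ?P = 0" by (simp only: card.empty)
    then have "d ^ card I \<le> 0" using le' by (simp only: mult_zero_left)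
    then show False using d0 by simp
  qed
qed

lemma card_pairs_le:
  assumes "finite (S :: 'b set set)"
  shows "finite {(u, v). {u, v} \<in> S} \<and> card {(u, v). {u, v} \<in> S} \<le> 2 * card S"
proof -
  have one: "finite {(u, v). {u, v} = e} \<and> card {(u, v). {u, v} = e} \<le> 2" for e :: "'b set"
  proof (cases "\<exists>a b. e = {a, b}")
    case True
    then obtain a b where e: "e = {a, b}" by blast
    have sub: "{(u, v). {u, v} = e} \<subseteq> {(a, b), (b, a)}"
      unfolding e by (auto simp: doubleton_eq_iff)
    have "card {(u, v). {u, v} = e} \<le> card {(a, b), (b, a)}"
      by (rule card_mono[OF _ sub]) simp
    also have "\<dots> \<le> 2" by (cases "a = b") auto
    finally show ?thesis using finite_subset[OF sub] by simp
  next
    case False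
    then have "{(u, v). {u, v} = e} = {}" by auto
    then show ?thesis by simp
  qed
  have eq: "{(u, v). {u, v} \<in> S} = (\<Union>e\<in>S. {(u, v). {u, v} = e})" by auto
  have "card (\<Union>e\<in>S. {(u, v). {u, v} = e}) \<le> (\<Sum>e\<in>S. card {(u, v). {u, v} = e})"
    by (rule card_UN_le[OF assms])
  also have "\<dots> \<le> (\<Sum>e\<in>S. 2)" by (rule sum_mono) (use one in auto)
  finally show ?thesis unfolding eq using assms one by auto
qed

text \<open>Edge-disjoint candidates for a copy are chosen greedily; in a random orientation they become
  copies independently.\<close>
lemma card_no_copy_le:
  fixes c :: "'l \<Rightarrow> nat" and X :: "'l \<Rightarrow> nat set"
  assumes fE: "finite E" and fVL: "finite VL" and w: "card VL \<le> w"
    and AL: "AL \<subseteq> VL \<times> VL" "\<And>x y. (x, y) \<in> AL \<Longrightarrow> (y, x) \<notin> AL"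
    and X: "\<And>l. l \<in> VL \<Longrightarrow> finite (X l) \<and> card (X l) = d"
    and Ms: "\<And>l l' u v. l \<in> VL \<Longrightarrow> l' \<in> VL \<Longrightarrow> c l \<noteq> c l' \<Longrightarrow> u \<in> X l \<Longrightarrow> v \<in> X l' \<Longrightarrow>
      {u, v} \<notin> E \<Longrightarrow> (u, v) \<in> Ms" "finite Ms" "card Ms \<le> \<mu>"
    and num: "w ^ 2 * (w * d + \<mu> + 2 * r * w ^ 2) < d ^ 2"
  shows "real (card {F. F \<subseteq> E \<and> \<not> (\<exists>f. inj_on f VL \<and> (\<forall>l\<in>VL. f l \<in> X l) \<and>
          (\<forall>(x, y)\<in>AL. c x \<noteq> c y \<longrightarrow> arc E F (f x) (f y)))}) \<le> 2 ^ card E * (1 - 1 / 2 ^ w ^ 2) ^ r"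
proof -
  define A where "A = {(x, y) \<in> AL. c x \<noteq> c y}"
  define es where "es g = (\<lambda>(x, y). {g x, g y}) ` A" for g :: "'l \<Rightarrow> nat"
  define good where "good g \<longleftrightarrow> inj_on g VL \<and> (\<forall>l\<in>VL. g l \<in> X l) \<and> es g \<subseteq> E" for g
  have A: "(x, y) \<in> A \<longleftrightarrow> (x, y) \<in> AL \<and> c x \<noteq> c y" for x y unfolding A_def by simp
  have fAL: "finite AL" using AL(1) fVL by (meson finite_SigmaI finite_subset)
  have cAL: "card A \<le> w ^ 2"
  proof -
    have "card A \<le> card (VL \<times> VL)" by (rule card_mono) (use AL(1) fVL in \<open>auto simp: A_def\<close>)
    also have "\<dots> \<le> w ^ 2" using w by (simp add: card_cartesian_product power2_eq_square mult_mono)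
    finally show ?thesis .
  qed
  have fA: "finite A" using fAL by (rule rev_finite_subset) (auto simp: A_def)
  have ces: "finite (es g) \<and> card (es g) \<le> w ^ 2" for g
    using card_image_le[OF fA, of "\<lambda>(x, y). {g x, g y}"] cAL fA unfolding es_def by auto
  have greedy: "\<exists>G. (\<forall>a<r'. good (G a)) \<and> (\<forall>a<r'. \<forall>b<r'. a \<noteq> b \<longrightarrow> es (G a) \<inter> es (G b) = {})"
    if "r' \<le> r" for r'
    using that
  proof (induction r')
    case (Suc r')
    then obtain G where G: "\<And>a. a < r' \<Longrightarrow> good (G a)"
      "\<And>a b. a < r' \<Longrightarrow> b < r' \<Longrightarrow> a \<noteq> b \<Longrightarrow> es (G a) \<inter> es (G b) = {}" by (metis Suc_leD)
    define S where "S = (\<Union>a<r'. es (G a))"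
    have fS: "finite S" unfolding S_def using ces by auto
    have cS: "card S \<le> r * w ^ 2"
    proof -
      have "card S \<le> (\<Sum>a<r'. card (es (G a)))" unfolding S_def by (rule card_UN_le) simp
      also have "\<dots> \<le> (\<Sum>a<r'. w ^ 2)" by (rule sum_mono) (use ces in auto)
      also have "\<dots> \<le> r * w ^ 2" using Suc.prems by simp
      finally show ?thesis .
    qed
    \<comment> \<open>Three kinds of bad pairs: equal vertices, for injectivity; pairs of
      \<open>Ms\<close>, which may be missing edges; and pairs forming an edge of an earlier
      candidate, for edge-disjointness. The hypothesis \<open>num\<close> is the condition of
      \<open>ex_transversal\<close> for this set.\<close>
    define B where "B = (\<lambda>u. (u, u)) ` (\<Union>l\<in>VL. X l) \<union> Ms \<union> {(u, v). {u, v} \<in> S}"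
    have fB: "finite B" unfolding B_def using fVL X Ms(2) card_pairs_le[OF fS] by auto
    have "card B \<le> card ((\<lambda>u. (u, u)) ` (\<Union>l\<in>VL. X l)) + card Ms + card {(u, v). {u, v} \<in> S}"
      unfolding B_def by (meson card_Un_le add_le_mono1 order_trans)
    also have "card ((\<lambda>u. (u, u)) ` (\<Union>l\<in>VL. X l)) \<le> w * d"
    proof -
      have "card ((\<lambda>u. (u, u)) ` (\<Union>l\<in>VL. X l)) \<le> card (\<Union>l\<in>VL. X l)"
        by (rule card_image_le) (use fVL X in auto)
      also have "\<dots> \<le> (\<Sum>l\<in>VL. card (X l))" by (rule card_UN_le[OF fVL])
      also have "\<dots> = card VL * d" using X by simp
      also have "\<dots> \<le> w * d" using w by simp
      finally show ?thesis .
    qed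
    finally have cB: "card B \<le> w * d + \<mu> + 2 * r * w ^ 2"
      using Ms(3) card_pairs_le[OF fS] cS by linarith
    obtain g where g: "\<And>i. i \<in> VL \<Longrightarrow> g i \<in> X i" "\<And>i j. i \<in> VL \<Longrightarrow> j \<in> VL \<Longrightarrow> i \<noteq> j \<Longrightarrow> (g i, g j) \<notin> B"
      using ex_transversal[OF fVL w _ fB cB num, of X] X by blast
    have "inj_on g VL"
    proof (rule inj_onI)
      fix i j assume "i \<in> VL" "j \<in> VL" "g i = g j"
      then show "i = j" using g(1)[of i] g(2)[of i j] by (cases "i = j") (auto simp: B_def)
    qed
    moreover have edge: "{g x, g y} \<in> E \<and> {g x, g y} \<notin> S" if "(x, y) \<in> A" for x y
    proof -
      have xy: "x \<in> VL" "y \<in> VL" "c x \<noteq> c y" using that AL(1) unfolding A by auto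
      then have "x \<noteq> y" by auto
      then have "(g x, g y) \<notin> B" using g(2) xy by blast
      then show ?thesis using Ms(1)[OF xy g(1)[OF xy(1)] g(1)[OF xy(2)]] by (auto simp: B_def)
    qed
    ultimately have gg: "good g" using g(1) unfolding good_def es_def by auto
    have disj: "es g \<inter> es (G a) = {}" if "a < r'" for a
    proof -
      have "es (G a) \<subseteq> S" using that unfolding S_def by auto
      then show ?thesis using edge unfolding es_def[of g] by auto
    qed
    let ?G = "G(r' := g)"
    show ?case
    proof (rule exI[of _ ?G], intro conjI allI impI)
      fix a assume "a < Suc r'"
      then show "good (?G a)" using G(1)[of a] gg by (auto simp: less_Suc_eq)
    next
      fix a b assume ab: "a < Suc r'" "b < Suc r'" "a \<noteq> b"
      then consider "a < r'" "b < r'" | "a = r'" "b < r'" | "a < r'" "b = r'" by linarith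
      then show "es (?G a) \<inter> es (?G b) = {}"
      proof cases
        case 1 then show ?thesis using G(2)[of a b] ab by simp
      next
        case 2 then show ?thesis using disj[of b] by simp
      next
        case 3 then show ?thesis using disj[of a] by (simp add: Int_commute)
      qed
    qed
  qed simp
  then obtain G where G: "\<And>a. a < r \<Longrightarrow> good (G a)"
      "\<And>a b. a < r \<Longrightarrow> b < r \<Longrightarrow> a \<noteq> b \<Longrightarrow> es (G a) \<inter> es (G b) = {}"
    by (metis (no_types, lifting) order_refl)
  define Q where "Q a = {{G a x, G a y} | x y. (x, y) \<in> A \<and> G a x < G a y}" for a
  have QD: "Q a \<subseteq> es (G a)" for a unfolding Q_def es_def by auto
  have "{F. F \<subseteq> E \<and> \<not> (\<exists>f. inj_on f VL \<and> (\<forall>l\<in>VL. f l \<in> X l) \<and>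
          (\<forall>(x, y)\<in>AL. c x \<noteq> c y \<longrightarrow> arc E F (f x) (f y)))}
      \<subseteq> {F. F \<subseteq> E \<and> (\<forall>a<r. F \<inter> es (G a) \<noteq> Q a)}"
  proof (intro Collect_mono impI conjI allI notI)
    fix F a assume F: "F \<subseteq> E \<and> \<not> (\<exists>f. inj_on f VL \<and> (\<forall>l\<in>VL. f l \<in> X l) \<and>
          (\<forall>(x, y)\<in>AL. c x \<noteq> c y \<longrightarrow> arc E F (f x) (f y)))" and a: "a < r" "F \<inter> es (G a) = Q a"
    have ga: "inj_on (G a) VL" "\<forall>l\<in>VL. G a l \<in> X l" "es (G a) \<subseteq> E"
      using G(1)[OF a(1)] unfolding good_def by auto
    have "arc E F (G a x) (G a y)" if xy: "(x, y) \<in> A" for x y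
    proof (rule arcs_of_pattern[OF ga(1) AL(1) AL(2), of A E "es (G a)" F])
      show "{G a x, G a y} \<in> E \<and> {G a x, G a y} \<in> es (G a)" if "(x, y) \<in> A" for x y
      proof -
        have "{G a x, G a y} \<in> es (G a)" unfolding es_def by (rule rev_image_eqI[OF that]) simp
        then show ?thesis using ga(3) by auto
      qed
      show "F \<inter> es (G a) = {{G a x, G a y} |x y. (x, y) \<in> A \<and> G a x < G a y}"
        using a(2) unfolding Q_def .
    qed (use xy A in auto)
    then have "\<forall>(x, y)\<in>AL. c x \<noteq> c y \<longrightarrow> arc E F (G a x) (G a y)" unfolding A by auto
    then show False using F ga by blast
  qed simp
  then have "card {F. F \<subseteq> E \<and> \<not> (\<exists>f. inj_on f VL \<and> (\<forall>l\<in>VL. f l \<in> X l) \<and>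
          (\<forall>(x, y)\<in>AL. c x \<noteq> c y \<longrightarrow> arc E F (f x) (f y)))}
      \<le> card {F. F \<subseteq> E \<and> (\<forall>a<r. F \<inter> es (G a) \<noteq> Q a)}"
    by (intro card_mono) (use fE in auto)
  also have "real \<dots> \<le> 2 ^ card E * (1 - 1 / 2 ^ w ^ 2) ^ r"
    by (rule card_avoid_patterns_le[OF fE]) (use G QD ces in \<open>auto simp: good_def\<close>)
  finally show ?thesis by simp
qed

text \<open>Union bound over the colourings \<open>c\<close> and the families \<open>X\<close>, at
  most (k 2^|V|)^|VL| of them. Each \<open>X l\<close> may be shrunk to exactly \<open>d\<close>
  elements, as a copy inside smaller sets is also one inside the larger sets.\<close>

lemma card_not_univ_le:
  assumes V: "finite V" "\<And>i. i < k \<Longrightarrow> P i \<subseteq> V" and fE: "finite E"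
    and fVL: "finite VL" and w: "card VL \<le> w"
    and AL: "AL \<subseteq> VL \<times> VL" "\<And>x y. (x, y) \<in> AL \<Longrightarrow> (y, x) \<notin> AL"
    and Ms: "\<And>i j u v. i < k \<Longrightarrow> j < k \<Longrightarrow> i \<noteq> j \<Longrightarrow> u \<in> P i \<Longrightarrow> v \<in> P j \<Longrightarrow>
      {u, v} \<notin> E \<Longrightarrow> (u, v) \<in> Ms" "finite Ms" "card Ms \<le> \<mu>"
    and num: "w ^ 2 * (w * d + \<mu> + 2 * r * w ^ 2) < d ^ 2"
  shows "real (card {F. F \<subseteq> E \<and> \<not> univ VL AL k P E d F})
    \<le> real ((k * 2 ^ card V) ^ card VL) * (2 ^ card E * (1 - 1 / 2 ^ w ^ 2) ^ r)"
proof -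
  let ?copy = "\<lambda>c X F. \<exists>f. inj_on f VL \<and> (\<forall>l\<in>VL. f l \<in> X l) \<and>
          (\<forall>(x, y)\<in>AL. c x \<noteq> c y \<longrightarrow> arc E F (f x) (f y))"
  let ?CX = "{(c, X). c \<in> VL \<rightarrow>\<^sub>E {..<k} \<and> X \<in> VL \<rightarrow>\<^sub>E Pow V}"
  define bad where "bad = (\<lambda>(c :: 'a \<Rightarrow> nat, X). if \<forall>l\<in>VL. X l \<subseteq> P (c l) \<and> card (X l) = d
     then {F. F \<subseteq> E \<and> \<not> ?copy c X F} else {})"
  have CX: "?CX = (VL \<rightarrow>\<^sub>E {..<k}) \<times> (VL \<rightarrow>\<^sub>E Pow V)" by auto
  have fCX: "finite ?CX" unfolding CX using fVL V by (auto intro!: finite_PiE)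
  have cCX: "card ?CX = (k * 2 ^ card V) ^ card VL"
    unfolding CX using fVL V by (simp add: card_cartesian_product card_funcsetE card_Pow power_mult_distrib)
  have sub: "{F. F \<subseteq> E \<and> \<not> univ VL AL k P E d F} \<subseteq> (\<Union>cX\<in>?CX. bad cX)"
  proof
    fix F assume "F \<in> {F. F \<subseteq> E \<and> \<not> univ VL AL k P E d F}"
    then obtain c X where F: "F \<subseteq> E" and cX: "\<forall>l\<in>VL. c l < k \<and> X l \<subseteq> P (c l) \<and> d \<le> card (X l)"
      and no: "\<not> ?copy c X F" unfolding univ_def by blast
    have "\<forall>l\<in>VL. \<exists>Y. Y \<subseteq> X l \<and> card Y = d"
      using cX by (meson obtain_subset_with_card_n)
    then obtain Y where Y: "\<forall>l\<in>VL. Y l \<subseteq> X l \<and> card (Y l) = d" by metis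
    define c' where "c' = restrict c VL"
    define Y' where "Y' = restrict Y VL"
    have "(c', Y') \<in> ?CX" using cX Y V(2) unfolding c'_def Y'_def by auto blast
    moreover have "F \<in> bad (c', Y')"
    proof -
      have "\<not> ?copy c' Y' F"
      proof
        assume "?copy c' Y' F"
        then obtain f where f: "inj_on f VL" "\<forall>l\<in>VL. f l \<in> Y' l"
          "\<forall>(x, y)\<in>AL. c' x \<noteq> c' y \<longrightarrow> arc E F (f x) (f y)" by blast
        have "\<forall>(x, y)\<in>AL. c x \<noteq> c y \<longrightarrow> arc E F (f x) (f y)" 
        proof (intro ballI, clarify)
          fix x y assume xy: "(x, y) \<in> AL" "c x \<noteq> c y"
          then have "x \<in> VL" "y \<in> VL" using AL(1) by auto
          then show "arc E F (f x) (f y)" using f(3) xy by (auto simp: c'_def split: if_split_asm)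
        qed
        moreover have "\<forall>l\<in>VL. f l \<in> X l" using f(2) Y by (auto simp: Y'_def)
        ultimately show False using no f(1) by blast
      qed
      moreover have "\<forall>l\<in>VL. Y' l \<subseteq> P (c' l) \<and> card (Y' l) = d"
        using Y cX unfolding c'_def Y'_def by (auto dest!: bspec)
      ultimately show ?thesis using F unfolding bad_def by simp
    qed
    ultimately show "F \<in> (\<Union>cX\<in>?CX. bad cX)" by blast
  qed
  have fb: "finite (bad cX)" for cX
    using fE unfolding bad_def by (auto split: prod.splits)
  have each: "real (card (bad cX)) \<le> 2 ^ card E * (1 - 1 / 2 ^ w ^ 2) ^ r" if "cX \<in> ?CX" for cX
  proof -
    obtain c X where cX: "cX = (c, X)" by force
    have pos: "(0::real) \<le> 2 ^ card E * (1 - 1 / 2 ^ w ^ 2) ^ r" by (simp add: field_simps)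
    show ?thesis
    proof (cases "\<forall>l\<in>VL. X l \<subseteq> P (c l) \<and> card (X l) = d")
      case True
      have ck: "c l < k" if "l \<in> VL" for l using \<open>cX \<in> ?CX\<close> that unfolding cX by auto
      have "real (card {F. F \<subseteq> E \<and> \<not> ?copy c X F}) \<le> 2 ^ card E * (1 - 1 / 2 ^ w ^ 2) ^ r"
      proof (rule card_no_copy_le[OF fE fVL w AL _ _ Ms(2,3) num])
        show "finite (X l) \<and> card (X l) = d" if "l \<in> VL" for l
          using True V ck[OF that] that by (meson finite_subset)
        show "(u, v) \<in> Ms" if "l \<in> VL" "l' \<in> VL" "c l \<noteq> c l'" "u \<in> X l" "v \<in> X l'" "{u, v} \<notin> E"
          for l l' u v
          using Ms(1)[of "c l" "c l'" u v] ck that True by blast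
      qed
      then show ?thesis using True unfolding cX bad_def by simp
    next
      case False
      then have "bad cX = {}" unfolding cX bad_def by (simp only: prod.case if_False)
      then show ?thesis using pos by simp
    qed
  qed
  have "real (card {F. F \<subseteq> E \<and> \<not> univ VL AL k P E d F}) \<le> real (card (\<Union>cX\<in>?CX. bad cX))"
    using card_mono[OF _ sub] fCX fb by simp
  also have "\<dots> \<le> (\<Sum>cX\<in>?CX. real (card (bad cX)))"
  proof -
    have "real (card (\<Union>cX\<in>?CX. bad cX)) \<le> real (\<Sum>cX\<in>?CX. card (bad cX))"
      using card_UN_le[OF fCX, of bad] by (simp only: of_nat_le_iff)
    then show ?thesis by (simp only: of_nat_sum)
  qed
  also have "\<dots> \<le> (\<Sum>cX\<in>?CX. 2 ^ card E * (1 - 1 / 2 ^ w ^ 2) ^ r)"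
    by (rule sum_mono[OF each])
  also have "\<dots> = real (card ?CX) * (2 ^ card E * (1 - 1 / 2 ^ w ^ 2) ^ r)" by simp
  finally show ?thesis unfolding cCX .
qed

lemma eventually_linear_le_quadratic:
  fixes a A B :: real
  assumes "a > 0"
  shows "\<exists>n0::nat. \<forall>n::nat. n \<ge> n0 \<longrightarrow> A * n + B \<le> a * real n ^ 2"
proof (intro exI allI impI)
  fix n :: nat assume n: "n \<ge> nat \<lceil>(\<bar>A\<bar> + \<bar>B\<bar>) / a\<rceil> + 1"
  have "(\<bar>A\<bar> + \<bar>B\<bar>) / a \<le> n" using n by linarith
  then have 1: "\<bar>A\<bar> + \<bar>B\<bar> \<le> a * n" using assms by (simp add: divide_le_eq mult.commute)
  have n1: "real n \<ge> 1" using n by simp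
  have "A * n \<le> \<bar>A\<bar> * n" by (rule mult_right_mono) auto
  moreover have "B \<le> \<bar>B\<bar> * n" using mult_left_mono[OF n1, of "\<bar>B\<bar>"] by simp
  ultimately have "A * n + B \<le> (\<bar>A\<bar> + \<bar>B\<bar>) * n" by (simp add: algebra_simps)
  also have "\<dots> \<le> (a * n) * n" by (rule mult_right_mono[OF 1]) simp
  finally show "A * n + B \<le> a * real n ^ 2" by (simp add: power2_eq_square)
qed

lemma eventually_log_less_linear:
  fixes a A B :: real
  assumes "a > 0"
  shows "\<exists>n0::nat. \<forall>n::nat. n \<ge> n0 \<longrightarrow> A * log 2 n + B < a * n"
proof -
  have "(\<lambda>n. A / ln 2 * (ln (real n) / real n) + B * (1 / real n)) \<longlonglongrightarrow> A / ln 2 * 0 + B * 0"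
    by (intro tendsto_add tendsto_mult tendsto_const lim_1_over_n
        filterlim_compose[OF ln_x_over_x_tendsto_0 filterlim_real_sequentially])
  then have "eventually (\<lambda>n. A / ln 2 * (ln (real n) / real n) + B * (1 / real n) < a) sequentially"
    using assms by (intro order_tendstoD) auto
  then have "eventually (\<lambda>n. A * log 2 n + B < a * n) sequentially"
    using eventually_gt_at_top[of 0]
    by eventually_elim (simp add: log_def field_simps)
  then show ?thesis by (simp add: eventually_sequentially)
qed

text \<open>For fixed \<delta> the number \<open>r\<close> of edge-disjoint candidates is of order
  n^2, so a failure probability of 2^(-g r) beats the 2^(O(n)) choices in the union bound. Even a
  quadratic number of missing cross pairs is tolerated if its constant \<alpha> is small.\<close>

lemma card_not_univ_small:
  fixes VL :: "'l set" and \<delta> :: real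
  assumes fVL: "finite VL" and AL: "AL \<subseteq> VL \<times> VL" "\<forall>x y. (x, y) \<in> AL \<longrightarrow> (y, x) \<notin> AL"
    and k: "k \<ge> 1" and \<delta>: "\<delta> > 0"
  shows "\<exists>\<alpha>>0. \<exists>n0. \<forall>V P E Ms. n0 \<le> card V \<longrightarrow> finite V \<longrightarrow> (\<forall>i<k. P i \<subseteq> V) \<longrightarrow> finite E \<longrightarrow>
    (\<forall>i<k. \<forall>j<k. i \<noteq> j \<longrightarrow> (\<forall>u\<in>P i. \<forall>v\<in>P j. {u, v} \<notin> E \<longrightarrow> (u, v) \<in> Ms)) \<longrightarrow>
    finite Ms \<longrightarrow> real (card Ms) \<le> \<alpha> * real (card V) ^ 2 \<longrightarrow>
     real (card {F. F \<subseteq> E \<and> \<not> univ VL AL k P E (nat \<lceil>\<delta> * card V\<rceil>) F})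
       \<le> 2 ^ card E * 2 powr (- (\<alpha> * real (card V) ^ 2))"
proof -
  \<comment> \<open>The extra 1 keeps 2^(w^2) above 1, so that \<open>g\<close> below is positive
    even for an empty pattern.\<close>
  define w where "w = card VL + 1"
  define g where "g = - log 2 (1 - 1 / 2 ^ w ^ 2 :: real)"
  have w2: "(2::real) ^ w ^ 2 > 1" unfolding w_def by (rule one_less_power) auto
  then have i01: "(0::real) < 1 - 1 / 2 ^ w ^ 2" "(1::real) - 1 / 2 ^ w ^ 2 < 1" by auto
  have g: "g > 0" unfolding g_def using i01 by simp
  have w1: "w \<ge> 1" unfolding w_def by simp
  \<comment> \<open>The candidates give the exponent g \<delta>^2 n^2 / (8 w^4), which is 2 a n^2.
    One half pays for the union bound, the other half is the gain. The second term in \<alpha> below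
    limits the contribution of the missing pairs to \<open>num\<close>.\<close>
  define a where "a = g * \<delta> ^ 2 / (16 * real w ^ 4)"
  have a: "a > 0" unfolding a_def using g \<delta> w1 by simp
  define \<alpha> where "\<alpha> = min a (\<delta> ^ 2 / (4 * real w ^ 2))"
  have \<alpha>: "\<alpha> > 0" unfolding \<alpha>_def using a \<delta> w1 by simp
  obtain n1 :: nat where n1: "\<And>n::nat. n \<ge> n1 \<Longrightarrow> real (card VL) * n + (card VL * log 2 k + g) \<le> a * real n ^ 2"
    using eventually_linear_le_quadratic[OF a, of "card VL" "card VL * log 2 k + g"] by blast
  define n0 where "n0 = max n1 (nat \<lceil>4 * real w ^ 3 / \<delta>\<rceil> + 1)"
  show ?thesis
  proof (intro exI[of _ \<alpha>] conjI exI[of _ n0] allI impI)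
    fix V :: "nat set" and P E Ms
    assume n: "n0 \<le> card V" and fV: "finite V" and PV: "\<forall>i<k. P i \<subseteq> V" and fE: "finite E"
      and Ms0: "\<forall>i<k. \<forall>j<k. i \<noteq> j \<longrightarrow> (\<forall>u\<in>P i. \<forall>v\<in>P j. {u, v} \<notin> E \<longrightarrow> (u, v) \<in> Ms)"
      and fMs: "finite Ms" and cMs: "real (card Ms) \<le> \<alpha> * real (card V) ^ 2"
    have V: "finite V" "\<And>i. i < k \<Longrightarrow> P i \<subseteq> V" using fV PV by auto
    have Ms: "\<And>i j u v. i < k \<Longrightarrow> j < k \<Longrightarrow> i \<noteq> j \<Longrightarrow> u \<in> P i \<Longrightarrow> v \<in> P j \<Longrightarrow> {u, v} \<notin> E \<Longrightarrow> (u, v) \<in> Ms"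
        "finite Ms" "real (card Ms) \<le> \<alpha> * real (card V) ^ 2" using Ms0 fMs cMs by blast+
    define n where "n = card V"
    define d where "d = nat \<lceil>\<delta> * n\<rceil>"
    define r where "r = d ^ 2 div (8 * w ^ 4)"
    have "4 * real w ^ 3 / \<delta> \<le> n" using n unfolding n0_def n_def by linarith
    then have "4 * real w ^ 3 \<le> \<delta> * n" using \<delta> by (simp add: divide_le_eq mult.commute)
    moreover have dn: "\<delta> * n \<le> d" unfolding d_def by linarith
    ultimately have d4: "4 * real w ^ 3 \<le> d" by linarith
    have d0: "real d > 0" using d4 w1 by (smt (verit) of_nat_1 of_nat_mono one_le_power)
    have dn2: "(\<delta> * n) ^ 2 \<le> real d ^ 2" using dn \<delta> by (intro power_mono) auto
    have "r * (8 * w ^ 4) \<le> d ^ 2" unfolding r_def by (rule div_times_less_eq_dividend)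
    then have "real (r * (8 * w ^ 4)) \<le> real (d ^ 2)" by (simp only: of_nat_le_iff)
    then have r1: "8 * real w ^ 4 * r \<le> real d ^ 2" by (simp add: mult_ac)
    have "real d ^ 2 / (8 * real w ^ 4) - 1 \<le> r"
    proof -
      have "d ^ 2 < (r + 1) * (8 * w ^ 4)"
        using dividend_less_div_times[of "8 * w ^ 4" "d ^ 2"] w1 by (simp add: r_def algebra_simps)
      then have "real (d ^ 2) < real ((r + 1) * (8 * w ^ 4))" by (simp only: of_nat_less_iff)
      then have *: "real d ^ 2 < (real r + 1) * (8 * real w ^ 4)" by (simp add: algebra_simps)
      have "8 * real w ^ 4 > 0" using w1 by simp
      then have "real d ^ 2 / (8 * real w ^ 4) < real r + 1" using * by (simp only: pos_divide_less_eq)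
      then show ?thesis by linarith
    qed
    moreover have "(\<delta> * n) ^ 2 / (8 * real w ^ 4) \<le> real d ^ 2 / (8 * real w ^ 4)"
      using dn2 by (intro divide_right_mono) auto
    ultimately have r2: "(\<delta> * n) ^ 2 / (8 * real w ^ 4) - 1 \<le> r" by linarith
    have m: "real w ^ 2 * card Ms \<le> real d ^ 2 / 4"
    proof -
      have "real (card Ms) \<le> \<delta> ^ 2 / (4 * real w ^ 2) * n ^ 2"
      proof (rule order_trans)
        show "real (card Ms) \<le> \<alpha> * real n ^ 2" using Ms(3) unfolding n_def .
        have "\<alpha> \<le> \<delta> ^ 2 / (4 * real w ^ 2)" unfolding \<alpha>_def by simp
        then show "\<alpha> * real n ^ 2 \<le> \<delta> ^ 2 / (4 * real w ^ 2) * n ^ 2"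
          by (simp only: of_nat_power) (rule mult_right_mono, auto)
      qed
      then have "real w ^ 2 * card Ms \<le> real w ^ 2 * (\<delta> ^ 2 / (4 * real w ^ 2) * n ^ 2)"
        by (intro mult_left_mono) auto
      also have "\<dots> = (\<delta> * n) ^ 2 / 4" using w1 by (simp add: power_mult_distrib)
      finally show ?thesis using dn2 by linarith
    qed
    have "4 * real w ^ 3 * d \<le> real d * real d" using d4 by (intro mult_right_mono) auto
    then have wd: "real w ^ 3 * d \<le> real d ^ 2 / 4" by (simp add: power2_eq_square)
    \<comment> \<open>Each of the three summands is at most d^2 / 4.\<close>
    have "real (w ^ 2 * (w * d + card Ms + 2 * r * w ^ 2))
        = real w ^ 3 * d + real w ^ 2 * card Ms + 8 * real w ^ 4 * r / 4"
      by (simp add: algebra_simps power2_eq_square power3_eq_cube power4_eq_xxxx)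
    also have "\<dots> < real d ^ 2"
    proof -
      have "0 < real d ^ 2" using d0 by simp
      then show ?thesis using wd m r1 by linarith
    qed
    finally have num: "w ^ 2 * (w * d + card Ms + 2 * r * w ^ 2) < d ^ 2"
      by (metis of_nat_less_iff of_nat_power)
    have "real (card {F. F \<subseteq> E \<and> \<not> univ VL AL k P E d F})
      \<le> real ((k * 2 ^ card V) ^ card VL) * (2 ^ card E * (1 - 1 / 2 ^ w ^ 2) ^ r)"
      by (rule card_not_univ_le[OF V fE fVL _ AL(1) AL(2)[rule_format] Ms(1,2) order_refl num]) (auto simp: w_def)
    also have "(1 - 1 / 2 ^ w ^ 2 :: real) ^ r = 2 powr (- (g * r))"
    proof -
      have "(1 - 1 / 2 ^ w ^ 2 :: real) = 2 powr (- g)" unfolding g_def using i01 by simp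
      then have "(1 - 1 / 2 ^ w ^ 2 :: real) ^ r = (2 powr (- g)) ^ r" by (rule arg_cong)
      also have "\<dots> = 2 powr (- (g * r))" by (simp add: powr_power mult.commute)
      finally show ?thesis .
    qed
    also have "real ((k * 2 ^ card V) ^ card VL) = 2 powr (card VL * log 2 k + real (card VL) * n)"
    proof -
      have "real k = 2 powr (log 2 k)" using k by simp
      then have "real k * 2 ^ n = 2 powr (log 2 k + n)" by (simp add: powr_add powr_realpow)
      then have "real ((k * 2 ^ n) ^ card VL) = (2 powr (log 2 k + n)) ^ card VL" by simp
      also have "\<dots> = 2 powr (card VL * log 2 k + real (card VL) * n)" by (simp add: powr_power algebra_simps)
      finally show ?thesis unfolding n_def .
    qed
    also have "2 powr (card VL * log 2 k + real (card VL) * n) * (2 ^ card E * 2 powr (- (g * r)))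
        = 2 ^ card E * 2 powr (card VL * log 2 k + real (card VL) * n - g * r)"
      by (simp add: powr_diff powr_minus field_simps)
    also have "\<dots> \<le> 2 ^ card E * 2 powr (- (\<alpha> * real n ^ 2))"
    proof (intro mult_left_mono powr_mono)
      have "real (card VL) * n + (card VL * log 2 k + g) \<le> a * real n ^ 2" using n1 n unfolding n0_def n_def by simp
      moreover have "g * ((\<delta> * n) ^ 2 / (8 * real w ^ 4) - 1) \<le> g * r" using r2 g by (intro mult_left_mono) auto
      moreover have "g * ((\<delta> * n) ^ 2 / (8 * real w ^ 4) - 1) = 2 * (a * real n ^ 2) - g"
        unfolding a_def by (simp add: field_simps power_mult_distrib)
      moreover have "\<alpha> * real n ^ 2 \<le> a * real n ^ 2" unfolding \<alpha>_def by (intro mult_right_mono) auto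
      ultimately show "card VL * log 2 k + real (card VL) * n - g * r \<le> - (\<alpha> * real n ^ 2)" by linarith
    qed auto
    finally show "real (card {F. F \<subseteq> E \<and> \<not> univ VL AL k P E (nat \<lceil>\<delta> * card V\<rceil>) F})
       \<le> 2 ^ card E * 2 powr (- (\<alpha> * real (card V) ^ 2))" unfolding d_def n_def .
  qed (rule \<alpha>)
qed

text \<open>The universal graph on \<open>{..<k * m}\<close> has the residue classes modulo \<open>k\<close> as parts.\<close>
definition turan_edges :: "nat \<Rightarrow> nat \<Rightarrow> nat set set" where
  "turan_edges k n = {{u, v} | u v. u < n \<and> v < n \<and> u mod k \<noteq> v mod k}"

lemma finite_turan_edges: "finite (turan_edges k n)"
  by (rule finite_subset[of _ "Pow {..<n}"]) (auto simp: turan_edges_def)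

text \<open>Between distinct residue classes no pair is missing, so \<open>Ms\<close> is empty and
  the orientations that fail to be universal are fewer than all. The parameter \<delta> / k reflects
  that a class has m of the k m vertices.\<close>

lemma ex_univ:
  fixes VL :: "'l set" and \<delta> :: real
  assumes fVL: "finite VL" and AL: "AL \<subseteq> VL \<times> VL" "\<forall>x y. (x, y) \<in> AL \<longrightarrow> (y, x) \<notin> AL"
    and k: "k \<ge> 1" and \<delta>: "\<delta> > 0"
  obtains m0 :: nat where "\<And>m::nat. m \<ge> m0 \<Longrightarrow> \<exists>F \<subseteq> turan_edges k (k * m).
    univ VL AL k (\<lambda>i. {v. v < k * m \<and> v mod k = i}) (turan_edges k (k * m)) (nat \<lceil>\<delta> * m\<rceil>) F"
proof -
  have \<delta>k: "\<delta> / k > 0" using \<delta> k by simp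
  obtain \<alpha> :: real and n0 :: nat where \<alpha>: "\<alpha> > 0" and small: "\<forall>V P E Ms. n0 \<le> card V \<longrightarrow> finite V \<longrightarrow> (\<forall>i<k. P i \<subseteq> V) \<longrightarrow> finite E \<longrightarrow>
    (\<forall>i<k. \<forall>j<k. i \<noteq> j \<longrightarrow> (\<forall>u\<in>P i. \<forall>v\<in>P j. {u, v} \<notin> E \<longrightarrow> (u, v) \<in> Ms)) \<longrightarrow>
    finite Ms \<longrightarrow> real (card Ms) \<le> \<alpha> * real (card V) ^ 2 \<longrightarrow>
     real (card {F. F \<subseteq> E \<and> \<not> univ VL AL k P E (nat \<lceil>\<delta> / k * card V\<rceil>) F})
       \<le> 2 ^ card E * 2 powr (- (\<alpha> * real (card V) ^ 2))"
    using card_not_univ_small[OF fVL AL k \<delta>k] by (elim exE conjE)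
  have "\<exists>F \<subseteq> turan_edges k (k * m).
    univ VL AL k (\<lambda>i. {v. v < k * m \<and> v mod k = i}) (turan_edges k (k * m)) (nat \<lceil>\<delta> * m\<rceil>) F"
    if m: "m \<ge> n0 + 1" for m
  proof (rule ccontr)
    let ?E = "turan_edges k (k * m)" and ?P = "\<lambda>i. {v. v < k * m \<and> v mod k = i}"
    assume "\<not> ?thesis"
    then have all: "{F. F \<subseteq> ?E \<and> \<not> univ VL AL k ?P ?E (nat \<lceil>\<delta> * m\<rceil>) F} = Pow ?E" by auto
    have "n0 \<le> k * m" using m k by (metis Suc_eq_plus1 Suc_leD le_trans mult_le_mono1 nat_mult_1)
    then have "real (card {F. F \<subseteq> ?E \<and> \<not> univ VL AL k ?P ?E (nat \<lceil>\<delta> / k * card {..<k * m}\<rceil>) F})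
       \<le> 2 ^ card ?E * 2 powr (- (\<alpha> * real (card {..<k * m}) ^ 2))"
      by (intro small[rule_format, of "{..<k * m}" ?P ?E "{}"] finite_turan_edges)
        (use \<alpha> in \<open>auto simp: turan_edges_def\<close>)
    moreover have "\<delta> / k * card {..<k * m} = \<delta> * m" using k by simp
    ultimately have "real (card (Pow ?E)) \<le> 2 ^ card ?E * 2 powr (- (\<alpha> * real (k * m) ^ 2))"
      using all by simp
    then have "1 \<le> 2 powr (- (\<alpha> * real (k * m) ^ 2))" by (simp add: card_Pow finite_turan_edges)
    moreover have "- (\<alpha> * real (k * m) ^ 2) < 0" using \<alpha> k m by simp
    ultimately show False by (smt (verit) powr_less_one)
  qed
  then show ?thesis using that by blast
qed

section \<open>Fibres over a fixed vertex set and the rows of shattered sets\<close>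

section \<open>Fibres of orientations over a vertex set\<close>

text \<open>A set \<open>Y\<close> of edges leaving \<open>S\<close> is studied through these traces
  on \<open>S\<close>, one for each vertex outside; there are only 2^|S| possible values, which
  makes pigeonhole arguments possible.\<close>

definition row :: "nat set set \<Rightarrow> nat set \<Rightarrow> nat \<Rightarrow> nat set" where
  "row Y S v = {x \<in> S. {x, v} \<in> Y}"

definition cross_edges :: "nat set set \<Rightarrow> nat set \<Rightarrow> nat set set" where
  "cross_edges E S = {e \<in> E. \<not> (e \<inter> S = {} \<or> e \<subseteq> S)}"

definition agree_off :: "nat set set \<Rightarrow> nat set \<Rightarrow> nat set set set \<Rightarrow> bool" where
  "agree_off E S \<E> \<longleftrightarrow>
     (\<forall>F\<in>\<E>. \<forall>F'\<in>\<E>. \<forall>e\<in>E. (e \<inter> S = {} \<or> e \<subseteq> S) \<longrightarrow> (e \<in> F \<longleftrightarrow> e \<in> F'))"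

lemma graph_edgeD:
  assumes "graph (V, E)" "e \<in> E"
  obtains x y where "x \<noteq> y" "x \<in> V" "y \<in> V" "e = {x, y}"
  using assms unfolding graph_def by auto

lemma graph_finite: "graph (V, E) \<Longrightarrow> finite V \<and> finite E"
  unfolding graph_def by (auto intro!: finite_subset[of E "Pow V"])

lemma cross_edgesE:
  assumes "graph (V, E)" "e \<in> cross_edges E S"
  obtains x v where "x \<in> S" "v \<in> V - S" "e = {x, v}"
  using assms unfolding cross_edges_def by (auto elim!: graph_edgeD)

text \<open>An edge on which all members agree cannot be shattered.\<close>

lemma shattered_subset_cross:
  assumes "agree_off E S \<E>" "\<E> \<subseteq> Pow E" "shatters \<E> Y"
  shows "Y \<subseteq> cross_edges E S"
proof
  fix e assume e: "e \<in> Y"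
  obtain F where F: "F \<in> \<E>" "F \<inter> Y = {}" using assms(3) unfolding shatters_def by (meson empty_subsetI)
  obtain F' where F': "F' \<in> \<E>" "F' \<inter> Y = Y" using assms(3) unfolding shatters_def by (meson order_refl)
  have "e \<notin> F" "e \<in> F'" using e F F' by auto
  moreover have "e \<in> E" using \<open>e \<in> F'\<close> F'(1) assms(2) by auto
  ultimately show "e \<in> cross_edges E S"
    using assms(1) F(1) F'(1) unfolding agree_off_def cross_edges_def by blast
qed

text \<open>A set of edges between \<open>S\<close> and its complement is determined by its rows.
  The sets in question therefore inject into the functions from \<open>V - S\<close> to
  \<open>R\<close>, and the exponential-moment bound applies to the coordinates with value in
  \<open>B\<close>.\<close>

lemma card_rows_le:
  fixes \<mu> :: real
  assumes G: "graph (V, E)" and S: "S \<subseteq> V"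
    and Y: "\<And>Y. Y \<in> \<Y> \<Longrightarrow> Y \<subseteq> cross_edges E S"
      "\<And>Y v. Y \<in> \<Y> \<Longrightarrow> v \<in> V - S \<Longrightarrow> row Y S v \<in> R"
      "\<And>Y. Y \<in> \<Y> \<Longrightarrow> u \<le> card {v \<in> V - S. row Y S v \<in> B}"
    and R: "R \<subseteq> Pow S" "B \<subseteq> R" and \<mu>: "\<mu> \<ge> 1"
  shows "card \<Y> * \<mu> ^ u \<le> (card R + (\<mu> - 1) * card B) ^ card (V - S)"
proof -
  let ?W = "V - S"
  let ?H = "{g \<in> PiE ?W (\<lambda>_. R). u \<le> card {v \<in> ?W. g v \<in> B}}"
  have fV: "finite V" using graph_finite[OF G] by simp
  have fR: "finite R" using R(1) S fV by (meson finite_Pow_iff finite_subset)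
  have "card \<Y> \<le> card ?H"
  proof (rule card_inj_on_le)
    let ?f = "\<lambda>Y. restrict (row Y S) ?W"
    show "inj_on ?f \<Y>"
    proof (rule inj_onI)
      fix Y Y' assume YY: "Y \<in> \<Y>" "Y' \<in> \<Y>" and eq: "?f Y = ?f Y'"
      have iff: "{x, v} \<in> Y \<longleftrightarrow> {x, v} \<in> Y'" if "x \<in> S" "v \<in> ?W" for x v
      proof -
        have "row Y S v = row Y' S v" using fun_cong[OF eq, of v] that by simp
        then show ?thesis using that unfolding row_def by auto
      qed
      show "Y = Y'"
      proof (rule set_eqI)
        fix e show "e \<in> Y \<longleftrightarrow> e \<in> Y'"
          using Y(1)[OF YY(1)] Y(1)[OF YY(2)] iff by (metis G cross_edgesE subsetD)
      qed
    qed
    show "?f ` \<Y> \<subseteq> ?H"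
    proof
      fix g assume "g \<in> ?f ` \<Y>"
      then obtain Z where Z: "Z \<in> \<Y>" "g = ?f Z" by auto
      have "{v \<in> ?W. g v \<in> B} = {v \<in> ?W. row Z S v \<in> B}" unfolding Z(2) by auto
      then show "g \<in> ?H" using Y(2,3)[OF Z(1)] unfolding Z(2) by auto
    qed
    show "finite ?H" using fV fR by (auto intro!: finite_subset[OF _ finite_PiE[of ?W "\<lambda>_. R"]])
  qed
  then have "card \<Y> * \<mu> ^ u \<le> card ?H * \<mu> ^ u" using \<mu> by (intro mult_right_mono) auto
  also have "\<dots> \<le> (\<Prod>v\<in>?W. card R + (\<mu> - 1) * card B)"
    by (rule card_PiE_hits_le) (use fV fR R \<mu> in auto)
  finally show ?thesis by simp
qed

text \<open>Completion of a partial placement: the labels in \<open>Q\<close> are put by hand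
  outside the image of \<phi>, all others are found in the universal graph inside the prescribed
  sets \<open>Z\<close>, and the arcs between the two groups lie on shattered edges.\<close>

lemma emb_via_univ:
  fixes k m :: nat
  defines "VU \<equiv> {..<k * m}" and "EU \<equiv> turan_edges k (k * m)"
  assumes univ: "univ VL AL k (\<lambda>i. {v. v < k * m \<and> v mod k = i}) EU d FU"
    and k: "k \<ge> 1"
    and AL: "AL \<subseteq> VL \<times> VL" "\<And>x y. (x, y) \<in> AL \<Longrightarrow> (y, x) \<notin> AL"
    and \<phi>: "inj_on \<phi> VU" "\<phi> ` VU \<subseteq> V"
    and arcsU: "\<And>F a b. F \<in> \<E> \<Longrightarrow> a < k * m \<Longrightarrow> b < k * m \<Longrightarrow> arc EU FU a b \<Longrightarrow> arc E F (\<phi> a) (\<phi> b)"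
    and Y: "shatters \<E> Y" "Y \<subseteq> E"
    and g: "inj_on g Q" "g ` Q \<subseteq> V - \<phi> ` VU" "Q \<subseteq> VL"
    and c: "\<And>l. l \<in> VL - Q \<Longrightarrow> c l < k"
      "\<And>x y. (x, y) \<in> AL \<Longrightarrow> x \<notin> Q \<Longrightarrow> y \<notin> Q \<Longrightarrow> c x \<noteq> c y"
    and Z: "\<And>i. i < k \<Longrightarrow> Z i \<subseteq> \<phi> ` {v. v < k * m \<and> v mod k = i} \<and> d \<le> card (Z i)"
    and QZ: "\<And>l x a. l \<in> Q \<Longrightarrow> x \<in> VL - Q \<Longrightarrow> a \<in> Z (c x) \<Longrightarrow> {a, g l} \<in> Y"
    and arcsQ: "\<And>x y F. (x, y) \<in> AL \<Longrightarrow> x \<in> Q \<Longrightarrow> y \<in> Q \<Longrightarrow> F \<in> \<E> \<Longrightarrow> arc E F (g x) (g y)"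
  shows "\<exists>F\<in>\<E>. emb V E F VL AL"
proof -
  \<comment> \<open>Universality speaks about all labels at once. Those in \<open>Q\<close> receive
    the dummy colour 0, and their images under \<open>f\<close> are discarded in
    \<open>h\<close>.\<close>
  define c' where "c' l = (if l \<in> Q then 0 else c l)" for l
  define X where "X l = {a \<in> VU. a mod k = c' l \<and> \<phi> a \<in> Z (c' l)}" for l
  have c'k: "c' l < k" if "l \<in> VL" for l using c(1)[of l] k that by (auto simp: c'_def)
  have X: "c' l < k \<and> X l \<subseteq> {v. v < k * m \<and> v mod k = c' l} \<and> d \<le> card (X l)" if l: "l \<in> VL" for l
  proof (intro conjI)
    have "Z (c' l) \<subseteq> \<phi> ` X l" using Z[OF c'k[OF l]] by (auto simp: X_def VU_def)
    moreover have "finite (X l)" unfolding X_def VU_def by simp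
    ultimately have "card (Z (c' l)) \<le> card (X l)" by (meson surj_card_le)
    then show "d \<le> card (X l)" using Z[OF c'k[OF l]] by simp
    show "X l \<subseteq> {v. v < k * m \<and> v mod k = c' l}" unfolding X_def VU_def by auto
  qed (rule c'k[OF l])
  have "\<exists>f. inj_on f VL \<and> (\<forall>l\<in>VL. f l \<in> X l) \<and>
      (\<forall>(x, y)\<in>AL. c' x \<noteq> c' y \<longrightarrow> arc EU FU (f x) (f y))"
    by (rule univ[unfolded univ_def, rule_format]) (rule X)
  then obtain f where f0: "inj_on f VL \<and> (\<forall>l\<in>VL. f l \<in> X l) \<and>
      (\<forall>(x, y)\<in>AL. c' x \<noteq> c' y \<longrightarrow> arc EU FU (f x) (f y))" by (elim exE)
  have f: "inj_on f VL" "\<And>l. l \<in> VL \<Longrightarrow> f l \<in> X l"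
      "\<And>x y. (x, y) \<in> AL \<Longrightarrow> c' x \<noteq> c' y \<Longrightarrow> arc EU FU (f x) (f y)"
    using f0 by auto
  define h where "h l = (if l \<in> Q then g l else \<phi> (f l))" for l
  have fVU: "f l \<in> VU" if "l \<in> VL" for l using f(2)[OF that] unfolding X_def by simp
  show ?thesis
  proof (rule emb_of_shattered[OF Y _ _ AL])
    show "inj_on h VL"
    proof (rule inj_onI)
      fix x y assume xy: "x \<in> VL" "y \<in> VL" "h x = h y"
      consider "x \<in> Q" "y \<in> Q" | "x \<in> Q" "y \<notin> Q" | "x \<notin> Q" "y \<in> Q" | "x \<notin> Q" "y \<notin> Q" by blast
      then show "x = y"
      proof cases
        case 1
        then show ?thesis using xy g(1) by (auto simp: h_def dest: inj_onD)
      next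
        case 2
        then have "g x = \<phi> (f y)" using xy by (simp add: h_def)
        moreover have "g x \<notin> \<phi> ` VU" using 2 g(2) by auto
        ultimately show ?thesis using fVU[OF xy(2)] by auto
      next
        case 3
        then have "g y = \<phi> (f x)" using xy by (simp add: h_def)
        moreover have "g y \<notin> \<phi> ` VU" using 3 g(2) by auto
        ultimately show ?thesis using fVU[OF xy(1)] by auto
      next
        case 4
        then have "\<phi> (f x) = \<phi> (f y)" using xy by (simp add: h_def)
        then have "f x = f y" using \<phi>(1) fVU xy by (auto dest: inj_onD)
        then show ?thesis using f(1) xy by (auto dest: inj_onD)
      qed
    qed
    show "h ` VL \<subseteq> V" using g(2) \<phi>(2) fVU unfolding h_def by auto
    fix x y assume xy: "(x, y) \<in> AL"
    then have V: "x \<in> VL" "y \<in> VL" using AL(1) by auto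
    have Zf: "\<phi> (f l) \<in> Z (c l)" if "l \<in> VL" "l \<notin> Q" for l
      using f(2)[OF that(1)] that(2) unfolding X_def c'_def by simp
    consider "x \<in> Q" "y \<in> Q" | "x \<in> Q" "y \<notin> Q" | "x \<notin> Q" "y \<in> Q" | "x \<notin> Q" "y \<notin> Q" by blast
    then show "{h x, h y} \<in> Y \<or> (\<forall>F\<in>\<E>. arc E F (h x) (h y))"
    proof cases
      case 1
      then show ?thesis using arcsQ[OF xy] by (simp add: h_def)
    next
      case 2
      then show ?thesis using QZ[of x y "\<phi> (f y)"] Zf V by (simp add: h_def insert_commute)
    next
      case 3
      then show ?thesis using QZ[of y x "\<phi> (f x)"] Zf V by (simp add: h_def)
    next
      case 4
      then have "c' x \<noteq> c' y" using c(2)[OF xy] by (simp add: c'_def)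
      then have "arc EU FU (f x) (f y)" by (rule f(3)[OF xy])
      then show ?thesis using 4 arcsU fVU V by (auto simp: h_def VU_def)
    qed
  qed
qed

text \<open>The extremal function is abstracted to \<open>D\<close>: an upper bound for every graph,
  and the Turan lower bound with a linear error. \<open>star_colourings\<close> is what remains of
  the two pure stars: p-colourings of the pattern whose monochromatic arcs all leave, respectively
  all enter, a single vertex \<open>z\<close>, with the colour of \<open>z\<close> prescribed.
  \<open>K\<close> is the slack allowed in the notion of a good n.\<close>

locale oriented_pattern =
  fixes VH :: "'a set" and AH :: "('a \<times> 'a) set" and p :: nat and D :: "nat \<Rightarrow> nat" and K :: real
  assumes finite_VH: "finite VH"
    and AH: "AH \<subseteq> VH \<times> VH" "\<And>x y. (x, y) \<in> AH \<Longrightarrow> (y, x) \<notin> AH"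
    and p2: "p \<ge> 2"
    and D_bound: "\<And>V E. graph (V, E) \<Longrightarrow> card {F. F \<subseteq> E \<and> \<not> emb V E F VH AH} \<le> D (card V)"
    and D_lower: "\<And>n. 2 powr ((1 - 1 / p) * real n ^ 2 / 2 - n) \<le> D n"
    and star_colourings: "\<And>i. i < p \<Longrightarrow> \<exists>z\<in>VH. \<exists>c. (\<forall>l\<in>VH. c l < p) \<and> c z = i \<and> (\<forall>(x, y)\<in>AH. c x = c y \<longrightarrow> x = z)"
      "\<And>i. i < p \<Longrightarrow> \<exists>z\<in>VH. \<exists>c. (\<forall>l\<in>VH. c l < p) \<and> c z = i \<and> (\<forall>(x, y)\<in>AH. c x = c y \<longrightarrow> y = z)"
begin

definition hfree :: "nat set \<Rightarrow> nat set set \<Rightarrow> nat set set set" where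
  "hfree V E = {F. F \<subseteq> E \<and> \<not> emb V E F VH AH}"

definition \<beta> :: real where "\<beta> = 1 - 1 / p"

text \<open>Deleting few vertices lowers \<open>D\<close> as much as it lowers the Turan bound, up to the factor \<open>2 powr K\<close>.\<close>
definition good :: "nat \<Rightarrow> nat \<Rightarrow> bool" where
  "good s0 n \<longleftrightarrow> (\<forall>s. 1 \<le> s \<and> s \<le> s0 \<longrightarrow>
     s \<le> n \<and> real (D (n - s)) * 2 powr (\<beta> * s * n - real s ^ 2) \<le> 2 powr K * D n)"

definition extremal :: "nat set \<Rightarrow> nat set set \<Rightarrow> bool" where
  "extremal V E \<longleftrightarrow> graph (V, E) \<and> card (hfree V E) = D (card V)"

lemma D_pos: "real (D n) > 0"
  using D_lower[of n] by (smt (verit) powr_gt_zero)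

lemma good_mono: "good s0 n \<Longrightarrow> s1 \<le> s0 \<Longrightarrow> good s1 n"
  unfolding good_def by auto

text \<open>An orientation in \<G> is mapped to its restrictions to the edges off \<open>S\<close>
  and inside \<open>S\<close>. The first is pattern-free on n - s vertices, the second has at most
  2^(s^2) values, so goodness makes some fibre as large as claimed. One s^2 in the exponent stems
  from this count, the other from the definition of \<open>good\<close>.\<close>

lemma ex_large_fibre:
  fixes c :: real
  assumes good: "good s0 (card V)" and ext: "extremal V E" and S: "S \<subseteq> V" "1 \<le> card S" "card S \<le> s0"
    and \<G>: "\<G> \<subseteq> hfree V E" "c > 0" "D (card V) \<le> c * card \<G>"
  obtains \<E> where "\<E> \<subseteq> \<G>" "agree_off E S \<E>"
    "2 powr (\<beta> * card S * card V - 2 * real (card S) ^ 2 - K) / c \<le> card \<E>"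
proof -
  let ?n = "card V" and ?s = "card S"
  define E1 where "E1 = {e \<in> E. e \<inter> S = {}}"
  define E2 where "E2 = {e \<in> E. e \<subseteq> S}"
  have G: "graph (V, E)" using ext unfolding extremal_def by simp
  have fin: "finite V" "finite E" "finite S" using graph_finite[OF G] S finite_subset by auto
  let ?f = "\<lambda>F. (F \<inter> E1, F \<inter> E2)"
  let ?C = "hfree (V - S) E1 \<times> Pow E2"
  have im: "?f ` \<G> \<subseteq> ?C"
  proof -
    have "\<not> emb (V - S) E1 (F \<inter> E1) VH AH" if "F \<in> \<G>" for F
    proof
      assume "emb (V - S) E1 (F \<inter> E1) VH AH"
      then obtain f where f: "inj_on f VH" "f ` VH \<subseteq> V - S"
        "\<forall>(x, y)\<in>AH. arc E1 (F \<inter> E1) (f x) (f y)" unfolding emb_def by blast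
      have "\<forall>(x, y)\<in>AH. arc E F (f x) (f y)" using f(3) unfolding arc_def E1_def by auto
      then have "emb V E F VH AH" unfolding emb_def using f by blast
      then show False using \<G>(1) that unfolding hfree_def by auto
    qed
    then show ?thesis unfolding hfree_def by auto
  qed
  have fC: "finite ?C" unfolding hfree_def E1_def E2_def using fin by auto
  have \<G>ne: "\<G> \<noteq> {}" using \<G>(3) D_pos[of ?n] by auto
  have f\<G>: "finite \<G>" using \<G>(1) fin unfolding hfree_def by (auto intro: finite_subset[of _ "Pow E"])
  obtain y where y: "card \<G> \<le> card ?C * card {F \<in> \<G>. ?f F = y}"
    using pigeonhole_fibre[OF f\<G> fC im] im \<G>ne by blast
  define \<E> where "\<E> = {F \<in> \<G>. ?f F = y}"
  have "card (hfree (V - S) E1) \<le> D (card (V - S))"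
    unfolding hfree_def
  proof (rule D_bound)
    show "graph (V - S, E1)"
      unfolding graph_def fst_conv snd_conv
    proof (intro conjI ballI)
      fix e assume e: "e \<in> E1"
      then have "e \<in> E" "e \<inter> S = {}" unfolding E1_def by auto
      then show "\<exists>x y. x \<noteq> y \<and> x \<in> V - S \<and> y \<in> V - S \<and> e = {x, y}"
        using G by (elim graph_edgeD[of V E e]) auto
    qed (use fin in auto)
  qed
  moreover have "card (V - S) = ?n - ?s" using S fin by (simp add: card_Diff_subset)
  ultimately have 1: "card (hfree (V - S) E1) \<le> D (?n - ?s)" by simp
  have "card E2 \<le> ?s ^ 2"
  proof -
    have "E2 \<subseteq> (\<lambda>(x, y). {x, y}) ` (S \<times> S)"
    proof
      fix e assume e: "e \<in> E2"
      then obtain x y where "e = {x, y}" using G unfolding E2_def by (auto elim: graph_edgeD)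
      moreover have "e \<subseteq> S" using e unfolding E2_def by auto
      ultimately show "e \<in> (\<lambda>(x, y). {x, y}) ` (S \<times> S)" by auto
    qed
    then have "card E2 \<le> card (S \<times> S)" using surj_card_le[of "S \<times> S" E2 "\<lambda>(x, y). {x, y}"] fin by simp
    then show ?thesis by (simp add: card_cartesian_product power2_eq_square)
  qed
  then have "card (Pow E2) \<le> 2 ^ (?s ^ 2)" using fin by (simp add: card_Pow E2_def)
  then have "card ?C \<le> D (?n - ?s) * 2 ^ (?s ^ 2)"
    unfolding card_cartesian_product using 1 by (rule mult_le_mono[rotated])
  then have "card \<G> \<le> D (?n - ?s) * 2 ^ (?s ^ 2) * card \<E>"
    using y unfolding \<E>_def by (meson le_trans mult_le_mono1)
  then have "real (card \<G>) \<le> real (D (?n - ?s) * 2 ^ (?s ^ 2) * card \<E>)" by (simp only: of_nat_le_iff)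
  then have g1: "real (card \<G>) \<le> real (D (?n - ?s)) * 2 powr (real ?s ^ 2) * card \<E>"
    by (simp add: powr_realpow[symmetric])
  let ?T = "2 powr (\<beta> * ?s * ?n - real ?s ^ 2)"
  have gd: "real (D (?n - ?s)) * ?T \<le> 2 powr K * D ?n" using good S unfolding good_def by auto
  have "D ?n * ?T \<le> c * card \<G> * ?T" using \<G>(3) by (intro mult_right_mono) auto
  also have "\<dots> \<le> c * (real (D (?n - ?s)) * 2 powr (real ?s ^ 2) * card \<E>) * ?T"
    using g1 \<G>(2) by (intro mult_right_mono mult_left_mono) auto
  also have "\<dots> = (real (D (?n - ?s)) * ?T) * (c * 2 powr (real ?s ^ 2) * card \<E>)" by simp
  also have "\<dots> \<le> (2 powr K * D ?n) * (c * 2 powr (real ?s ^ 2) * card \<E>)"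
    using gd \<G>(2) by (intro mult_right_mono) auto
  finally have "D ?n * ?T \<le> D ?n * (2 powr K * (c * 2 powr (real ?s ^ 2) * card \<E>))" by (simp add: mult_ac)
  then have "?T \<le> 2 powr K * (c * 2 powr (real ?s ^ 2) * card \<E>)" using D_pos[of ?n] by simp
  then have "?T / (2 powr K * 2 powr (real ?s ^ 2)) / c \<le> card \<E>" using \<G>(2) by (simp add: field_simps)
  also have "?T / (2 powr K * 2 powr (real ?s ^ 2)) = 2 powr (\<beta> * ?s * ?n - 2 * real ?s ^ 2 - K)"
    by (simp add: powr_diff powr_add[symmetric] field_simps)
  finally have big: "2 powr (\<beta> * ?s * ?n - 2 * real ?s ^ 2 - K) / c \<le> card \<E>" .
  have "agree_off E S \<E>"
    unfolding agree_off_def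
  proof (intro ballI impI)
    fix F F' e assume FF: "F \<in> \<E>" "F' \<in> \<E>" and e: "e \<in> E" "e \<inter> S = {} \<or> e \<subseteq> S"
    have "F \<inter> E1 = F' \<inter> E1" "F \<inter> E2 = F' \<inter> E2" using FF unfolding \<E>_def by auto
    then show "e \<in> F \<longleftrightarrow> e \<in> F'" using e unfolding E1_def E2_def by blast
  qed
  then show ?thesis using big by (intro that[of \<E>]) (auto simp: \<E>_def)
qed

text \<open>One more pigeonhole step, over the at most n^N positions of the copy, makes all members
  contain it at the same place \<phi>; its vertex set then serves as \<open>S\<close>.\<close>

lemma ex_large_fibre_copy:
  fixes c :: real
  assumes good: "good s0 (card V)" and ext: "extremal V E" and N: "1 \<le> N" "N \<le> s0"
    and \<G>: "\<G> \<subseteq> hfree V E" "c > 0" "D (card V) \<le> c * card \<G>"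
    and copy: "\<And>F. F \<in> \<G> \<Longrightarrow> emb V E F {..<N} AU" and AU: "AU \<subseteq> {..<N} \<times> {..<N}"
  obtains \<phi> \<E> where "inj_on \<phi> {..<N}" "\<phi> ` {..<N} \<subseteq> V" "\<E> \<subseteq> \<G>" "agree_off E (\<phi> ` {..<N}) \<E>"
    "\<And>F a b. F \<in> \<E> \<Longrightarrow> (a, b) \<in> AU \<Longrightarrow> arc E F (\<phi> a) (\<phi> b)"
    "2 powr (\<beta> * N * card V - 2 * real N ^ 2 - K) / (c * card V ^ N) \<le> card \<E>"
proof -
  have G: "graph (V, E)" using ext unfolding extremal_def by simp
  have fin: "finite V" "finite E" using graph_finite[OF G] by auto
  have f\<G>: "finite \<G>" using \<G>(1) fin unfolding hfree_def by (auto intro: finite_subset[of _ "Pow E"])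
  have \<G>ne: "\<G> \<noteq> {}" using \<G>(3) D_pos[of "card V"] by auto
  let ?ok = "\<lambda>F f. inj_on f {..<N} \<and> f ` {..<N} \<subseteq> V \<and> (\<forall>(x, y)\<in>AU. arc E F (f x) (f y))"
  have "\<forall>F\<in>\<G>. \<exists>f. f \<in> {..<N} \<rightarrow>\<^sub>E V \<and> ?ok F f"
  proof
    fix F assume "F \<in> \<G>"
    then obtain f where f: "?ok F f" using copy unfolding emb_def by blast
    have "?ok F (restrict f {..<N})"
    proof (intro conjI)
      show "inj_on (restrict f {..<N}) {..<N}" using f by (simp add: inj_on_restrict_eq)
      show "restrict f {..<N} ` {..<N} \<subseteq> V" using f by auto
      show "\<forall>(x, y)\<in>AU. arc E F (restrict f {..<N} x) (restrict f {..<N} y)"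
      proof (intro ballI, clarify)
        fix x y assume xy: "(x, y) \<in> AU"
        then have "x < N" "y < N" using AU by auto
        moreover have "arc E F (f x) (f y)" using f xy by blast
        ultimately show "arc E F (restrict f {..<N} x) (restrict f {..<N} y)" by simp
      qed
    qed
    then show "\<exists>f. f \<in> {..<N} \<rightarrow>\<^sub>E V \<and> ?ok F f" using f by (intro exI[of _ "restrict f {..<N}"]) auto
  qed
  then obtain f where f: "\<And>F. F \<in> \<G> \<Longrightarrow> f F \<in> {..<N} \<rightarrow>\<^sub>E V" "\<And>F. F \<in> \<G> \<Longrightarrow> ?ok F (f F)" by metis
  have im: "f ` \<G> \<subseteq> {..<N} \<rightarrow>\<^sub>E V" using f(1) by auto
  have "finite ({..<N} \<rightarrow>\<^sub>E V)" using fin by (intro finite_PiE) auto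
  moreover have "{..<N} \<rightarrow>\<^sub>E V \<noteq> {}" using im \<G>ne by auto
  ultimately obtain \<phi> where \<phi>: "\<phi> \<in> {..<N} \<rightarrow>\<^sub>E V"
    and le: "card \<G> \<le> card ({..<N} \<rightarrow>\<^sub>E V) * card {F \<in> \<G>. f F = \<phi>}"
    using pigeonhole_fibre[OF f\<G> _ im] by blast
  define \<H> where "\<H> = {F \<in> \<G>. f F = \<phi>}"
  have le': "card \<G> \<le> card V ^ N * card \<H>" using le by (simp add: card_funcsetE \<H>_def)
  have "\<H> \<noteq> {}" using le' \<G>ne f\<G> by (metis card_0_eq card.empty le_zero_eq mult_is_0)
  then have \<phi>ok: "inj_on \<phi> {..<N}" "\<phi> ` {..<N} \<subseteq> V" using f(2) unfolding \<H>_def by auto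
  let ?S = "\<phi> ` {..<N}"
  have cS: "card ?S = N" using \<phi>ok(1) by (simp add: card_image)
  have "V \<noteq> {}" using \<phi>ok(2) N(1) by (auto simp: lessThan_empty_iff)
  then have V0: "card V > 0" using fin by (simp add: card_gt_0_iff)
  have "real (D (card V)) \<le> c * real (card V ^ N * card \<H>)"
    using \<G>(2,3) le' by (smt (verit) mult_left_mono of_nat_mono)
  then have "D (card V) \<le> (c * card V ^ N) * card \<H>" by simp
  moreover have "\<H> \<subseteq> hfree V E" using \<G>(1) unfolding \<H>_def by auto
  moreover have "c * card V ^ N > 0" using \<G>(2) V0 by simp
  ultimately obtain \<E> where \<E>: "\<E> \<subseteq> \<H>" "agree_off E ?S \<E>"
    "2 powr (\<beta> * card ?S * card V - 2 * real (card ?S) ^ 2 - K) / (c * card V ^ N) \<le> card \<E>"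
    using ex_large_fibre[OF good ext \<phi>ok(2), of \<H> "c * card V ^ N"] N unfolding cS by blast
  show ?thesis
  proof (rule that[OF \<phi>ok, of \<E>])
    show "arc E F (\<phi> a) (\<phi> b)" if "F \<in> \<E>" "(a, b) \<in> AU" for F a b
    proof -
      have "F \<in> \<G>" "f F = \<phi>" using that(1) \<E>(1) unfolding \<H>_def by auto
      then show ?thesis using f(2)[of F] that(2) by blast
    qed
  qed (use \<E> in \<open>auto simp: \<H>_def cS\<close>)
qed

end

section \<open>From universal pieces to a partition with o(n^2) inner edges\<close>

section \<open>Partitions with few inner edges\<close>

lemma card_small_traces_le:
  assumes "finite S" "A \<subseteq> S" "B \<subseteq> S" "A \<inter> B = {}"
  shows "card {r. r \<subseteq> S \<and> card (r \<inter> A) < d \<and> card (r \<inter> B) < d'}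
    \<le> 2 ^ (card S - card A - card B) * (card {r. r \<subseteq> A \<and> card r < d} * card {r. r \<subseteq> B \<and> card r < d'})"
proof -
  let ?P = "Pow (S - A - B) \<times> ({r. r \<subseteq> A \<and> card r < d} \<times> {r. r \<subseteq> B \<and> card r < d'})"
  have fin: "finite A" "finite B" using assms by (auto intro: finite_subset)
  have "card {r. r \<subseteq> S \<and> card (r \<inter> A) < d \<and> card (r \<inter> B) < d'} \<le> card ?P"
  proof (rule card_inj_on_le)
    show "inj_on (\<lambda>r. (r - A - B, r \<inter> A, r \<inter> B)) {r. r \<subseteq> S \<and> card (r \<inter> A) < d \<and> card (r \<inter> B) < d'}"
      by (rule inj_onI) blast
    show "finite ?P" using assms fin by auto
  qed (use assms in auto)
  also have "card ?P = 2 ^ (card S - card A - card B) *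
      (card {r. r \<subseteq> A \<and> card r < d} * card {r. r \<subseteq> B \<and> card r < d'})"
  proof -
    have "card (S - A - B) = card S - card A - card B"
    proof -
      have "B \<subseteq> S - A" using assms by auto
      then show ?thesis using assms(2) fin by (simp add: card_Diff_subset)
    qed
    then show ?thesis using assms(1) by (simp add: card_cartesian_product card_Pow)
  qed
  finally show ?thesis .
qed

lemma card_residue_class:
  assumes "i < (k::nat)"
  shows "card {v. v < k * m \<and> v mod k = i} = m"
proof -
  have "{v. v < k * m \<and> v mod k = i} = (\<lambda>j. k * j + i) ` {..<m}"
  proof safe
    fix v assume v: "v < k * m" "i = v mod k"
    then have "v div k < m" by (simp add: less_mult_imp_div_less mult.commute)
    moreover have "v = k * (v div k) + v mod k" by simp
    ultimately show "v \<in> (\<lambda>j. k * j + v mod k) ` {..<m}" by blast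
  next
    fix j assume "j < m"
    then have "k * j + i < k * Suc j" "k * Suc j \<le> k * m" using assms by (simp, intro mult_le_mono2, simp)
    then show "k * j + i < k * m" by linarith
  qed (use assms in auto)
  moreover have "inj_on (\<lambda>j. k * j + i) {..<m}" using assms by (auto simp: inj_on_def)
  ultimately show ?thesis by (simp add: card_image)
qed

lemma inj_on_into_card_le:
  assumes "finite A" "finite B" "card A \<le> card B"
  obtains g where "inj_on g A" "g ` A \<subseteq> B"
  using card_le_inj[OF assms] by blast

lemma ceil_less_iff: "card r < nat \<lceil>x\<rceil> \<longleftrightarrow> real (card r) < x"
  by linarith

context oriented_pattern
begin

text \<open>Induction on the number of colours. A copy of the universal k-partite graph is fixed as
  \<open>S\<close>; by the induction hypothesis most orientations contain one. If many orientations
  missed a (k+1)-coloured pattern, then for each shattered \<open>Y\<close> all but boundedly many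
  rows would be small on one of the k parts, because \<open>card Q\<close> vertices with the same
  large row provide the last colour class. That leaves too few sets \<open>Y\<close>: the rate is
  about N - m per vertex, but a fibre needs \<beta> N = N - k m / p, and k < p.\<close>

lemma most_contain_coloured:
  assumes "1 \<le> k" "k \<le> p"
  shows "\<forall>(VL :: nat set) AL c (C :: real). finite VL \<longrightarrow> AL \<subseteq> VL \<times> VL \<longrightarrow> (\<forall>x y. (x, y) \<in> AL \<longrightarrow> (y, x) \<notin> AL) \<longrightarrow>
    (\<forall>l\<in>VL. c l < k) \<longrightarrow> (\<forall>(x, y)\<in>AL. c x \<noteq> (c y :: nat)) \<longrightarrow> C > 0 \<longrightarrow>
    (\<exists>s0 n0. \<forall>V E. n0 \<le> card V \<longrightarrow> good s0 (card V) \<longrightarrow> extremal V E \<longrightarrow>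
      C * card {F \<in> hfree V E. \<not> emb V E F VL AL} < D (card V))"
  using assms
proof (induction k rule: nat_induct_at_least)
  case base
  show ?case
  proof (intro allI impI)
    fix VL :: "nat set" and AL and c :: "nat \<Rightarrow> nat" and C :: real
    assume VL: "finite VL" and AL: "AL \<subseteq> VL \<times> VL" and c: "\<forall>l\<in>VL. c l < 1" "\<forall>(x, y)\<in>AL. c x \<noteq> c y"
    have AL0: "AL = {}"
    proof (rule ccontr)
      assume "AL \<noteq> {}"
      then obtain x y where "(x, y) \<in> AL" by auto
      then have "c x \<noteq> c y" "x \<in> VL" "y \<in> VL" using c(2) AL by auto
      then show False using c(1) by (metis less_one)
    qed
    have "C * card {F \<in> hfree V E. \<not> emb V E F VL AL} < D (card V)"
      if n: "card VL \<le> card V" and ext: "extremal V E" for V E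
    proof -
      have "finite V" using ext graph_finite unfolding extremal_def by blast
      then obtain g where g: "inj_on g VL" "g ` VL \<subseteq> V" using inj_on_into_card_le[OF VL _ n] by blast
      then have "emb V E F VL AL" for F unfolding emb_def AL0 by auto
      then have none: "{F \<in> hfree V E. \<not> emb V E F VL AL} = {}" by auto
      show ?thesis unfolding none using D_pos by simp
    qed
    then show "\<exists>s0 n0. \<forall>V E. n0 \<le> card V \<longrightarrow> good s0 (card V) \<longrightarrow> extremal V E \<longrightarrow>
      C * card {F \<in> hfree V E. \<not> emb V E F VL AL} < D (card V)" by blast
  qed
next
  case (Suc k)
  have kp: "k \<le> p" "real k \<le> real p - 1" using Suc.prems by linarith+
  note IH = Suc.IH[OF kp(1)]
  show ?case
  proof (intro allI impI)
    fix VL :: "nat set" and AL and c :: "nat \<Rightarrow> nat" and C :: real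
    assume VL: "finite VL" and AL: "AL \<subseteq> VL \<times> VL" "\<forall>x y. (x, y) \<in> AL \<longrightarrow> (y, x) \<notin> AL"
      and c: "\<forall>l\<in>VL. c l < Suc k" "\<forall>(x, y)\<in>AL. c x \<noteq> c y" and C: "C > 0"
    \<comment> \<open>Since k \<le> p - 1, the ratio k / p is at most 1 - 2 \<epsilon>. One
      \<epsilon> m is lost in the count of small traces; the other, by the choice of
      \<open>m\<close>, is at least log2 (k + 1) + 1.\<close>
    define \<epsilon> :: real where "\<epsilon> = 1 / (2 * p)"
    have \<epsilon>: "\<epsilon> > 0" unfolding \<epsilon>_def using p2 by simp
    obtain \<delta> :: real where \<delta>: "\<delta> > 0" "\<delta> \<le> 1" and small: "\<And>A :: nat set. finite A \<Longrightarrow>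
      card {r. r \<subseteq> A \<and> real (card r) < \<delta> * card A} \<le> 2 powr (\<epsilon> * card A)"
      using card_small_subsets_le[OF \<epsilon>] by blast
    obtain m0 :: nat where m0: "\<And>m. m \<ge> m0 \<Longrightarrow> \<exists>F \<subseteq> turan_edges k (k * m).
      univ VL AL k (\<lambda>i. {v. v < k * m \<and> v mod k = i}) (turan_edges k (k * m)) (nat \<lceil>\<delta> * m\<rceil>) F"
      using ex_univ[OF VL AL(1) AL(2) Suc.hyps \<delta>(1)] by blast
    define m where "m = max (m0 + 1) (nat \<lceil>(log 2 (k + 1) + 1) / \<epsilon>\<rceil>)"
    have m: "m \<ge> m0" "m \<ge> 1" unfolding m_def by auto
    have "(log 2 (k + 1) + 1) / \<epsilon> \<le> m" unfolding m_def by linarith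
    then have m2: "log 2 (k + 1) + 1 \<le> \<epsilon> * m" using \<epsilon> by (simp add: divide_le_eq mult.commute)
    define d where "d = nat \<lceil>\<delta> * m\<rceil>"
    define EU where "EU = turan_edges k (k * m)"
    obtain FU where FU: "univ VL AL k (\<lambda>i. {v. v < k * m \<and> v mod k = i}) EU d FU"
      using m0[OF m(1)] unfolding d_def EU_def by blast
    define N where "N = k * m"
    have N1: "1 \<le> N" unfolding N_def using Suc.hyps m(2) by (metis mult_le_mono nat_mult_1)
    have mN: "m \<le> N" unfolding N_def using Suc.hyps by simp
    define AU where "AU = {(a, b). a < N \<and> b < N \<and> arc EU FU a b}"
    have AU: "AU \<subseteq> {..<N} \<times> {..<N}" unfolding AU_def by auto
    \<comment> \<open>The factor 2 ensures that the orientations without the universal graph are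
      fewer than D / (2 C). Of the D / C orientations assumed in the contradiction, at least D / (2
      C) then contain it.\<close>
    have "\<exists>s0 n0. \<forall>V E. n0 \<le> card V \<longrightarrow> good s0 (card V) \<longrightarrow> extremal V E \<longrightarrow>
      2 * C * card {F \<in> hfree V E. \<not> emb V E F {..<N} AU} < D (card V)"
    proof (rule IH[rule_format, of "{..<N}" AU "\<lambda>a. a mod k" "2 * C"])
      show "AU \<subseteq> {..<N} \<times> {..<N}" by (rule AU)
      show "(y, x) \<notin> AU" if "(x, y) \<in> AU" for x y
        using that unfolding AU_def arc_def by (auto simp: insert_commute)
      show "case e of (x, y) \<Rightarrow> x mod k \<noteq> y mod k" if "e \<in> AU" for e
        using that unfolding AU_def arc_def EU_def turan_edges_def
        by (auto simp: doubleton_eq_iff)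
    qed (use C Suc.hyps in auto)
    then obtain s1 n1 where s1: "\<And>V E. n1 \<le> card V \<Longrightarrow> good s1 (card V) \<Longrightarrow> extremal V E \<Longrightarrow>
      2 * C * card {F \<in> hfree V E. \<not> emb V E F {..<N} AU} < D (card V)" by blast
    define Q where "Q = {l \<in> VL. c l = k}"
    have fQ: "finite Q" unfolding Q_def using VL by simp
    \<comment> \<open>Vertices that may be absent from the count \<open>u\<close> of controlled
      rows: the \<open>N\<close> vertices of \<open>S\<close> and fewer than
      \<open>card Q * 2 ^ N\<close> exceptions.\<close>
    define h where "h = N + card Q * 2 ^ N"
    define cst where "cst = 2 * real N ^ 2 + K + log 2 (2 * C) + (1 - \<epsilon>) * m * h"
    obtain n2 :: nat where n2: "\<And>n::nat. n \<ge> n2 \<Longrightarrow> N * log 2 n + cst < 1 * n"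
      using eventually_log_less_linear[of 1 "N" cst] by auto
    have "C * card {F \<in> hfree V E. \<not> emb V E F VL AL} < D (card V)"
      if n: "max (max n1 n2) 1 \<le> card V" and good: "good (max s1 N) (card V)" and ext: "extremal V E" for V E
    proof (rule ccontr)
      let ?n = "card V"
      assume "\<not> ?thesis"
      then have ge: "D ?n \<le> C * card {F \<in> hfree V E. \<not> emb V E F VL AL}" by simp
      have G: "graph (V, E)" using ext unfolding extremal_def by simp
      have fin: "finite V" "finite E" using graph_finite[OF G] by auto
      have fh: "finite (hfree V E)" unfolding hfree_def using fin by simp
      define \<G> where "\<G> = {F \<in> hfree V E. \<not> emb V E F VL AL \<and> emb V E F {..<N} AU}"
      have "card {F \<in> hfree V E. \<not> emb V E F VL AL}
          \<le> card (\<G> \<union> {F \<in> hfree V E. \<not> emb V E F {..<N} AU})"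
        by (rule card_mono) (use fh in \<open>auto simp: \<G>_def\<close>)
      also have "\<dots> \<le> card \<G> + card {F \<in> hfree V E. \<not> emb V E F {..<N} AU}" by (rule card_Un_le)
      finally have "C * card {F \<in> hfree V E. \<not> emb V E F VL AL}
          \<le> C * (card \<G> + card {F \<in> hfree V E. \<not> emb V E F {..<N} AU})"
        using C by (intro mult_left_mono) auto
      moreover have "2 * C * card {F \<in> hfree V E. \<not> emb V E F {..<N} AU} < D ?n"
        using s1 n good_mono[OF good] ext by simp
      ultimately have D\<G>: "D ?n \<le> (2 * C) * card \<G>" using ge by (simp add: distrib_left)
      obtain \<phi> \<E> where \<phi>: "inj_on \<phi> {..<N}" "\<phi> ` {..<N} \<subseteq> V" and \<E>: "\<E> \<subseteq> \<G>"
        "agree_off E (\<phi> ` {..<N}) \<E>"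
        and arcs: "\<And>F a b. F \<in> \<E> \<Longrightarrow> (a, b) \<in> AU \<Longrightarrow> arc E F (\<phi> a) (\<phi> b)"
        and big: "2 powr (\<beta> * N * ?n - 2 * real N ^ 2 - K) / (2 * C * ?n ^ N) \<le> card \<E>"
        by (rule ex_large_fibre_copy[OF good ext N1, of \<G> "2 * C" AU]) (use C D\<G> AU in \<open>auto simp: \<G>_def\<close>)
      define S where "S = \<phi> ` {..<N}"
      define A where "A i = \<phi> ` {v. v < N \<and> v mod k = i}" for i
      have cS: "card S = N" unfolding S_def using \<phi>(1) by (simp add: card_image)
      have fS: "finite S" unfolding S_def by simp
      have SV: "S \<subseteq> V" using \<phi>(2) unfolding S_def .
      have AS: "A i \<subseteq> S" for i unfolding A_def S_def by auto
      have cA: "card (A i) = m" if "i < k" for i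
      proof -
        have "card (A i) = card {v. v < N \<and> v mod k = i}"
          unfolding A_def by (rule card_image) (rule inj_on_subset[OF \<phi>(1)], auto)
        then show ?thesis using card_residue_class[OF that] unfolding N_def by simp
      qed
      define B where "B = {r. r \<subseteq> S \<and> (\<exists>i<k. card (r \<inter> A i) < d)}"
      define \<Y> where "\<Y> = {Y. Y \<subseteq> E \<and> shatters \<E> Y}"
      have \<E>E: "\<E> \<subseteq> Pow E" using \<E>(1) unfolding \<G>_def hfree_def by auto
      have c\<E>: "card \<E> \<le> card \<Y>" unfolding \<Y>_def by (rule card_le_card_shattered[OF fin(2) \<E>E])
      have dm: "d \<le> m" unfolding d_def using \<delta> by (simp add: nat_le_iff ceiling_le_iff mult_left_le_one_le)
      \<comment> \<open>Among \<open>card Q * 2 ^ N\<close> vertices with rows large on all parts,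
        \<open>card Q\<close> share one row \<open>r\<close>. They receive the last colour class,
        and the other labels are found in the universal graph inside \<open>r\<close>.\<close>
      have few: "card {v \<in> V - S. row Y S v \<notin> B} < card Q * 2 ^ N" if Y: "Y \<in> \<Y>" for Y
      proof (rule ccontr)
        assume "\<not> ?thesis"
        then have many: "card Q * 2 ^ N \<le> card {v \<in> V - S. row Y S v \<notin> B}" by simp
        let ?W = "{v \<in> V - S. row Y S v \<notin> B}"
        have "finite ?W" using fin by simp
        moreover have "finite (Pow S - B)" using fS by simp
        moreover have "row Y S ` ?W \<subseteq> Pow S - B" by (auto simp: row_def)
        moreover have "S \<in> Pow S - B"
        proof -
          have "card (S \<inter> A i) \<ge> d" if "i < k" for i
            using cA[OF that] AS[of i] dm by (simp add: Int_absorb1)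
          then show ?thesis unfolding B_def using leD by blast
        qed
        ultimately obtain r where r: "r \<in> Pow S - B"
          "card ?W \<le> card (Pow S - B) * card {v \<in> ?W. row Y S v = r}"
          using pigeonhole_fibre[of ?W "Pow S - B" "row Y S"] by blast
        let ?X = "{v \<in> ?W. row Y S v = r}"
        have "card (Pow S - B) \<le> 2 ^ N" using card_mono[of "Pow S" "Pow S - B"] fS cS by (simp add: card_Pow)
        then have "card Q * 2 ^ N \<le> 2 ^ N * card ?X" using r(2) many by (meson le_trans mult_le_mono1)
        then have "card Q \<le> card ?X" by simp
        moreover have "finite ?X" using fin by simp
        ultimately obtain g where g: "inj_on g Q" "g ` Q \<subseteq> ?X" using inj_on_into_card_le[OF fQ] by blast
        have "\<exists>F\<in>\<E>. emb V E F VL AL"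
        proof (rule emb_via_univ[where k = k and m = m and c = c and Q = Q and g = g and Y = Y and \<phi> = \<phi>
              and Z = "\<lambda>i. r \<inter> A i", OF FU[unfolded EU_def] Suc.hyps AL(1)])
          show "(y, x) \<notin> AL" if "(x, y) \<in> AL" for x y using AL(2) that by blast
          show "inj_on \<phi> {..<k * m}" "\<phi> ` {..<k * m} \<subseteq> V" using \<phi> unfolding N_def by auto
          show "arc E F (\<phi> a) (\<phi> b)" if "F \<in> \<E>" "a < k * m" "b < k * m" "arc (turan_edges k (k * m)) FU a b" for F a b
            using arcs[of F a b] that unfolding AU_def N_def EU_def by auto
          show "shatters \<E> Y" "Y \<subseteq> E" using Y unfolding \<Y>_def by auto
          show "g ` Q \<subseteq> V - \<phi> ` {..<k * m}" using g(2) unfolding S_def N_def by auto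
          show "Q \<subseteq> VL" unfolding Q_def by auto
          show "c l < k" if "l \<in> VL - Q" for l using c(1)[rule_format, of l] that unfolding Q_def by (auto simp: less_Suc_eq)
          show "c x \<noteq> c y" if "(x, y) \<in> AL" for x y using c(2) that by auto
          show "r \<inter> A i \<subseteq> \<phi> ` {v. v < k * m \<and> v mod k = i} \<and> d \<le> card (r \<inter> A i)" if "i < k" for i
          proof
            show "r \<inter> A i \<subseteq> \<phi> ` {v. v < k * m \<and> v mod k = i}" unfolding A_def N_def by auto
            have "r \<subseteq> S" "r \<notin> B" using r(1) by auto
            then show "d \<le> card (r \<inter> A i)" using that unfolding B_def using not_less by blast
          qed
          show "{a, g l} \<in> Y" if "l \<in> Q" "x \<in> VL - Q" "a \<in> r \<inter> A (c x)" for l x a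
          proof -
            have "row Y S (g l) = r" using g(2) that(1) by auto
            then show ?thesis using that(3) unfolding row_def by auto
          qed
          show "arc E F (g x) (g y)" if "(x, y) \<in> AL" "x \<in> Q" "y \<in> Q" for x y F
            using c(2) that unfolding Q_def by auto
        qed (rule g(1))
        then show False using \<E>(1) unfolding \<G>_def by auto
      qed
      let ?W = "V - S"
      define u where "u = card ?W - card Q * 2 ^ N"
      have hits: "u \<le> card {v \<in> ?W. row Y S v \<in> B}" if "Y \<in> \<Y>" for Y
      proof -
        have "card ?W = card ({v \<in> ?W. row Y S v \<in> B} \<union> {v \<in> ?W. row Y S v \<notin> B})"
          by (rule arg_cong[where f = card]) auto
        also have "\<dots> \<le> card {v \<in> ?W. row Y S v \<in> B} + card {v \<in> ?W. row Y S v \<notin> B}" by (rule card_Un_le)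
        finally show ?thesis using few[OF that] unfolding u_def by linarith
      qed
      \<comment> \<open>The weight is chosen so that \<mu> card B is at most k 2^N, of the same
        order as the number 2^N of all rows.\<close>
      define \<mu> :: real where "\<mu> = 2 powr ((1 - \<epsilon>) * m)"
      have \<epsilon>1: "\<epsilon> \<le> 1" unfolding \<epsilon>_def using p2 by simp
      have \<mu>: "\<mu> \<ge> 1" unfolding \<mu>_def using \<epsilon>1 by (intro ge_one_powr_ge_zero) auto
      have cB: "card B \<le> k * 2 powr (N - m + \<epsilon> * m)"
      proof -
        have "B = (\<Union>i<k. {r. r \<subseteq> S \<and> card (r \<inter> A i) < d})" unfolding B_def by auto
        then have "card B \<le> (\<Sum>i<k. card {r. r \<subseteq> S \<and> card (r \<inter> A i) < d})"
          using card_UN_le[of "{..<k}"] by simp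
        then have "real (card B) \<le> real (\<Sum>i<k. card {r. r \<subseteq> S \<and> card (r \<inter> A i) < d})"
          by (simp only: of_nat_le_iff)
        also have "\<dots> = (\<Sum>i<k. real (card {r. r \<subseteq> S \<and> card (r \<inter> A i) < d}))" by (simp only: of_nat_sum)
        also have "\<dots> \<le> (\<Sum>i<k. 2 powr (N - m + \<epsilon> * m))"
        proof (rule sum_mono)
          fix i assume i: "i \<in> {..<k}"
          then have cAi: "card (A i) = m" using cA by simp
          have fA: "finite (A i)" using AS fS finite_subset by blast
          have "card {r. r \<subseteq> S \<and> card (r \<inter> A i) < d}
              = card {r. r \<subseteq> S \<and> card (r \<inter> A i) < d \<and> card (r \<inter> {}) < 1}" by simp
          also have "\<dots> \<le> 2 ^ (card S - card (A i) - card ({}::nat set)) *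
              (card {r. r \<subseteq> A i \<and> card r < d} * card {r :: nat set. r \<subseteq> {} \<and> card r < 1})"
            by (rule card_small_traces_le) (use fS AS in auto)
          also have "{r :: nat set. r \<subseteq> {} \<and> card r < 1} = {{}}" by auto
          finally have "card {r. r \<subseteq> S \<and> card (r \<inter> A i) < d} \<le> 2 ^ (N - m) * card {r. r \<subseteq> A i \<and> card r < d}"
            using cS cAi by simp
          then have "real (card {r. r \<subseteq> S \<and> card (r \<inter> A i) < d})
              \<le> real (2 ^ (N - m) * card {r. r \<subseteq> A i \<and> card r < d})" by (simp only: of_nat_le_iff)
          also have "\<dots> = 2 powr (N - m) * card {r. r \<subseteq> A i \<and> card r < d}"
            using mN by (simp add: powr_realpow[symmetric] of_nat_diff)
          also have "\<dots> \<le> 2 powr (N - m) * 2 powr (\<epsilon> * m)"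
            using small[OF fA] unfolding cAi d_def ceil_less_iff by (intro mult_left_mono) auto
          finally show "real (card {r. r \<subseteq> S \<and> card (r \<inter> A i) < d}) \<le> 2 powr (N - m + \<epsilon> * m)"
            by (simp add: powr_add[symmetric] algebra_simps)
        qed
        finally show ?thesis by simp
      qed
      have "card \<Y> * \<mu> ^ u \<le> (card (Pow S) + (\<mu> - 1) * card B) ^ card ?W"
        by (rule card_rows_le[OF G SV _ _ hits _ _ \<mu>])
          (use shattered_subset_cross[OF \<E>(2) \<E>E] in \<open>auto simp: S_def B_def row_def \<Y>_def\<close>)
      also have "\<dots> \<le> ((k + 1) * 2 powr N) ^ card ?W"
      proof (rule power_mono)
        have "(\<mu> - 1) * card B \<le> \<mu> * (k * 2 powr (N - m + \<epsilon> * m))"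
          using \<mu> cB by (intro mult_mono) auto
        also have "\<dots> = k * (2 powr ((1 - \<epsilon>) * m) * 2 powr (N - m + \<epsilon> * m))" unfolding \<mu>_def by simp
        also have "\<dots> = k * 2 powr N"
          unfolding powr_add[symmetric] using mN by (simp add: left_diff_distrib of_nat_diff)
        finally show "card (Pow S) + (\<mu> - 1) * card B \<le> (k + 1) * 2 powr N"
          using fS cS by (simp add: card_Pow powr_realpow algebra_simps)
      qed (use \<mu> in simp)
      also have "\<dots> \<le> ((k + 1) * 2 powr N) ^ ?n"
      proof (rule power_increasing)
        show "1 \<le> (k + 1) * 2 powr N"
          using mult_mono[of 1 "real (k + 1)" 1 "2 powr N"] by (simp add: ge_one_powr_ge_zero)
        show "card ?W \<le> ?n" using fin by (auto intro: card_mono)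
      qed
      also have "(k + 1) * 2 powr N = 2 powr (log 2 (k + 1) + N)" by (simp add: powr_add)
      also have "(2 powr (log 2 (k + 1) + N)) ^ ?n = 2 powr (?n * (log 2 (k + 1) + N))"
        by (simp add: powr_power mult.commute)
      also have "\<mu> ^ u = 2 powr (u * ((1 - \<epsilon>) * m))" unfolding \<mu>_def by (simp add: powr_power mult.commute)
      finally have up: "card \<Y> * 2 powr (u * ((1 - \<epsilon>) * m)) \<le> 2 powr (?n * (log 2 (k + 1) + N))" .
      have "real u \<ge> real ?n - h"
      proof -
        have "card ?W = ?n - N" using SV fS cS by (simp add: card_Diff_subset)
        then show ?thesis unfolding u_def h_def by linarith
      qed
      then have "(real ?n - h) * ((1 - \<epsilon>) * m) \<le> u * ((1 - \<epsilon>) * m)" using \<epsilon>1 by (intro mult_right_mono) auto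
      then have "2 powr ((real ?n - h) * ((1 - \<epsilon>) * m)) \<le> 2 powr (u * ((1 - \<epsilon>) * m))"
        by (intro powr_mono) auto
      then have "card \<Y> * 2 powr ((real ?n - h) * ((1 - \<epsilon>) * m)) \<le> card \<Y> * 2 powr (u * ((1 - \<epsilon>) * m))"
        by (intro mult_left_mono) auto
      then have up': "card \<Y> * 2 powr ((real ?n - h) * ((1 - \<epsilon>) * m)) \<le> 2 powr (?n * (log 2 (k + 1) + N))"
        using up by (rule order_trans)
      have n0: "real ?n > 0" using n by simp
      have "2 powr (log 2 (2 * C)) = 2 * C" using C by simp
      moreover have "2 powr (N * log 2 ?n) = real ?n ^ N"
      proof -
        have "2 powr (N * log 2 ?n) = (2 powr (log 2 ?n)) powr N" by (simp add: powr_powr mult.commute)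
        then show ?thesis using n0 by (simp add: powr_realpow)
      qed
      ultimately have den: "2 * C * ?n ^ N = 2 powr (log 2 (2 * C) + N * log 2 ?n)" by (simp add: powr_add)
      have "2 powr (\<beta> * N * ?n - 2 * real N ^ 2 - K) / (2 * C * ?n ^ N) \<le> card \<Y>"
        using big c\<E> by linarith
      then have "2 powr (\<beta> * N * ?n - 2 * real N ^ 2 - K) / 2 powr (log 2 (2 * C) + N * log 2 ?n)
          * 2 powr ((real ?n - h) * ((1 - \<epsilon>) * m)) \<le> card \<Y> * 2 powr ((real ?n - h) * ((1 - \<epsilon>) * m))"
        unfolding den by (intro mult_right_mono) auto
      also note up'
      finally have "2 powr (\<beta> * N * ?n - 2 * real N ^ 2 - K) / 2 powr (log 2 (2 * C) + N * log 2 ?n)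
          * 2 powr ((real ?n - h) * ((1 - \<epsilon>) * m)) \<le> 2 powr (?n * (log 2 (k + 1) + N))" .
      then have "2 powr (\<beta> * N * ?n - 2 * real N ^ 2 - K - (log 2 (2 * C) + N * log 2 ?n)
          + (real ?n - h) * ((1 - \<epsilon>) * m)) \<le> 2 powr (?n * (log 2 (k + 1) + N))"
        by (simp only: powr_add powr_diff)
      then have "\<beta> * N * ?n - 2 * real N ^ 2 - K - (log 2 (2 * C) + N * log 2 ?n)
          + (real ?n - h) * ((1 - \<epsilon>) * m) \<le> ?n * (log 2 (k + 1) + N)" by simp
      then have fin_ineq: "?n * (\<beta> * N + (1 - \<epsilon>) * m - log 2 (k + 1) - N) \<le> N * log 2 ?n + cst"
        unfolding cst_def by (simp add: algebra_simps)
      \<comment> \<open>The rate \<beta> N of the fibre against the rate N - (1 - \<epsilon>) m +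
        log2 (k + 1) of the rows. A gap of 1 per vertex defeats all terms of order log n.\<close>
      have "1 \<le> \<beta> * N + (1 - \<epsilon>) * m - log 2 (k + 1) - N"
      proof -
        have "\<beta> * N - N = - (k / p) * m" unfolding \<beta>_def N_def using p2 by (simp add: field_simps)
        moreover have "k / p \<le> 1 - 2 * \<epsilon>" unfolding \<epsilon>_def using kp(2) p2 by (simp add: field_simps)
        then have "k / p * m \<le> (1 - 2 * \<epsilon>) * m" by (intro mult_right_mono) auto
        ultimately have "\<beta> * N - N + (1 - \<epsilon>) * m \<ge> \<epsilon> * m" by (simp add: algebra_simps)
        then show ?thesis using m2 by linarith
      qed
      then have "real ?n * 1 \<le> ?n * (\<beta> * N + (1 - \<epsilon>) * m - log 2 (k + 1) - N)" by (intro mult_left_mono) auto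
      then show False using fin_ineq n2[of ?n] n by simp
    qed
    then show "\<exists>s0 n0. \<forall>V E. n0 \<le> card V \<longrightarrow> good s0 (card V) \<longrightarrow> extremal V E \<longrightarrow>
      C * card {F \<in> hfree V E. \<not> emb V E F VL AL} < D (card V)" by blast
  qed
qed


text \<open>A vertex with many neighbours in its own part, all having large common traces with it, is the
  centre of a pure star whose leaves have equal traces; the universal graph completes it to a copy.\<close>
lemma star_emb:
  fixes m :: nat
  defines "EU \<equiv> turan_edges p (p * m)"
  assumes univ: "univ VH AH p (\<lambda>i. {v. v < p * m \<and> v mod p = i}) EU d FU"
    and G: "graph (V, E)"
    and \<phi>: "inj_on \<phi> {..<p * m}" "\<phi> ` {..<p * m} \<subseteq> V"
    and arcsU: "\<And>F a b. F \<in> \<E> \<Longrightarrow> a < p * m \<Longrightarrow> b < p * m \<Longrightarrow> arc EU FU a b \<Longrightarrow> arc E F (\<phi> a) (\<phi> b)"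
    and \<E>: "agree_off E S \<E>" and Y: "shatters \<E> Y" "Y \<subseteq> E"
    and S: "S = \<phi> ` {..<p * m}" and A: "\<And>i. A i = \<phi> ` {v. v < p * m \<and> v mod p = i}"
    and i: "i < p" "d \<le> card (A i)" and x: "x \<in> V - S"
    and T: "T \<subseteq> V - S" "\<And>y. y \<in> T \<Longrightarrow> {x, y} \<in> E" "2 * (card VH * 2 ^ (p * m)) \<le> card T"
      "\<And>y j. y \<in> T \<Longrightarrow> j < p \<Longrightarrow> j \<noteq> i \<Longrightarrow> d \<le> card (row Y S x \<inter> row Y S y \<inter> A j)"
  shows "\<exists>F\<in>\<E>. emb V E F VH AH"
proof -
  have fin: "finite V" "finite S" using graph_finite[OF G] unfolding S by auto
  have fT: "finite T" using T(1) fin finite_subset by blast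
  have cS: "card S = p * m" unfolding S using \<phi>(1) by (simp add: card_image)
  \<comment> \<open>Any member serves as reference: \<open>x\<close> and its neighbours in
    \<open>T\<close> lie outside \<open>S\<close>, so the edges between them are directed alike in
    the whole fibre.\<close>
  obtain F0 where F0: "F0 \<in> \<E>" using Y(1) unfolding shatters_def by blast
  have xT: "x \<notin> T" using T(2)[of x] G by (auto elim: graph_edgeD)
  have same: "arc E F x y \<longleftrightarrow> arc E F0 x y" "arc E F y x \<longleftrightarrow> arc E F0 y x" if "F \<in> \<E>" "y \<in> T" for F y
  proof -
    have "{x, y} \<in> E" "{x, y} \<inter> S = {}" using T(1,2) x that(2) by auto
    then have "{x, y} \<in> F \<longleftrightarrow> {x, y} \<in> F0" using \<E> F0 that(1) unfolding agree_off_def by blast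
    then show "arc E F x y \<longleftrightarrow> arc E F0 x y" "arc E F y x \<longleftrightarrow> arc E F0 y x"
      unfolding arc_def by (auto simp: insert_commute)
  qed
  \<comment> \<open>Completion from a set \<open>T'\<close> of leaves whose edges to
    \<open>x\<close> all have the direction required by the colouring; both pure stars are instances
    of it.\<close>
  have one_sign: "\<exists>F\<in>\<E>. emb V E F VH AH"
    if T': "T' \<subseteq> T" "card VH * 2 ^ (p * m) \<le> card T'"
      and z: "z \<in> VH" "\<forall>l\<in>VH. c l < p" "c z = i"
      and mono: "\<And>l l'. (l, l') \<in> AH \<Longrightarrow> c l = c l' \<Longrightarrow> (l = z \<or> l' = z) \<and> c l = i"
      and dir: "\<And>l l' y. (l, l') \<in> AH \<Longrightarrow> c l = c l' \<Longrightarrow> y \<in> T' \<Longrightarrow>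
          (l = z \<longrightarrow> arc E F0 x y) \<and> (l' = z \<longrightarrow> arc E F0 y x)"
    for T' z c
  proof -
    have fT': "finite T'" using T'(1) fT finite_subset by blast
    obtain r where r: "r \<in> Pow S" "card T' \<le> card (Pow S) * card {y \<in> T'. row Y S y = r}"
      using pigeonhole_fibre[of T' "Pow S" "row Y S"] fT' fin by (auto simp: row_def)
    let ?X = "{y \<in> T'. row Y S y = r}"
    have "card T' \<le> 2 ^ (p * m) * card ?X"
      using r(2) fin cS by (simp add: card_Pow)
    from order_trans[OF T'(2) this] have cX: "card VH \<le> card ?X" by simp
    have fX: "finite ?X" using fT' by simp
    obtain g0 where g0: "inj_on g0 VH" "g0 ` VH \<subseteq> ?X"
      using inj_on_into_card_le[OF finite_VH fX cX] by blast
    have "?X \<noteq> {}" using g0(2) z(1) by auto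
    then obtain y0 where y0: "y0 \<in> T'" "row Y S y0 = r" by auto
    define Q where "Q = {l \<in> VH. c l = i}"
    define g where "g l = (if l = z then x else g0 l)" for l
    have gX: "g l \<in> ?X" if "l \<in> Q" "l \<noteq> z" for l using that g0(2) unfolding g_def Q_def by auto
    \<comment> \<open>No label outside \<open>Q\<close> has colour \<open>i\<close>, so for this
      colour the set \<open>A i\<close> only serves the size condition.\<close>
    show ?thesis
    proof (rule emb_via_univ[where k = p and m = m and c = c and Q = Q and g = g and Y = Y and \<phi> = \<phi>
          and Z = "\<lambda>j. if j = i then A i else row Y S x \<inter> r \<inter> A j", OF univ[unfolded EU_def] _ AH(1) AH(2) \<phi>])
      show "1 \<le> p" using p2 by simp
      show "arc E F (\<phi> a) (\<phi> b)" if "F \<in> \<E>" "a < p * m" "b < p * m" "arc (turan_edges p (p * m)) FU a b" for F a b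
        using arcsU that unfolding EU_def by blast
      show "inj_on g Q"
      proof (rule inj_onI)
        fix l l' assume l: "l \<in> Q" "l' \<in> Q" "g l = g l'"
        have "x \<noteq> g0 l''" if "l'' \<in> VH" for l'' using g0(2) that T'(1) xT by auto
        then show "l = l'" using l inj_onD[OF g0(1), of l l'] unfolding g_def Q_def
          by (auto split: if_split_asm)
      qed
      show "g ` Q \<subseteq> V - \<phi> ` {..<p * m}"
      proof
        fix v assume "v \<in> g ` Q"
        then obtain l where l: "l \<in> Q" "v = g l" by auto
        have "v \<in> V - S"
        proof (cases "l = z")
          case True
          then show ?thesis using x l(2) by (simp add: g_def)
        next
          case False
          then have "v \<in> T'" using gX[OF l(1)] l(2) by auto
          then show ?thesis using T'(1) T(1) by auto
        qed
        then show "v \<in> V - \<phi> ` {..<p * m}" unfolding S .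
      qed
      show "Q \<subseteq> VH" unfolding Q_def by auto
      show "c l < p" if "l \<in> VH - Q" for l using z(2) that by auto
      show "c l \<noteq> c l'" if "(l, l') \<in> AH" "l \<notin> Q" "l' \<notin> Q" for l l'
        using mono[OF that(1)] that AH(1) unfolding Q_def by auto
      show "(if j = i then A i else row Y S x \<inter> r \<inter> A j) \<subseteq> \<phi> ` {v. v < p * m \<and> v mod p = j} \<and>
          d \<le> card (if j = i then A i else row Y S x \<inter> r \<inter> A j)" if "j < p" for j
        using T(4)[of y0 j] y0 T'(1) i(2) that by (auto simp: A)
      show "{a, g l} \<in> Y" if l: "l \<in> Q" and l': "l' \<in> VH - Q"
        and a: "a \<in> (if c l' = i then A i else row Y S x \<inter> r \<inter> A (c l'))" for l l' a
      proof -
        have "c l' \<noteq> i" using l' unfolding Q_def by auto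
        then have a': "a \<in> row Y S x" "a \<in> r" using a by auto
        show ?thesis
        proof (cases "l = z")
          case True
          then show ?thesis using a'(1) by (simp add: g_def row_def)
        next
          case False
          then have "row Y S (g l) = r" using gX[OF l] by auto
          then show ?thesis using a'(2) unfolding row_def by auto
        qed
      qed
      show "arc E F (g l) (g l')" if ll: "(l, l') \<in> AH" and Q: "l \<in> Q" "l' \<in> Q" and F: "F \<in> \<E>" for l l' F
      proof -
        have c: "c l = c l'" using Q unfolding Q_def by auto
        have ne: "l \<noteq> l'" using AH(2)[OF ll] ll by auto
        from mono[OF ll c] consider "l = z" "l' \<noteq> z" | "l \<noteq> z" "l' = z" using ne by blast
        then show ?thesis
        proof cases
          case 1
          then have "g l' \<in> T'" using gX[OF Q(2)] by auto
          then show ?thesis using 1 dir[OF ll c, of "g l'"] same[OF F] T'(1) by (auto simp: g_def)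
        next
          case 2
          then have "g l \<in> T'" using gX[OF Q(1)] by auto
          then show ?thesis using 2 dir[OF ll c, of "g l"] same[OF F] T'(1) by (auto simp: g_def)
        qed
      qed
    qed (use Y in auto)
  qed
  let ?Tp = "{y \<in> T. arc E F0 x y}" and ?Tm = "{y \<in> T. \<not> arc E F0 x y}"
  have "card T = card (?Tp \<union> ?Tm)" by (rule arg_cong[where f = card]) auto
  also have "\<dots> \<le> card ?Tp + card ?Tm" by (rule card_Un_le)
  finally have "card VH * 2 ^ (p * m) \<le> card ?Tp \<or> card VH * 2 ^ (p * m) \<le> card ?Tm"
    using T(3) by linarith
  then show ?thesis
  proof
    assume le: "card VH * 2 ^ (p * m) \<le> card ?Tp"
    obtain z c where z: "z \<in> VH" "\<forall>l\<in>VH. c l < p" "c z = i"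
      and col: "\<forall>(x, y)\<in>AH. c x = c y \<longrightarrow> x = z"
      using star_colourings(1)[OF i(1)] by blast
    have mono: "l = z" if "(l, l') \<in> AH" "c l = c l'" for l l' using col that by auto
    show ?thesis
    proof (rule one_sign[OF _ le z])
      fix l l' y assume ll: "(l, l') \<in> AH" "c l = c l'"
      show "(l = z \<or> l' = z) \<and> c l = i" using mono[OF ll] z(3) by auto
      have "l' \<noteq> z" using mono[OF ll] AH(2)[OF ll(1)] ll(1) by auto
      then show "(l = z \<longrightarrow> arc E F0 x y) \<and> (l' = z \<longrightarrow> arc E F0 y x)" if "y \<in> ?Tp" using that by auto
    qed auto
  next
    assume le: "card VH * 2 ^ (p * m) \<le> card ?Tm"
    obtain z c where z: "z \<in> VH" "\<forall>l\<in>VH. c l < p" "c z = i"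
      and col: "\<forall>(x, y)\<in>AH. c x = c y \<longrightarrow> y = z"
      using star_colourings(2)[OF i(1)] by blast
    have mono: "l' = z" if "(l, l') \<in> AH" "c l = c l'" for l l' using col that by auto
    show ?thesis
    proof (rule one_sign[OF _ le z])
      fix l l' y assume ll: "(l, l') \<in> AH" "c l = c l'"
      show "(l = z \<or> l' = z) \<and> c l = i" using mono[OF ll] ll(2) z(3) by auto
      have lz: "l \<noteq> z" using mono[OF ll] AH(2)[OF ll(1)] ll(1) by auto
      show "(l = z \<longrightarrow> arc E F0 x y) \<and> (l' = z \<longrightarrow> arc E F0 y x)" if y: "y \<in> ?Tm"
      proof -
        have "{x, y} \<in> E" "x \<noteq> y" using y T(2) xT by auto
        then show ?thesis using y arc_flip[of x y E F0] lz by blast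
      qed
    qed auto
  qed
qed

text \<open>A vertex whose row is large on all \<open>p\<close> parts could play the vertex
  \<open>z\<close> of a star colouring: only arcs at \<open>z\<close> are monochromatic, so the
  other labels fit into the universal graph. In a pattern-free fibre each row is therefore small on
  some part.\<close>

lemma row_small_trace:
  fixes m :: nat
  defines "EU \<equiv> turan_edges p (p * m)"
  assumes univ: "univ VH AH p (\<lambda>i. {v. v < p * m \<and> v mod p = i}) EU d FU"
    and \<phi>: "inj_on \<phi> {..<p * m}" "\<phi> ` {..<p * m} \<subseteq> V"
    and arcsU: "\<And>F a b. F \<in> \<E> \<Longrightarrow> a < p * m \<Longrightarrow> b < p * m \<Longrightarrow> arc EU FU a b \<Longrightarrow> arc E F (\<phi> a) (\<phi> b)"
    and Y: "shatters \<E> Y" "Y \<subseteq> E"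
    and S: "S = \<phi> ` {..<p * m}" and A: "\<And>i. A i = \<phi> ` {v. v < p * m \<and> v mod p = i}"
    and v: "v \<in> V - S" and full: "\<And>i. i < p \<Longrightarrow> d \<le> card (row Y S v \<inter> A i)"
  shows "\<exists>F\<in>\<E>. emb V E F VH AH"
proof -
  obtain z c where z: "z \<in> VH" "\<forall>l\<in>VH. c l < p" and col: "\<forall>(x, y)\<in>AH. c x = c y \<longrightarrow> x = z"
    using star_colourings(1)[of 0] p2 by auto
  have mono: "l = z" if "(l, l') \<in> AH" "c l = c l'" for l l' using col that by auto
  show ?thesis
  proof (rule emb_via_univ[where k = p and m = m and c = c and Q = "{z}" and g = "\<lambda>_. v" and Y = Y and \<phi> = \<phi>
        and Z = "\<lambda>j. row Y S v \<inter> A j", OF univ[unfolded EU_def] _ AH(1) AH(2) \<phi>])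
    show "1 \<le> p" using p2 by simp
    show "arc E F (\<phi> a) (\<phi> b)" if "F \<in> \<E>" "a < p * m" "b < p * m" "arc (turan_edges p (p * m)) FU a b" for F a b
      using arcsU that unfolding EU_def by blast
    show "(\<lambda>_. v) ` {z} \<subseteq> V - \<phi> ` {..<p * m}" using v unfolding S by auto
    show "row Y S v \<inter> A i \<subseteq> \<phi> ` {v. v < p * m \<and> v mod p = i} \<and> d \<le> card (row Y S v \<inter> A i)" if "i < p" for i
      using full[OF that] by (auto simp: A)
    show "c x \<noteq> c y" if "(x, y) \<in> AH" "x \<notin> {z}" "y \<notin> {z}" for x y using mono[OF that(1)] that by auto
    show "arc E F v v" if "(x, y) \<in> AH" "x \<in> {z}" "y \<in> {z}" for x y F using AH(2) that by auto
  qed (use z Y in \<open>auto simp: row_def\<close>)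
qed

text \<open>By \<open>row_small_trace\<close> the rows lie in a set \<open>R\<close> of about 2^(N -
  m) traces, and the fibre is so large that almost all of this freedom is used. Hence some shattered
  \<open>Y\<close> has few rows in each of the much smaller sets \<open>B1 i\<close> and
  \<open>B2 i Z\<close>. For this \<open>Y\<close>, a typical vertex \<open>x\<close> of class i has
  a large row on every other part, and all but few vertices of the class have a large common trace
  with it there; by \<open>star_emb\<close> only boundedly many of these are adjacent to
  \<open>x\<close>.\<close>

lemma sparse_partition:
  fixes \<eta> :: real
  assumes "\<eta> > 0"
  shows "\<exists>s0 n0. \<forall>V E. n0 \<le> card V \<longrightarrow> good s0 (card V) \<longrightarrow> extremal V E \<longrightarrow>
    (\<exists>P. is_partition (V, E) p P \<and> real (part_cost (V, E) p P) \<le> \<eta> * real (card V) ^ 2)"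
proof -
  define \<eta>1 where "\<eta>1 = min 1 (\<eta> / (4 * p))"
  have p0: "real p > 0" using p2 by simp
  have \<eta>1: "\<eta>1 > 0" "\<eta>1 \<le> 1" "4 * p * \<eta>1 \<le> \<eta>"
  proof -
    have "\<eta>1 \<le> \<eta> / (4 * p)" unfolding \<eta>1_def by simp
    then show "4 * p * \<eta>1 \<le> \<eta>" using p0 by (simp add: pos_le_divide_eq mult_ac)
  qed (use assms p0 in \<open>auto simp: \<eta>1_def\<close>)
  obtain \<zeta> :: real where \<zeta>: "\<zeta> > 0" "\<zeta> \<le> 1" and small1: "\<And>A :: nat set. finite A \<Longrightarrow>
      card {r. r \<subseteq> A \<and> real (card r) < \<zeta> * card A} \<le> 2 powr (1 / 2 * card A)"
    using card_small_subsets_le[of "1/2"] by auto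
  \<comment> \<open>Being small on a second part of size m saves at least about 2^(m/2); being small
    on a further set of size \<zeta> m saves about 2^(\<zeta> m). The smaller of the two rates is
    \<gamma>.\<close>
  define \<gamma> where "\<gamma> = min \<zeta> (1 / 2)"
  have \<gamma>: "\<gamma> > 0" "\<gamma> \<le> 1 / 2" "\<gamma> \<le> \<zeta>" unfolding \<gamma>_def using \<zeta> by auto
  \<comment> \<open>Small enough for \<eta>1 (\<gamma> - \<epsilon>) - \<epsilon> \<ge> \<gamma>
    \<eta>1 / 2. Multiplied by m, this is the final gain per vertex, and \<open>m\<close> is chosen
    so that it exceeds log2 (2 p) by 1.\<close>
  define \<epsilon> where "\<epsilon> = \<gamma> * \<eta>1 / 4"
  have \<epsilon>: "\<epsilon> > 0" unfolding \<epsilon>_def using \<gamma> \<eta>1 by simp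
  have \<epsilon>\<gamma>: "\<epsilon> \<le> \<gamma> / 4" unfolding \<epsilon>_def using \<gamma> \<eta>1 by (simp add: mult_left_le)
  obtain \<delta> :: real where \<delta>: "\<delta> > 0" "\<delta> \<le> 1" and small: "\<And>A :: nat set. finite A \<Longrightarrow>
      card {r. r \<subseteq> A \<and> real (card r) < \<delta> * card A} \<le> 2 powr (\<epsilon> * card A)"
    using card_small_subsets_le[OF \<epsilon>] by blast
  have AH2: "\<forall>x y. (x, y) \<in> AH \<longrightarrow> (y, x) \<notin> AH" using AH(2) by blast
  have p1: "1 \<le> p" using p2 by simp
  obtain m0 :: nat where m0: "\<And>m. m \<ge> m0 \<Longrightarrow> \<exists>F \<subseteq> turan_edges p (p * m).
      univ VH AH p (\<lambda>i. {v. v < p * m \<and> v mod p = i}) (turan_edges p (p * m)) (nat \<lceil>\<delta> * m\<rceil>) F"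
    using ex_univ[OF finite_VH AH(1) AH2 p1 \<delta>(1)] by blast
  define m where "m = max (m0 + 1) (nat \<lceil>(log 2 (2 * p) + 1) / (\<gamma> * \<eta>1 / 2)\<rceil>)"
  have m: "m \<ge> m0" "m \<ge> 1" unfolding m_def by auto
  have "(log 2 (2 * p) + 1) / (\<gamma> * \<eta>1 / 2) \<le> m" unfolding m_def by linarith
  then have m2: "log 2 (2 * p) + 1 \<le> \<gamma> * \<eta>1 / 2 * m"
    using \<gamma>(1) \<eta>1(1) by (simp add: pos_divide_le_eq mult.commute)
  define d where "d = nat \<lceil>\<delta> * m\<rceil>"
  define d1 where "d1 = nat \<lceil>\<zeta> * m\<rceil>"
  define EU where "EU = turan_edges p (p * m)"
  obtain FU where FU: "univ VH AH p (\<lambda>i. {v. v < p * m \<and> v mod p = i}) EU d FU"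
    using m0[OF m(1)] unfolding d_def EU_def by blast
  define N where "N = p * m"
  have N1: "1 \<le> N" and mN: "2 * m \<le> N" unfolding N_def using p2 m(2) by (auto simp: Suc_le_eq)
  define AU where "AU = {(a, b). a < N \<and> b < N \<and> arc EU FU a b}"
  have AU: "AU \<subseteq> {..<N} \<times> {..<N}" unfolding AU_def by auto
  have "\<exists>s0 n0. \<forall>V E. n0 \<le> card V \<longrightarrow> good s0 (card V) \<longrightarrow> extremal V E \<longrightarrow>
      2 * real (card {F \<in> hfree V E. \<not> emb V E F {..<N} AU}) < real (D (card V))"
  proof (rule most_contain_coloured[OF p1 order_refl, rule_format, of "{..<N}" AU "\<lambda>a. a mod p" 2])
    show "AU \<subseteq> {..<N} \<times> {..<N}" by (rule AU)
    show "(y, x) \<notin> AU" if "(x, y) \<in> AU" for x y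
      using that unfolding AU_def arc_def by (auto simp: insert_commute)
    show "case e of (x, y) \<Rightarrow> x mod p \<noteq> y mod p" if "e \<in> AU" for e
      using that unfolding AU_def arc_def EU_def turan_edges_def by (auto simp: doubleton_eq_iff)
  qed (use p2 in auto)
  then obtain s1 n1 where s1: "\<And>V E. n1 \<le> card V \<Longrightarrow> good s1 (card V) \<Longrightarrow> extremal V E \<Longrightarrow>
      2 * real (card {F \<in> hfree V E. \<not> emb V E F {..<N} AU}) < real (D (card V))" by blast
  define cst where "cst = 2 * real N ^ 2 + K + 1 + log 2 (2 * p) + N"
  obtain n2 :: nat where n2: "\<And>n::nat. n \<ge> n2 \<Longrightarrow> N * log 2 n + cst < 1 * n"
    using eventually_log_less_linear[of 1 "N" cst] by auto
  define big where "big = 2 * (card VH * 2 ^ N)"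
  have \<eta>2: "\<eta> / 2 > 0" using assms by simp
  obtain n3 :: nat where n3: "\<And>n::nat. n \<ge> n3 \<Longrightarrow> p * (2 + N + real big) * n + 0 \<le> \<eta> / 2 * real n ^ 2"
    using eventually_linear_le_quadratic[OF \<eta>2] by blast
  have "\<exists>P. is_partition (V, E) p P \<and> real (part_cost (V, E) p P) \<le> \<eta> * real (card V) ^ 2"
    if n: "max (max n1 n2) (max n3 1) \<le> card V" and good: "good (max s1 N) (card V)" and ext: "extremal V E" for V E
  proof -
    let ?n = "card V"
    have G: "graph (V, E)" using ext unfolding extremal_def by simp
    have fin: "finite V" "finite E" using graph_finite[OF G] by auto
    have fh: "finite (hfree V E)" unfolding hfree_def using fin by simp
    define \<G> where "\<G> = {F \<in> hfree V E. emb V E F {..<N} AU}"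
    have "hfree V E = \<G> \<union> {F \<in> hfree V E. \<not> emb V E F {..<N} AU}" unfolding \<G>_def by auto
    then have "D ?n = card (\<G> \<union> {F \<in> hfree V E. \<not> emb V E F {..<N} AU})"
      using ext unfolding extremal_def by simp
    also have "\<dots> \<le> card \<G> + card {F \<in> hfree V E. \<not> emb V E F {..<N} AU}" by (rule card_Un_le)
    finally have "real (D ?n) \<le> card \<G> + card {F \<in> hfree V E. \<not> emb V E F {..<N} AU}" by linarith
    moreover have "2 * real (card {F \<in> hfree V E. \<not> emb V E F {..<N} AU}) < real (D ?n)"
      using s1 n good_mono[OF good] ext by simp
    ultimately have D\<G>: "D ?n \<le> 2 * real (card \<G>)" by linarith
    obtain \<phi> \<E> where \<phi>: "inj_on \<phi> {..<N}" "\<phi> ` {..<N} \<subseteq> V" and \<E>: "\<E> \<subseteq> \<G>"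
      "agree_off E (\<phi> ` {..<N}) \<E>"
      and arcs: "\<And>F a b. F \<in> \<E> \<Longrightarrow> (a, b) \<in> AU \<Longrightarrow> arc E F (\<phi> a) (\<phi> b)"
      and large: "2 powr (\<beta> * N * ?n - 2 * real N ^ 2 - K) / (2 * ?n ^ N) \<le> card \<E>"
      by (rule ex_large_fibre_copy[OF good ext N1, of \<G> 2 AU]) (use D\<G> AU in \<open>auto simp: \<G>_def\<close>)
    define S where "S = \<phi> ` {..<N}"
    define A where "A i = \<phi> ` {v. v < p * m \<and> v mod p = i}" for i
    have cS: "card S = N" unfolding S_def using \<phi>(1) by (simp add: card_image)
    have fS: "finite S" unfolding S_def by simp
    have SV: "S \<subseteq> V" using \<phi>(2) unfolding S_def .
    have AS: "A i \<subseteq> S" for i unfolding A_def S_def N_def by auto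
    have fA: "finite (A i)" for i using AS fS finite_subset by blast
    have cA: "card (A i) = m" if "i < p" for i
    proof -
      have "card (A i) = card {v. v < p * m \<and> v mod p = i}"
        unfolding A_def by (rule card_image) (rule inj_on_subset[OF \<phi>(1)], auto simp: N_def)
      then show ?thesis using card_residue_class[OF that] by simp
    qed
    have disjA: "A i \<inter> A j = {}" if "i \<noteq> j" for i j
      unfolding A_def using \<phi>(1) that by (auto simp: N_def dest: inj_onD)
    define \<Y> where "\<Y> = {Y. Y \<subseteq> E \<and> shatters \<E> Y}"
    have \<E>E: "\<E> \<subseteq> Pow E" using \<E>(1) unfolding \<G>_def hfree_def by auto
    have c\<E>: "card \<E> \<le> card \<Y>" unfolding \<Y>_def by (rule card_le_card_shattered[OF fin(2) \<E>E])
    have f\<Y>: "finite \<Y>" unfolding \<Y>_def using fin by simp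
    have free: "\<not> (\<exists>F\<in>\<E>. emb V E F VH AH)" using \<E>(1) unfolding \<G>_def hfree_def by auto
    have arcsU: "arc E F (\<phi> a) (\<phi> b)" if "F \<in> \<E>" "a < p * m" "b < p * m" "arc EU FU a b" for F a b
      using arcs[of F a b] that unfolding AU_def N_def by auto
    have \<phi>': "inj_on \<phi> {..<p * m}" "\<phi> ` {..<p * m} \<subseteq> V" using \<phi> unfolding N_def by auto
    have dm: "d \<le> m" unfolding d_def using \<delta> by (simp add: nat_le_iff ceiling_le_iff mult_left_le_one_le)
    define R where "R = {r. r \<subseteq> S \<and> (\<exists>i<p. card (r \<inter> A i) < d)}"
    have rowR: "row Y S v \<in> R" if Y: "Y \<in> \<Y>" and v: "v \<in> V - S" for Y v
    proof (rule ccontr)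
      assume "row Y S v \<notin> R"
      moreover have "row Y S v \<subseteq> S" unfolding row_def by auto
      ultimately have full: "d \<le> card (row Y S v \<inter> A i)" if "i < p" for i
        using that unfolding R_def using not_less by blast
      have "\<exists>F\<in>\<E>. emb V E F VH AH"
        by (rule row_small_trace[OF FU[unfolded EU_def] \<phi>' _ _ _ _ _ v full])
          (use arcsU Y in \<open>auto simp: EU_def \<Y>_def S_def A_def N_def\<close>)
      then show False using free by blast
    qed
    \<comment> \<open>Rows that are small on part i and on a second part, and rows small on part i
      with a small trace on \<open>Z\<close> in some other part. \<open>Gen i\<close> contains the
      possible rows \<open>Z\<close> of typical vertices, so the number of sets in \<B> is bounded
      in terms of \<open>N\<close> and \<open>p\<close>.\<close>
    define B1 where "B1 i = {r. r \<subseteq> S \<and> card (r \<inter> A i) < d \<and> (\<exists>j<p. j \<noteq> i \<and> card (r \<inter> A j) < d1)}" for i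
    define B2 where "B2 i Z = {r. r \<subseteq> S \<and> card (r \<inter> A i) < d \<and> (\<exists>j<p. j \<noteq> i \<and> card (r \<inter> (Z \<inter> A j)) < d)}" for i Z
    define Gen where "Gen i = {Z. Z \<subseteq> S \<and> (\<forall>j<p. j \<noteq> i \<longrightarrow> d1 \<le> card (Z \<inter> A j))}" for i
    define \<B> where "\<B> = B1 ` {..<p} \<union> (\<Union>i<p. B2 i ` Gen i)"
    have fGen: "finite (Gen i)" for i unfolding Gen_def using fS by simp
    have f\<B>: "finite \<B>" unfolding \<B>_def using fGen by auto
    have c\<B>: "real (card \<B>) \<le> 2 * p * 2 ^ N"
    proof -
      have "card \<B> \<le> card (B1 ` {..<p}) + card (\<Union>i<p. B2 i ` Gen i)" unfolding \<B>_def by (rule card_Un_le)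
      also have "card (B1 ` {..<p}) \<le> p * 2 ^ N"
        using card_image_le[of "{..<p}" B1] by (metis card_lessThan finite_lessThan le_trans mult.right_neutral mult_le_mono2 one_le_numeral one_le_power)
      also have "card (\<Union>i<p. B2 i ` Gen i) \<le> (\<Sum>i<p. card (B2 i ` Gen i))" by (rule card_UN_le) simp
      also have "\<dots> \<le> (\<Sum>i<p. 2 ^ N)"
      proof (rule sum_mono)
        fix i
        have "card (B2 i ` Gen i) \<le> card (Gen i)" by (rule card_image_le[OF fGen])
        also have "\<dots> \<le> card (Pow S)" by (rule card_mono) (use fS in \<open>auto simp: Gen_def\<close>)
        finally show "card (B2 i ` Gen i) \<le> 2 ^ N" using fS cS by (simp add: card_Pow)
      qed
      finally have "card \<B> \<le> 2 * p * 2 ^ N" by simp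
      then have "real (card \<B>) \<le> real (2 * p * 2 ^ N)" by (simp only: of_nat_le_iff)
      then show ?thesis by simp
    qed
    have two: "real (card {r. r \<subseteq> S \<and> card (r \<inter> A i) < d \<and> card (r \<inter> W) < e}) \<le> 2 powr (N - m - card W + \<epsilon> * m) * w"
      if i: "i < p" and j: "j < p" "j \<noteq> i" and W: "W \<subseteq> A j" and w: "real (card {r. r \<subseteq> W \<and> card r < e}) \<le> w" for i j W e w
    proof -
      have cW: "card W \<le> m" using card_mono[OF fA W] cA[OF j(1)] by simp
      have "card {r. r \<subseteq> S \<and> card (r \<inter> A i) < d \<and> card (r \<inter> W) < e}
          \<le> 2 ^ (card S - card (A i) - card W) * (card {r. r \<subseteq> A i \<and> card r < d} * card {r. r \<subseteq> W \<and> card r < e})"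
        by (rule card_small_traces_le) (use fS AS W disjA[OF j(2)] in auto)
      then have "real (card {r. r \<subseteq> S \<and> card (r \<inter> A i) < d \<and> card (r \<inter> W) < e})
          \<le> real (2 ^ (card S - card (A i) - card W) * (card {r. r \<subseteq> A i \<and> card r < d} * card {r. r \<subseteq> W \<and> card r < e}))"
        by (simp only: of_nat_le_iff)
      also have "\<dots> = 2 powr (N - m - card W) * (real (card {r. r \<subseteq> A i \<and> card r < d}) * card {r. r \<subseteq> W \<and> card r < e})"
        using mN cW cS cA[OF i] by (simp add: powr_realpow[symmetric] of_nat_diff)
      also have "\<dots> \<le> 2 powr (N - m - card W) * (2 powr (\<epsilon> * m) * w)"
      proof (intro mult_left_mono mult_mono)
        show "real (card {r. r \<subseteq> A i \<and> card r < d}) \<le> 2 powr (\<epsilon> * m)"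
          using small[OF fA[of i]] unfolding cA[OF i] d_def ceil_less_iff .
      qed (use w in auto)
      finally show ?thesis by (simp add: powr_add mult_ac)
    qed
    have d\<zeta>: "real d1 \<ge> \<zeta> * m" unfolding d1_def by linarith
    define b where "b = p * 2 powr (N - m - \<gamma> * m + 2 * \<epsilon> * m)"
    have cB1: "real (card (B1 i)) \<le> b" if i: "i < p" for i
    proof -
      have "B1 i = (\<Union>j\<in>{..<p} - {i}. {r. r \<subseteq> S \<and> card (r \<inter> A i) < d \<and> card (r \<inter> A j) < d1})"
        unfolding B1_def by auto
      then have "card (B1 i) \<le> (\<Sum>j\<in>{..<p} - {i}. card {r. r \<subseteq> S \<and> card (r \<inter> A i) < d \<and> card (r \<inter> A j) < d1})"
        using card_UN_le[of "{..<p} - {i}"] by simp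
      then have "real (card (B1 i)) \<le> real (\<Sum>j\<in>{..<p} - {i}. card {r. r \<subseteq> S \<and> card (r \<inter> A i) < d \<and> card (r \<inter> A j) < d1})"
        by (simp only: of_nat_le_iff)
      also have "\<dots> = (\<Sum>j\<in>{..<p} - {i}. real (card {r. r \<subseteq> S \<and> card (r \<inter> A i) < d \<and> card (r \<inter> A j) < d1}))"
        by (simp only: of_nat_sum)
      also have "\<dots> \<le> (\<Sum>j\<in>{..<p} - {i}. 2 powr (N - m - \<gamma> * m + 2 * \<epsilon> * m))"
      proof (rule sum_mono)
        fix j assume "j \<in> {..<p} - {i}"
        then have j: "j < p" "j \<noteq> i" by auto
        have "real (card {r. r \<subseteq> A j \<and> card r < d1}) \<le> 2 powr (1 / 2 * m)"
          using small1[OF fA[of j]] unfolding cA[OF j(1)] d1_def ceil_less_iff .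
        from two[OF i j order_refl this] have "real (card {r. r \<subseteq> S \<and> card (r \<inter> A i) < d \<and> card (r \<inter> A j) < d1})
            \<le> 2 powr (N - m - m + \<epsilon> * m + 1 / 2 * m)" unfolding cA[OF j(1)] powr_add by simp
        also have "\<dots> \<le> 2 powr (N - m - \<gamma> * m + 2 * \<epsilon> * m)"
        proof (rule powr_mono)
          have "\<gamma> * m \<le> 1 / 2 * m" using \<gamma>(2) by (intro mult_right_mono) auto
          moreover have "0 \<le> \<epsilon> * m" using \<epsilon> by simp
          ultimately show "N - m - m + \<epsilon> * m + 1 / 2 * m \<le> N - m - \<gamma> * m + 2 * \<epsilon> * m"
            using mN by (simp add: of_nat_diff)
        qed simp
        finally show "real (card {r. r \<subseteq> S \<and> card (r \<inter> A i) < d \<and> card (r \<inter> A j) < d1}) \<le> 2 powr (N - m - \<gamma> * m + 2 * \<epsilon> * m)" .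
      qed
      also have "\<dots> \<le> b" unfolding b_def using i by (simp add: of_nat_diff)
      finally show ?thesis .
    qed
    have cB2: "real (card (B2 i Z)) \<le> b" if i: "i < p" and Z: "Z \<in> Gen i" for i Z
    proof -
      have "B2 i Z = (\<Union>j\<in>{..<p} - {i}. {r. r \<subseteq> S \<and> card (r \<inter> A i) < d \<and> card (r \<inter> (Z \<inter> A j)) < d})"
        unfolding B2_def by auto
      then have "card (B2 i Z) \<le> (\<Sum>j\<in>{..<p} - {i}. card {r. r \<subseteq> S \<and> card (r \<inter> A i) < d \<and> card (r \<inter> (Z \<inter> A j)) < d})"
        using card_UN_le[of "{..<p} - {i}"] by simp
      then have "real (card (B2 i Z)) \<le> real (\<Sum>j\<in>{..<p} - {i}. card {r. r \<subseteq> S \<and> card (r \<inter> A i) < d \<and> card (r \<inter> (Z \<inter> A j)) < d})"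
        by (simp only: of_nat_le_iff)
      also have "\<dots> = (\<Sum>j\<in>{..<p} - {i}. real (card {r. r \<subseteq> S \<and> card (r \<inter> A i) < d \<and> card (r \<inter> (Z \<inter> A j)) < d}))"
        by (simp only: of_nat_sum)
      also have "\<dots> \<le> (\<Sum>j\<in>{..<p} - {i}. 2 powr (N - m - \<gamma> * m + 2 * \<epsilon> * m))"
      proof (rule sum_mono)
        fix j assume "j \<in> {..<p} - {i}"
        then have j: "j < p" "j \<noteq> i" by auto
        have "card {r. r \<subseteq> Z \<inter> A j \<and> card r < d} \<le> card {r. r \<subseteq> A j \<and> card r < d}"
          by (rule card_mono) (use fA in auto)
        moreover have "real (card {r. r \<subseteq> A j \<and> card r < d}) \<le> 2 powr (\<epsilon> * m)"
          using small[OF fA[of j]] unfolding cA[OF j(1)] d_def ceil_less_iff .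
        ultimately have "real (card {r. r \<subseteq> Z \<inter> A j \<and> card r < d}) \<le> 2 powr (\<epsilon> * m)" by linarith
        from two[OF i j _ this] have "real (card {r. r \<subseteq> S \<and> card (r \<inter> A i) < d \<and> card (r \<inter> (Z \<inter> A j)) < d})
            \<le> 2 powr (N - m - card (Z \<inter> A j) + \<epsilon> * m + \<epsilon> * m)" unfolding powr_add by simp
        also have "\<dots> \<le> 2 powr (N - m - \<gamma> * m + 2 * \<epsilon> * m)"
        proof (rule powr_mono)
          have "d1 \<le> card (Z \<inter> A j)" using Z j unfolding Gen_def by auto
          moreover have "card (Z \<inter> A j) \<le> m" using card_mono[OF fA[of j], of "Z \<inter> A j"] cA[OF j(1)] by simp
          then have "real (N - m - card (Z \<inter> A j)) = real (N - m) - card (Z \<inter> A j)" using mN by (simp add: of_nat_diff)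
          moreover have "\<gamma> * m \<le> \<zeta> * m" using \<gamma>(3) by (intro mult_right_mono) auto
          ultimately show "N - m - card (Z \<inter> A j) + \<epsilon> * m + \<epsilon> * m \<le> N - m - \<gamma> * m + 2 * \<epsilon> * m"
            using d\<zeta> by linarith
        qed simp
        finally show "real (card {r. r \<subseteq> S \<and> card (r \<inter> A i) < d \<and> card (r \<inter> (Z \<inter> A j)) < d}) \<le> 2 powr (N - m - \<gamma> * m + 2 * \<epsilon> * m)" .
      qed
      also have "\<dots> \<le> b" unfolding b_def using i by (simp add: of_nat_diff)
      finally show ?thesis .
    qed
    have cR: "real (card R) \<le> p * 2 powr (N - m + \<epsilon> * m)"
    proof -
      have "R = (\<Union>i<p. {r. r \<subseteq> S \<and> card (r \<inter> A i) < d})" unfolding R_def by auto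
      then have "card R \<le> (\<Sum>i<p. card {r. r \<subseteq> S \<and> card (r \<inter> A i) < d})"
        using card_UN_le[of "{..<p}"] by simp
      then have "real (card R) \<le> real (\<Sum>i<p. card {r. r \<subseteq> S \<and> card (r \<inter> A i) < d})"
        by (simp only: of_nat_le_iff)
      also have "\<dots> = (\<Sum>i<p. real (card {r. r \<subseteq> S \<and> card (r \<inter> A i) < d}))" by (simp only: of_nat_sum)
      also have "\<dots> \<le> (\<Sum>i<p. 2 powr (N - m + \<epsilon> * m))"
      proof (rule sum_mono)
        fix i assume "i \<in> {..<p}"
        then have i: "i < p" by simp
        obtain j where j: "j < p" "j \<noteq> i" using p2 by (metis One_nat_def less_2_cases_iff order_less_le_trans pos2 zero_neq_one)
        have e: "{r :: nat set. r \<subseteq> {} \<and> card r < 1} = {{}}" by auto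
        have "real (card {r. r \<subseteq> S \<and> card (r \<inter> A i) < d \<and> card (r \<inter> {}) < 1}) \<le> 2 powr (N - m - card ({}::nat set) + \<epsilon> * m) * 1"
          by (rule two[OF i j empty_subsetI]) (unfold e, simp)
        then show "real (card {r. r \<subseteq> S \<and> card (r \<inter> A i) < d}) \<le> 2 powr (N - m + \<epsilon> * m)" by simp
      qed
      finally show ?thesis by simp
    qed
    define u where "u = nat \<lceil>\<eta>1 * ?n\<rceil>"
    have u: "\<eta>1 * ?n \<le> u" "u \<le> \<eta>1 * ?n + 1" 
  proof -
    have "0 \<le> \<eta>1 * ?n" using \<eta>1(1) by simp
    then show "\<eta>1 * ?n \<le> u" "u \<le> \<eta>1 * ?n + 1" unfolding u_def by linarith+
  qed
    \<comment> \<open>With this weight \<mu> b equals p 2^(N - m + \<epsilon> m), which is the bound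
      for \<open>card R\<close>.\<close>
    define \<mu> :: real where "\<mu> = 2 powr ((\<gamma> - \<epsilon>) * m)"
    have \<mu>: "\<mu> \<ge> 1" unfolding \<mu>_def using \<epsilon>\<gamma> \<gamma>(1) by (intro ge_one_powr_ge_zero) auto
    let ?base = "2 * p * 2 powr (N - m + \<epsilon> * m)"
    have base1: "1 \<le> ?base"
      using mult_mono[of 1 "2 * real p" 1 "2 powr (N - m + \<epsilon> * m)"] p2 mN \<epsilon> by (simp add: ge_one_powr_ge_zero)
    have cnt: "real (card {Y \<in> \<Y>. u \<le> card {v \<in> V - S. row Y S v \<in> B}}) \<le> ?base ^ ?n / \<mu> ^ u" if B: "B \<in> \<B>" for B
    proof -
      have BR: "B \<subseteq> R" using B unfolding \<B>_def R_def B1_def B2_def by auto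
      have cB: "real (card B) \<le> b" using B cB1 cB2 unfolding \<B>_def by auto
      have "card {Y \<in> \<Y>. u \<le> card {v \<in> V - S. row Y S v \<in> B}} * \<mu> ^ u
          \<le> (card R + (\<mu> - 1) * card B) ^ card (V - S)"
        by (rule card_rows_le[OF G SV _ _ _ _ BR \<mu>])
          (use shattered_subset_cross[OF \<E>(2) \<E>E] rowR in \<open>auto simp: S_def R_def \<Y>_def\<close>)
      also have "\<dots> \<le> ?base ^ card (V - S)"
      proof (rule power_mono)
        have "(\<mu> - 1) * card B \<le> \<mu> * b" using \<mu> cB by (intro mult_mono) auto
        also have "\<dots> = p * (2 powr ((\<gamma> - \<epsilon>) * m) * 2 powr (N - m - \<gamma> * m + 2 * \<epsilon> * m))"
          unfolding \<mu>_def b_def by simp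
        also have "\<dots> = p * 2 powr (N - m + \<epsilon> * m)"
          unfolding powr_add[symmetric] by (simp add: left_diff_distrib algebra_simps)
        finally show "card R + (\<mu> - 1) * card B \<le> ?base" using cR by linarith
      qed (use \<mu> in simp)
      also have "\<dots> \<le> ?base ^ ?n"
        by (rule power_increasing[OF _ base1]) (use fin in \<open>auto intro: card_mono\<close>)
      finally show ?thesis using \<mu> by (simp add: pos_le_divide_eq)
    qed
    \<comment> \<open>Otherwise each \<open>Y\<close> has at least \<open>u\<close> rows in one of
      boundedly many sets, and the weighted counts for these sets add up to less than the size of
      the fibre.\<close>
    have "\<exists>Y\<in>\<Y>. \<forall>B\<in>\<B>. card {v \<in> V - S. row Y S v \<in> B} < u"
    proof (rule ccontr)
      assume "\<not> ?thesis"
      then have "\<Y> \<subseteq> (\<Union>B\<in>\<B>. {Y \<in> \<Y>. u \<le> card {v \<in> V - S. row Y S v \<in> B}})" by (auto simp: not_less)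
      then have "card \<Y> \<le> card (\<Union>B\<in>\<B>. {Y \<in> \<Y>. u \<le> card {v \<in> V - S. row Y S v \<in> B}})"
        by (intro card_mono) (use f\<B> f\<Y> in auto)
      also have "\<dots> \<le> (\<Sum>B\<in>\<B>. card {Y \<in> \<Y>. u \<le> card {v \<in> V - S. row Y S v \<in> B}})" by (rule card_UN_le[OF f\<B>])
      finally have "real (card \<Y>) \<le> real (\<Sum>B\<in>\<B>. card {Y \<in> \<Y>. u \<le> card {v \<in> V - S. row Y S v \<in> B}})"
        by (simp only: of_nat_le_iff)
      also have "\<dots> = (\<Sum>B\<in>\<B>. real (card {Y \<in> \<Y>. u \<le> card {v \<in> V - S. row Y S v \<in> B}}))" by (simp only: of_nat_sum)
      also have "\<dots> \<le> (\<Sum>B\<in>\<B>. ?base ^ ?n / \<mu> ^ u)" by (rule sum_mono[OF cnt])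
      also have "\<dots> = card \<B> * (?base ^ ?n / \<mu> ^ u)" by simp
      also have "\<dots> \<le> (2 * p * 2 ^ N) * (?base ^ ?n / \<mu> ^ u)"
        using c\<B> base1 \<mu> by (intro mult_right_mono) auto
      also have "?base ^ ?n = 2 powr (?n * (log 2 (2 * p) + (N - m + \<epsilon> * m)))"
      proof -
        have "?base = 2 powr (log 2 (2 * p) + (N - m + \<epsilon> * m))" unfolding powr_add using p2 by simp
        then have "?base ^ ?n = (2 powr (log 2 (2 * p) + (N - m + \<epsilon> * m))) ^ ?n" by (rule arg_cong)
        then show ?thesis by (simp add: powr_power mult.commute)
      qed
      also have "\<mu> ^ u = 2 powr (u * ((\<gamma> - \<epsilon>) * m))" unfolding \<mu>_def by (simp add: powr_power mult.commute)
      also have "real (2 * p * 2 ^ N) = 2 powr (log 2 (2 * p) + N)"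
        unfolding powr_add using p2 by (simp add: powr_realpow)
      finally have up: "real (card \<Y>) \<le> 2 powr (log 2 (2 * p) + N)
          * (2 powr (?n * (log 2 (2 * p) + (N - m + \<epsilon> * m))) / 2 powr (u * ((\<gamma> - \<epsilon>) * m)))" .
      have n0: "real ?n > 0" using n by simp
      have "2 powr (N * log 2 ?n) = real ?n ^ N"
      proof -
        have "2 powr (N * log 2 ?n) = (2 powr (log 2 ?n)) powr N" by (simp add: powr_powr mult.commute)
        then show ?thesis using n0 by (simp add: powr_realpow)
      qed
      then have den: "real (2 * ?n ^ N) = 2 powr (1 + N * log 2 ?n)" by (simp add: powr_add)
      have "2 powr (\<beta> * N * ?n - 2 * real N ^ 2 - K) / 2 powr (1 + N * log 2 ?n) \<le> card \<Y>"
        using large c\<E> unfolding den by linarith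
      also note up
      finally have "2 powr (\<beta> * N * ?n - 2 * real N ^ 2 - K - (1 + N * log 2 ?n))
          \<le> 2 powr (log 2 (2 * p) + N + (?n * (log 2 (2 * p) + (N - m + \<epsilon> * m)) - u * ((\<gamma> - \<epsilon>) * m)))"
        by (simp only: powr_add powr_diff)
      then have 1: "\<beta> * N * ?n - 2 * real N ^ 2 - K - (1 + N * log 2 ?n)
          \<le> log 2 (2 * p) + N + (?n * (log 2 (2 * p) + (N - m + \<epsilon> * m)) - u * ((\<gamma> - \<epsilon>) * m))" by simp
      have 2: "?n * (\<eta>1 * ((\<gamma> - \<epsilon>) * m)) \<le> u * ((\<gamma> - \<epsilon>) * m)"
        using mult_right_mono[OF u(1), of "(\<gamma> - \<epsilon>) * m"] \<epsilon>\<gamma> \<gamma>(1) by (simp add: mult_ac)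
      have "\<beta> * N = N - m" unfolding \<beta>_def N_def using p2 by (simp add: field_simps)
      then have 3: "\<beta> * N * ?n = ?n * real (N - m)" by simp
      have 4: "?n * (log 2 (2 * p) + (N - m + \<epsilon> * m)) = ?n * log 2 (2 * p) + ?n * real (N - m) + ?n * (\<epsilon> * m)"
        by (simp add: distrib_left)
      have 5: "?n * (\<eta>1 * ((\<gamma> - \<epsilon>) * m) - log 2 (2 * p) - \<epsilon> * m)
          = ?n * (\<eta>1 * ((\<gamma> - \<epsilon>) * m)) - ?n * log 2 (2 * p) - ?n * (\<epsilon> * m)"
        by (simp add: right_diff_distrib)
      have comb: "r \<le> l + (x + K + 1 + lp + N')"
        if "bn - x - K - (1 + l) \<le> lp + N' + (e - uu)" "t \<le> uu" "bn = nm" "e = a + nm + b'" "r = t - a - b'"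
        for r l x lp N' bn e uu t nm a b' :: real using that by linarith
      have ineq: "?n * (\<eta>1 * ((\<gamma> - \<epsilon>) * m) - log 2 (2 * p) - \<epsilon> * m) \<le> N * log 2 ?n + cst"
        unfolding cst_def by (rule comb[OF 1 2 3 4 5])
      have "1 \<le> \<eta>1 * ((\<gamma> - \<epsilon>) * m) - log 2 (2 * p) - \<epsilon> * m"
      proof -
        have "\<gamma> * \<eta>1 / 2 \<le> \<eta>1 * (\<gamma> - \<epsilon>) - \<epsilon>"
        proof -
          have "\<eta>1 * \<epsilon> \<le> \<epsilon>" using \<epsilon> \<eta>1 by (simp add: mult_left_le_one_le)
          then show ?thesis unfolding \<epsilon>_def by (simp add: algebra_simps)
        qed
        then have "\<gamma> * \<eta>1 / 2 * m \<le> (\<eta>1 * (\<gamma> - \<epsilon>) - \<epsilon>) * m" by (intro mult_right_mono) auto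
        then show ?thesis using m2 by (simp add: algebra_simps)
      qed
      then have "real ?n * 1 \<le> ?n * (\<eta>1 * ((\<gamma> - \<epsilon>) * m) - log 2 (2 * p) - \<epsilon> * m)" by (intro mult_left_mono) auto
      then show False using ineq n2[of ?n] n by simp
    qed
    then obtain Y where Y: "Y \<in> \<Y>" and few: "\<And>B. B \<in> \<B> \<Longrightarrow> card {v \<in> V - S. row Y S v \<in> B} < u" by blast
    define ty where "ty v = (SOME i. i < p \<and> card (row Y S v \<inter> A i) < d)" for v
    have ty: "ty v < p \<and> card (row Y S v \<inter> A (ty v)) < d" if "v \<in> V - S" for v
      unfolding ty_def by (rule someI_ex) (use rowR[OF Y that] in \<open>auto simp: R_def\<close>)
    define W where "W i = {v \<in> V - S. ty v = i}" for i
    define N1 where "N1 i = {v \<in> W i. row Y S v \<in> B1 i}" for i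
    have cN1: "card (N1 i) \<le> u" if "i < p" for i
    proof -
      have "card (N1 i) \<le> card {v \<in> V - S. row Y S v \<in> B1 i}"
        by (rule card_mono) (use fin in \<open>auto simp: N1_def W_def\<close>)
      also have "\<dots> \<le> u" using few[of "B1 i"] that unfolding \<B>_def by auto
      finally show ?thesis .
    qed
    have deg: "card {y \<in> W i. {x, y} \<in> E} \<le> u + big" if i: "i < p" and x: "x \<in> W i - N1 i" for i x
    proof -
      let ?Z = "row Y S x"
      have xV: "x \<in> V - S" and tx: "ty x = i" using x unfolding W_def by auto
      have ZS: "?Z \<subseteq> S" unfolding row_def by auto
      have "?Z \<notin> B1 i" using x unfolding N1_def by auto
      moreover have "card (?Z \<inter> A i) < d" using ty[OF xV] tx by simp
      ultimately have "\<not> (\<exists>j<p. j \<noteq> i \<and> card (?Z \<inter> A j) < d1)" using ZS unfolding B1_def by blast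
      then have ZG: "?Z \<in> Gen i" using ZS leI unfolding Gen_def by blast
      \<comment> \<open>For \<open>y\<close> in this class, a row outside \<open>B2 i ?Z\<close>
        means a common trace of size at least \<open>d\<close> with \<open>x\<close> on each other
        part, as \<open>star_emb\<close> requires.\<close>
      let ?T = "{y \<in> W i. {x, y} \<in> E \<and> row Y S y \<notin> B2 i ?Z}"
      have "card {y \<in> W i. {x, y} \<in> E} \<le> card ({v \<in> V - S. row Y S v \<in> B2 i ?Z} \<union> ?T)"
        by (rule card_mono) (use fin in \<open>auto simp: W_def\<close>)
      also have "\<dots> \<le> card {v \<in> V - S. row Y S v \<in> B2 i ?Z} + card ?T" by (rule card_Un_le)
      also have "card {v \<in> V - S. row Y S v \<in> B2 i ?Z} \<le> u" using few[of "B2 i ?Z"] i ZG unfolding \<B>_def by force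
      also have "card ?T \<le> big"
      proof (rule ccontr)
        assume "\<not> card ?T \<le> big"
        then have bT: "2 * (card VH * 2 ^ (p * m)) \<le> card ?T" unfolding big_def N_def by simp
        have "\<exists>F\<in>\<E>. emb V E F VH AH"
        proof (rule star_emb[OF FU[unfolded EU_def] G \<phi>' _ _ _ _ _ _ i _ xV _ _ bT])
          show "arc E F (\<phi> a) (\<phi> b)" if "F \<in> \<E>" "a < p * m" "b < p * m" "arc (turan_edges p (p * m)) FU a b" for F a b
            using arcsU that unfolding EU_def by blast
          show "agree_off E S \<E>" using \<E>(2) unfolding S_def .
          show "shatters \<E> Y" "Y \<subseteq> E" using Y unfolding \<Y>_def by auto
          show "S = \<phi> ` {..<p * m}" unfolding S_def N_def ..
          show "\<And>i. A i = \<phi> ` {v. v < p * m \<and> v mod p = i}" unfolding A_def ..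
          show "d \<le> card (A i)" using dm cA[OF i] by simp
          show "?T \<subseteq> V - S" unfolding W_def by auto
          show "{x, y} \<in> E" if "y \<in> ?T" for y using that by auto
          show "d \<le> card (?Z \<inter> row Y S y \<inter> A j)" if y: "y \<in> ?T" and j: "j < p" "j \<noteq> i" for y j
          proof (rule ccontr)
            assume "\<not> ?thesis"
            then have "card (row Y S y \<inter> (?Z \<inter> A j)) < d" by (simp add: Int_ac)
            moreover have "y \<in> V - S" "ty y = i" using y unfolding W_def by auto
            moreover have "row Y S y \<subseteq> S" unfolding row_def by auto
            ultimately have "row Y S y \<in> B2 i ?Z" using ty[of y] j unfolding B2_def by blast
            then show False using y by simp
          qed
        qed
        then show False using free by blast
      qed
      finally show ?thesis by simp
    qed
    \<comment> \<open>The boundedly many vertices of \<open>S\<close> are put into the first class,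
      where they contribute O(n) edges.\<close>
    define P where "P i = W i \<union> (if i = 0 then S else {})" for i
    have part: "is_partition (V, E) p P"
      unfolding is_partition_def fst_conv
    proof (intro conjI allI impI)
      show "(\<Union>i<p. P i) = V"
      proof
        show "(\<Union>i<p. P i) \<subseteq> V" using SV unfolding P_def W_def by (auto split: if_split_asm)
        show "V \<subseteq> (\<Union>i<p. P i)"
        proof
          fix v assume v: "v \<in> V"
          show "v \<in> (\<Union>i<p. P i)"
          proof (cases "v \<in> S")
            case True
            then show ?thesis using p2 unfolding P_def by (intro UN_I[of 0]) auto
          next
            case False
            then show ?thesis using ty[of v] v unfolding P_def W_def by (intro UN_I[of "ty v"]) auto
          qed
        qed
      qed
      show "P i \<inter> P j = {}" if "i \<noteq> j" for i j
        using that unfolding P_def W_def by (auto split: if_split_asm)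
    qed
    have edges: "card (E_in (V, E) (P i)) \<le> (N + u) * ?n + ?n * (u + big)" if i: "i < p" for i
    proof -
      let ?E1 = "(\<lambda>(x, y). {x, y}) ` ((S \<union> N1 i) \<times> V)"
      let ?E2 = "\<Union>x\<in>W i - N1 i. (\<lambda>y. {x, y}) ` {y \<in> W i. {x, y} \<in> E}"
      have fW: "finite (W i)" unfolding W_def using fin by simp
      have sub: "E_in (V, E) (P i) \<subseteq> ?E1 \<union> ?E2"
      proof
        fix e assume "e \<in> E_in (V, E) (P i)"
        then have e: "e \<in> E" "e \<subseteq> P i" unfolding E_in_def by auto
        obtain x y where xy: "e = {x, y}" "x \<in> V" "y \<in> V" using e(1) G by (auto elim: graph_edgeD)
        have PS: "P i \<subseteq> S \<union> W i" unfolding P_def by (auto split: if_split_asm)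
        consider "x \<in> S \<union> N1 i" | "y \<in> S \<union> N1 i" | "x \<in> W i - N1 i" "y \<in> W i - N1 i"
          using e(2) PS xy(1) by auto
        then show "e \<in> ?E1 \<union> ?E2"
        proof cases
          case 1
          then have "(x, y) \<in> (S \<union> N1 i) \<times> V" using xy by auto
          then show ?thesis unfolding xy(1) by (intro UnI1 rev_image_eqI[of "(x, y)"]) auto
        next
          case 2
          then have "(y, x) \<in> (S \<union> N1 i) \<times> V" using xy by auto
          then show ?thesis unfolding xy(1) by (intro UnI1 rev_image_eqI[of "(y, x)"]) auto
        next
          case 3
          then show ?thesis using e(1) unfolding xy(1) by auto
        qed
      qed
      have fN1: "finite (N1 i)" unfolding N1_def using fW by simp
      have "card (E_in (V, E) (P i)) \<le> card (?E1 \<union> ?E2)"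
        by (rule card_mono[OF _ sub]) (use fS fN1 fin fW in auto)
      also have "\<dots> \<le> card ?E1 + card ?E2" by (rule card_Un_le)
      also have "card ?E1 \<le> card ((S \<union> N1 i) \<times> V)" by (rule card_image_le) (use fS fN1 fin in auto)
      also have "\<dots> \<le> (N + u) * ?n"
        using card_Un_le[of S "N1 i"] cN1[OF i] cS by (simp add: card_cartesian_product)
      also have "card ?E2 \<le> (\<Sum>x\<in>W i - N1 i. card ((\<lambda>y. {x, y}) ` {y \<in> W i. {x, y} \<in> E}))"
        by (rule card_UN_le) (use fW in auto)
      also have "\<dots> \<le> (\<Sum>x\<in>W i - N1 i. u + big)"
      proof (rule sum_mono)
        fix x assume x: "x \<in> W i - N1 i"
        have "card ((\<lambda>y. {x, y}) ` {y \<in> W i. {x, y} \<in> E}) \<le> card {y \<in> W i. {x, y} \<in> E}"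
          by (rule card_image_le) (use fW in auto)
        also have "\<dots> \<le> u + big" by (rule deg[OF i x])
        finally show "card ((\<lambda>y. {x, y}) ` {y \<in> W i. {x, y} \<in> E}) \<le> u + big" .
      qed
      also have "\<dots> \<le> ?n * (u + big)"
      proof -
        have "card (W i - N1 i) \<le> ?n" by (rule card_mono) (use fin in \<open>auto simp: W_def\<close>)
        then show ?thesis by simp
      qed
      finally show ?thesis by simp
    qed
    have "part_cost (V, E) p P \<le> (\<Sum>i<p. (N + u) * ?n + ?n * (u + big))"
      unfolding part_cost_def by (rule sum_mono) (use edges in auto)
    then have "real (part_cost (V, E) p P) \<le> real (p * ((N + u) * ?n + ?n * (u + big)))" by (simp only: sum_constant card_lessThan of_nat_le_iff of_nat_id)
    also have "\<dots> = p * ?n * (N + real big + 2 * u)" by (simp add: algebra_simps)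
    also have "\<dots> \<le> p * ?n * (N + real big + 2 * (\<eta>1 * ?n + 1))"
      using u(2) by (intro mult_left_mono) auto
    also have "\<dots> = p * (2 + N + real big) * ?n + 2 * p * \<eta>1 * real ?n ^ 2"
      by (simp add: algebra_simps power2_eq_square)
    also have "\<dots> \<le> \<eta> / 2 * real ?n ^ 2 + \<eta> / 2 * real ?n ^ 2"
    proof (rule add_mono)
      show "p * (2 + N + real big) * ?n \<le> \<eta> / 2 * real ?n ^ 2" using n3[of ?n] n by simp
      show "2 * p * \<eta>1 * real ?n ^ 2 \<le> \<eta> / 2 * real ?n ^ 2" using \<eta>1(3) by (intro mult_right_mono) auto
    qed
    also have "\<dots> = \<eta> * real ?n ^ 2" by simp
    finally show ?thesis using part by blast
  qed
  then show ?thesis by blast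
qed

end

section \<open>Local exchange in optimal partitions and counts of cross pairs\<close>

section \<open>Optimal partitions\<close>

lemma eventually_const_le_linear:
  fixes a B :: real
  assumes "a > 0"
  shows "\<exists>n0::nat. \<forall>n\<ge>n0. B \<le> a * real n"
proof (intro exI allI impI)
  fix n assume "n \<ge> nat \<lceil>B / a\<rceil>"
  then have "B / a \<le> n" by linarith
  then show "B \<le> a * real n" using assms by (simp add: pos_divide_le_eq mult.commute)
qed

lemma partition_subset:
  assumes "is_partition (V, E) p P" "i < p"
  shows "P i \<subseteq> V"
  using assms unfolding is_partition_def by auto

lemma sum_card_partition:
  assumes "is_partition (V, E) p P" "finite V"
  shows "(\<Sum>i<p. card (P i)) = card V"
proof -
  have "card (\<Union>i<p. P i) = (\<Sum>i<p. card (P i))"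
    by (rule card_UN_disjoint)
      (use assms partition_subset[OF assms(1)] finite_subset in \<open>auto simp: is_partition_def\<close>)
  then show ?thesis using assms(1) unfolding is_partition_def by simp
qed

text \<open>Moving \<open>x\<close> from class i to class j lowers the cost by its degree into i and
  raises it by at most its degree into j; an optimal partition admits no gain.\<close>

lemma optimal_partition_degree_le:
  assumes G: "graph (V, E)" and opt: "optimal_partition (V, E) p P" and i: "i < p" and j: "j < p" and x: "x \<in> P i"
  shows "card {y \<in> P i. {x, y} \<in> E} \<le> card {y \<in> P j. {x, y} \<in> E}"
proof (cases "i = j")
  case False
  have part: "is_partition (V, E) p P" and min: "\<And>Q. is_partition (V, E) p Q \<Longrightarrow> part_cost (V, E) p P \<le> part_cost (V, E) p Q"
    using opt unfolding optimal_partition_def by auto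
  have fin: "finite V" "finite E" using graph_finite[OF G] by auto
  have fP: "finite (P l)" if "l < p" for l using partition_subset[OF part that] fin finite_subset by blast
  have disj: "P l \<inter> P l' = {}" if "l < p" "l' < p" "l \<noteq> l'" for l l'
    using part that unfolding is_partition_def by auto
  have xj: "x \<notin> P j" using disj[OF i j False] x by auto
  have fE: "finite (E_in (V, E) Z)" for Z unfolding E_in_def using fin by simp
  define Q where "Q = P(i := P i - {x}, j := insert x (P j))"
  have Q: "Q i = P i - {x}" "Q j = insert x (P j)" "\<And>l. l \<noteq> i \<Longrightarrow> l \<noteq> j \<Longrightarrow> Q l = P l"
    unfolding Q_def using False by auto
  have partQ: "is_partition (V, E) p Q"
    unfolding is_partition_def fst_conv
  proof (intro conjI allI impI)
    show "(\<Union>l<p. Q l) = V"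
    proof
      show "(\<Union>l<p. Q l) \<subseteq> V"
        using partition_subset[OF part] x i j unfolding Q_def by (auto split: if_split_asm)
      show "V \<subseteq> (\<Union>l<p. Q l)"
      proof
        fix v assume "v \<in> V"
        then obtain l where l: "l < p" "v \<in> P l" using part unfolding is_partition_def by auto
        show "v \<in> (\<Union>l<p. Q l)"
        proof (cases "v = x")
          case True
          then show ?thesis using Q(2) j by (intro UN_I[of j]) auto
        next
          case False
          then have "v \<in> Q l" using l(2) unfolding Q_def by auto
          then show ?thesis using l(1) by auto
        qed
      qed
    qed
    fix a b assume ab: "a < p" "b < p" "a \<noteq> b"
    have xi: "x \<in> P l \<longleftrightarrow> l = i" if "l < p" for l using disj[OF that i] x by auto
    show "Q a \<inter> Q b = {}"
      using disj[OF ab] ab xi[OF ab(1)] xi[OF ab(2)] unfolding Q_def by (auto split: if_split_asm)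
  qed
  have star: "card ((\<lambda>y. {x, y}) ` {y \<in> Z. {x, y} \<in> E}) = card {y \<in> Z. {x, y} \<in> E}" for Z
    by (rule card_image) (auto simp: inj_on_def doubleton_eq_iff)
  have e: "e \<in> E \<Longrightarrow> x \<in> e \<Longrightarrow> \<exists>y. e = {x, y} \<and> y \<noteq> x" for e using G by (auto elim!: graph_edgeD)
  have "E_in (V, E) (P i) = E_in (V, E) (Q i) \<union> (\<lambda>y. {x, y}) ` {y \<in> P i. {x, y} \<in> E}"
  proof (intro equalityI subsetI)
    fix f assume f: "f \<in> E_in (V, E) (P i)"
    show "f \<in> E_in (V, E) (Q i) \<union> (\<lambda>y. {x, y}) ` {y \<in> P i. {x, y} \<in> E}"
    proof (cases "x \<in> f")
      case True
      then obtain y where "f = {x, y}" "y \<noteq> x" using e[of f] f unfolding E_in_def by auto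
      then show ?thesis using f unfolding E_in_def by auto
    next
      case False
      then show ?thesis using f unfolding E_in_def Q(1) by auto
    qed
  qed (use x in \<open>auto simp: E_in_def Q(1)\<close>)
  moreover have "E_in (V, E) (Q i) \<inter> (\<lambda>y. {x, y}) ` {y \<in> P i. {x, y} \<in> E} = {}"
    unfolding E_in_def Q(1) by auto
  ultimately have ci: "card (E_in (V, E) (P i)) = card (E_in (V, E) (Q i)) + card {y \<in> P i. {x, y} \<in> E}"
    using fE fP[OF i] star by (simp add: card_Un_disjoint)
  have "E_in (V, E) (Q j) \<subseteq> E_in (V, E) (P j) \<union> (\<lambda>y. {x, y}) ` {y \<in> P j. {x, y} \<in> E}"
  proof
    fix f assume f: "f \<in> E_in (V, E) (Q j)"
    show "f \<in> E_in (V, E) (P j) \<union> (\<lambda>y. {x, y}) ` {y \<in> P j. {x, y} \<in> E}"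
    proof (cases "x \<in> f")
      case True
      then obtain y where "f = {x, y}" "y \<noteq> x" using e[of f] f unfolding E_in_def by auto
      then show ?thesis using f unfolding E_in_def Q(2) by auto
    next
      case False
      then show ?thesis using f unfolding E_in_def Q(2) by auto
    qed
  qed
  then have "card (E_in (V, E) (Q j)) \<le> card (E_in (V, E) (P j) \<union> (\<lambda>y. {x, y}) ` {y \<in> P j. {x, y} \<in> E})"
    by (rule card_mono[rotated]) (use fE fP[OF j] in auto)
  also have "\<dots> \<le> card (E_in (V, E) (P j)) + card {y \<in> P j. {x, y} \<in> E}"
    using card_Un_le[of "E_in (V, E) (P j)" "(\<lambda>y. {x, y}) ` {y \<in> P j. {x, y} \<in> E}"] star by simp
  finally have cj: "card (E_in (V, E) (Q j)) \<le> card (E_in (V, E) (P j)) + card {y \<in> P j. {x, y} \<in> E}" .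
  let ?R = "{..<p} - {i, j}"
  have split: "(\<Sum>l<p. f l) = f i + f j + (\<Sum>l\<in>?R. f l)" for f :: "nat \<Rightarrow> nat"
  proof -
    have "{..<p} = insert i (insert j ?R)" using i j by auto
    then have "(\<Sum>l<p. f l) = sum f (insert i (insert j ?R))" by simp
    then show ?thesis using False by simp
  qed
  have "(\<Sum>l\<in>?R. card (E_in (V, E) (Q l))) = (\<Sum>l\<in>?R. card (E_in (V, E) (P l)))"
    by (rule sum.cong) (use Q(3) in auto)
  then show ?thesis using min[OF partQ] ci cj unfolding part_cost_def split by linarith
qed simp

text \<open>Pairs are ordered, so each cross edge is counted twice. The complement of
  \<open>C\<close> in the square of \<open>V\<close> consists of the squares of the classes.\<close>

lemma cross_pairs:
  fixes E :: "nat set set"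
  assumes G: "graph (V, E)" and part: "is_partition (V, E) p P"
  defines "C \<equiv> {(u, v). \<exists>i<p. \<exists>j<p. i \<noteq> j \<and> u \<in> P i \<and> v \<in> P j}"
  shows "finite C" "card C + (\<Sum>i<p. card (P i) ^ 2) = card V ^ 2"
    "2 * card E \<le> card {(u, v) \<in> C. {u, v} \<in> E} + 2 * part_cost (V, E) p P"
proof -
  have fin: "finite V" "finite E" using graph_finite[OF G] by auto
  have fP: "finite (P l)" if "l < p" for l using partition_subset[OF part that] fin finite_subset by blast
  have disj: "P l \<inter> P l' = {}" if "l < p" "l' < p" "l \<noteq> l'" for l l'
    using part that unfolding is_partition_def by auto
  have cover: "\<exists>i<p. v \<in> P i" if "v \<in> V" for v using part that unfolding is_partition_def by auto
  have sub: "P i \<subseteq> V" if "i < p" for i by (rule partition_subset[OF part that])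
  have CV: "C \<subseteq> V \<times> V" unfolding C_def using sub by auto
  then show fC: "finite C" using fin finite_subset by blast
  have "V \<times> V = C \<union> (\<Union>i<p. P i \<times> P i)"
  proof
    show "V \<times> V \<subseteq> C \<union> (\<Union>i<p. P i \<times> P i)"
    proof
      fix e assume "e \<in> V \<times> V"
      then obtain u v where uv: "e = (u, v)" "u \<in> V" "v \<in> V" by auto
      obtain i where "i < p" "u \<in> P i" using cover[OF uv(2)] by auto
      moreover obtain j where "j < p" "v \<in> P j" using cover[OF uv(3)] by auto
      moreover note uv
      ultimately have "e = (u, v)" "i < p" "u \<in> P i" "j < p" "v \<in> P j" by auto
      then show "e \<in> C \<union> (\<Union>i<p. P i \<times> P i)" unfolding C_def by (cases "i = j") auto
    qed
    show "C \<union> (\<Union>i<p. P i \<times> P i) \<subseteq> V \<times> V" using CV sub by auto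
  qed
  moreover have "C \<inter> (\<Union>i<p. P i \<times> P i) = {}"
  proof (rule ccontr)
    assume "C \<inter> (\<Union>i<p. P i \<times> P i) \<noteq> {}"
    then obtain u v i j l where uv: "i < p" "j < p" "l < p" "i \<noteq> j" "u \<in> P i" "v \<in> P j" "u \<in> P l" "v \<in> P l"
      unfolding C_def by auto
    then have "i = l" "j = l" using disj by blast+
    then show False using uv(4) by simp
  qed
  moreover have "card (\<Union>i<p. P i \<times> P i) = (\<Sum>i<p. card (P i \<times> P i))"
    by (rule card_UN_disjoint) (use fP disj in auto)
  ultimately have "card (V \<times> V) = card C + (\<Sum>i<p. card (P i \<times> P i))"
    using fC fP by (simp add: card_Un_disjoint)
  then show "card C + (\<Sum>i<p. card (P i) ^ 2) = card V ^ 2"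
    by (simp add: card_cartesian_product power2_eq_square)
  define A where "A = {(u, v) \<in> C. {u, v} \<in> E}"
  define X where "X = {e \<in> E. \<forall>i<p. \<not> e \<subseteq> P i}"
  have fA: "finite A" unfolding A_def using fC by (rule rev_finite_subset) auto
  have XA: "\<exists>u v. e = {u, v} \<and> u < v \<and> (u, v) \<in> A \<and> (v, u) \<in> A" if e: "e \<in> X" for e
  proof -
    have eE: "e \<in> E" using e unfolding X_def by simp
    obtain a b where ab: "a \<noteq> b" "a \<in> V" "b \<in> V" "e = {a, b}" using graph_edgeD[OF G eE] by metis
    have "e = {min a b, max a b}" "min a b < max a b" "min a b \<in> V" "max a b \<in> V"
      using ab by (auto simp: min_def max_def)
    then obtain u v where uv: "e = {u, v}" "u < v" "u \<in> V" "v \<in> V" by blast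
    obtain i j where ij: "i < p" "u \<in> P i" "j < p" "v \<in> P j" using cover uv by meson
    have "i \<noteq> j" using ij e uv(1) unfolding X_def by auto
    then have "(u, v) \<in> C" "(v, u) \<in> C" unfolding C_def using ij by auto
    then show ?thesis using uv eE unfolding A_def by (auto simp: insert_commute)
  qed
  have "card X \<le> card {(u, v) \<in> A. u < v}"
  proof (rule surj_card_le)
    show "finite {(u, v) \<in> A. u < v}" using fA by (rule rev_finite_subset) auto
    show "X \<subseteq> (\<lambda>(u, v). {u, v}) ` {(u, v) \<in> A. u < v}" using XA by fastforce
  qed
  moreover have "card X \<le> card {(u, v) \<in> A. v < u}"
  proof (rule surj_card_le)
    show "finite {(u, v) \<in> A. v < u}" using fA by (rule rev_finite_subset) auto
    show "X \<subseteq> (\<lambda>(u, v). {u, v}) ` {(u, v) \<in> A. v < u}"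
    proof
      fix e assume "e \<in> X"
      then obtain u v where "e = {u, v}" "u < v" "(v, u) \<in> A" using XA by blast
      then show "e \<in> (\<lambda>(u, v). {u, v}) ` {(u, v) \<in> A. v < u}" by (intro rev_image_eqI[of "(v, u)"]) auto
    qed
  qed
  moreover have "card {(u, v) \<in> A. u < v} + card {(u, v) \<in> A. v < u} \<le> card A"
  proof -
    have "card {(u, v) \<in> A. u < v} + card {(u, v) \<in> A. v < u} = card ({(u, v) \<in> A. u < v} \<union> {(u, v) \<in> A. v < u})"
      by (rule card_Un_disjoint[symmetric]) (use fA in \<open>auto intro: rev_finite_subset\<close>)
    also have "\<dots> \<le> card A" by (rule card_mono[OF fA]) auto
    finally show ?thesis .
  qed
  moreover have "card E \<le> card X + part_cost (V, E) p P"
  proof -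
    have "E \<subseteq> X \<union> (\<Union>i<p. E_in (V, E) (P i))" unfolding X_def E_in_def by auto
    then have "card E \<le> card (X \<union> (\<Union>i<p. E_in (V, E) (P i)))"
      by (rule card_mono[rotated]) (use fin in \<open>auto simp: X_def E_in_def\<close>)
    also have "\<dots> \<le> card X + card (\<Union>i<p. E_in (V, E) (P i))" by (rule card_Un_le)
    also have "card (\<Union>i<p. E_in (V, E) (P i)) \<le> part_cost (V, E) p P"
      unfolding part_cost_def by (rule card_UN_le) simp
    finally show ?thesis by simp
  qed
  ultimately have "2 * card E \<le> card A + 2 * part_cost (V, E) p P" by linarith
  then show "2 * card E \<le> card {(u, v) \<in> C. {u, v} \<in> E} + 2 * part_cost (V, E) p P" unfolding A_def .
qed

section \<open>Bounds for the fibres over a vertex and over a forcing set\<close>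

context oriented_pattern
begin

text \<open>Counterpart of \<open>emb_via_univ\<close> for a single orientation: the classes
  themselves are universal, and the arcs between \<open>Q\<close> and the other labels hold because
  each \<open>X l\<close> lies in the appropriate neighbourhoods. Again the labels in
  \<open>Q\<close> only fill places in the universal copy.\<close>

lemma emb_via_univ_partition:
  assumes univ: "univ VH AH p P E d F" and P: "\<And>j. j < p \<Longrightarrow> P j \<subseteq> V \<and> d \<le> card (P j)"
    and Q: "Q \<subseteq> VH" "inj_on g Q" "g ` Q \<subseteq> S" "S \<subseteq> V"
    and X: "\<And>l. l \<in> VH - Q \<Longrightarrow> c l < p \<and> X l \<subseteq> P (c l) - S \<and> d \<le> card (X l)"
    and arcs: "\<And>x y. (x, y) \<in> AH \<Longrightarrow> x \<notin> Q \<Longrightarrow> y \<notin> Q \<Longrightarrow> c x \<noteq> c y"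
      "\<And>x y. (x, y) \<in> AH \<Longrightarrow> x \<in> Q \<Longrightarrow> y \<in> Q \<Longrightarrow> arc E F (g x) (g y)"
      "\<And>x y w. (x, y) \<in> AH \<Longrightarrow> x \<in> Q \<Longrightarrow> y \<notin> Q \<Longrightarrow> w \<in> X y \<Longrightarrow> arc E F (g x) w"
      "\<And>x y w. (x, y) \<in> AH \<Longrightarrow> x \<notin> Q \<Longrightarrow> y \<in> Q \<Longrightarrow> w \<in> X x \<Longrightarrow> arc E F w (g y)"
  shows "emb V E F VH AH"
proof -
  define c' where "c' l = (if l \<in> Q then 0 else c l)" for l
  define X' where "X' l = (if l \<in> Q then P 0 else X l)" for l
  have p0: "0 < p" using p2 by simp
  have "\<exists>f. inj_on f VH \<and> (\<forall>l\<in>VH. f l \<in> X' l) \<and> (\<forall>(x, y)\<in>AH. c' x \<noteq> c' y \<longrightarrow> arc E F (f x) (f y))"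
    by (rule univ[unfolded univ_def, rule_format]) (use X P[OF p0] p0 in \<open>auto simp: c'_def X'_def\<close>)
  then obtain f where f0: "inj_on f VH \<and> (\<forall>l\<in>VH. f l \<in> X' l) \<and>
      (\<forall>(x, y)\<in>AH. c' x \<noteq> c' y \<longrightarrow> arc E F (f x) (f y))" by (elim exE)
  have f: "inj_on f VH" "\<And>l. l \<in> VH - Q \<Longrightarrow> f l \<in> X l"
      "\<And>x y. (x, y) \<in> AH \<Longrightarrow> c' x \<noteq> c' y \<Longrightarrow> arc E F (f x) (f y)"
    using f0 by (auto simp: X'_def)
  define h where "h l = (if l \<in> Q then g l else f l)" for l
  have fS: "f l \<in> V - S" if "l \<in> VH - Q" for l using f(2)[OF that] X[OF that] P by blast
  have "inj_on h VH"
  proof (rule inj_onI)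
    fix x y assume xy: "x \<in> VH" "y \<in> VH" "h x = h y"
    consider "x \<in> Q" "y \<in> Q" | "x \<in> Q" "y \<notin> Q" | "x \<notin> Q" "y \<in> Q" | "x \<notin> Q" "y \<notin> Q" by blast
    then show "x = y"
    proof cases
      case 1
      then show ?thesis using xy Q(2) by (auto simp: h_def dest: inj_onD)
    next
      case 2
      then show ?thesis using xy Q(3) fS[of y] by (auto simp: h_def)
    next
      case 3
      then have "g y \<in> S" "g y = f x" using xy Q(3) by (auto simp: h_def)
      then show ?thesis using 3 xy fS[of x] by auto
    next
      case 4
      then show ?thesis using xy f(1) by (auto simp: h_def dest: inj_onD)
    qed
  qed
  moreover have "h ` VH \<subseteq> V" using Q(3,4) fS unfolding h_def by auto
  moreover have "arc E F (h x) (h y)" if xy: "(x, y) \<in> AH" for x y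
  proof -
    have V: "x \<in> VH" "y \<in> VH" using xy AH(1) by auto
    consider "x \<in> Q" "y \<in> Q" | "x \<in> Q" "y \<notin> Q" | "x \<notin> Q" "y \<in> Q" | "x \<notin> Q" "y \<notin> Q" by blast
    then show ?thesis
    proof cases
      case 1
      then show ?thesis using arcs(2)[OF xy] by (simp add: h_def)
    next
      case 2
      then show ?thesis using arcs(3)[OF xy _ _ f(2)[of y]] V by (simp add: h_def)
    next
      case 3
      then show ?thesis using arcs(4)[OF xy _ _ f(2)[of x]] V by (simp add: h_def)
    next
      case 4
      then show ?thesis using arcs(1)[OF xy] f(3)[OF xy] by (simp add: h_def c'_def)
    qed
  qed
  ultimately show ?thesis unfolding emb_def by blast
qed

text \<open>However its edges are oriented, the set \<open>S\<close> can be completed to a copy by generic vertices: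
  \<open>c\<close> distributes the pattern over the parts, and only the vertices in \<open>Q\<close> are placed in \<open>S\<close>.\<close>
definition forcing :: "nat set set \<Rightarrow> nat set \<Rightarrow> bool" where
  "forcing E S \<longleftrightarrow> (\<forall>F. F \<subseteq> E \<longrightarrow> (\<exists>(c :: 'a \<Rightarrow> nat) Q g. Q \<subseteq> VH \<and> (\<forall>l\<in>VH. c l < p) \<and> (\<forall>l\<in>Q. c l = 0) \<and>
     inj_on g Q \<and> g ` Q \<subseteq> S \<and>
     (\<forall>(x, y)\<in>AH. c x = c y \<longrightarrow> x \<in> Q \<and> y \<in> Q \<and> arc E F (g x) (g y))))"

text \<open>The surplus \<open>card VH\<close> leaves \<open>d\<close> vertices in a class after a
  set of at most \<open>card VH\<close> vertices has been removed.\<close>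

definition rich_parts :: "nat set \<Rightarrow> nat set set \<Rightarrow> (nat \<Rightarrow> nat set) \<Rightarrow> nat \<Rightarrow> bool" where
  "rich_parts V E P d \<longleftrightarrow> graph (V, E) \<and> is_partition (V, E) p P \<and> (\<forall>j<p. d + card VH \<le> card (P j))"

text \<open>One direction occurs \<open>d\<close> times among the arcs between \<open>x\<close> and
  class i, and the star colouring of that direction is used with \<open>x\<close> as
  \<open>z\<close>. If \<open>x\<close> also had \<open>d\<close> out-neighbours and
  \<open>d\<close> in-neighbours in every other class, each label could be confined to the
  neighbourhood of the direction it needs.\<close>

lemma vertex_with_large_degrees:
  assumes rich: "rich_parts V E P d" and d: "d \<ge> 1" and univ: "univ VH AH p P E d F"
    and free: "\<not> emb V E F VH AH" and x: "x \<in> V" and i: "i < p" "2 * d \<le> card {y \<in> P i. {x, y} \<in> E}"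
  shows "\<exists>j<p. j \<noteq> i \<and> (card {y \<in> P j. arc E F x y} < d \<or> card {y \<in> P j. arc E F y x} < d)"
proof (rule ccontr)
  assume no: "\<not> ?thesis"
  have G: "graph (V, E)" and part: "is_partition (V, E) p P" using rich unfolding rich_parts_def by auto
  have out: "d \<le> card {y \<in> P j. arc E F x y}" and inn: "d \<le> card {y \<in> P j. arc E F y x}"
    if "j < p" "j \<noteq> i" for j using no that not_less by blast+
  have P: "P j \<subseteq> V \<and> d \<le> card (P j)" if "j < p" for j
    using rich that partition_subset[OF part that] unfolding rich_parts_def by auto
  have loop: "\<not> arc E F x x" by (simp add: arc_def)
  have "{y \<in> P i. {x, y} \<in> E} = {y \<in> P i. arc E F x y} \<union> {y \<in> P i. arc E F y x}"
  proof -
    have "{x, y} \<in> E \<Longrightarrow> x \<noteq> y" for y using G by (auto elim!: graph_edgeD)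
    then have "{x, y} \<in> E \<longleftrightarrow> arc E F x y \<or> arc E F y x" for y
      using arc_flip[of x y E F] unfolding arc_def by (auto simp: insert_commute)
    then show ?thesis by auto
  qed
  then have "2 * d \<le> card {y \<in> P i. arc E F x y} + card {y \<in> P i. arc E F y x}"
    using i(2) card_Un_le[of "{y \<in> P i. arc E F x y}" "{y \<in> P i. arc E F y x}"] by simp
  then consider "d \<le> card {y \<in> P i. arc E F x y}" | "d \<le> card {y \<in> P i. arc E F y x}" by linarith
  then have "emb V E F VH AH"
  proof cases
    case 1
    obtain z c where z: "z \<in> VH" "\<forall>l\<in>VH. c l < p" "c z = i" and col: "\<forall>(x, y)\<in>AH. c x = c y \<longrightarrow> x = z"
      using star_colourings(1)[OF i(1)] by blast
    have mono: "l = z" if "(l, l') \<in> AH" "c l = c l'" for l l' using col that by auto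
    \<comment> \<open>Labels of other colours that are not adjacent to \<open>z\<close> could take
      either neighbourhood; the choice made for them is arbitrary.\<close>
    show ?thesis
    proof (rule emb_via_univ_partition[where c = c and Q = "{z}" and g = "\<lambda>_. x" and S = "{x}"
          and X = "\<lambda>l. if c l = i \<or> (z, l) \<in> AH then {y \<in> P (c l). arc E F x y} else {y \<in> P (c l). arc E F y x}", OF univ P])
      show "c l < p \<and> (if c l = i \<or> (z, l) \<in> AH then {y \<in> P (c l). arc E F x y} else {y \<in> P (c l). arc E F y x})
          \<subseteq> P (c l) - {x} \<and> d \<le> card (if c l = i \<or> (z, l) \<in> AH then {y \<in> P (c l). arc E F x y} else {y \<in> P (c l). arc E F y x})"
        if "l \<in> VH - {z}" for l
        using that z(2) 1 out[of "c l"] inn[of "c l"] loop by (cases "c l = i") auto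
      show "c u \<noteq> c v" if "(u, v) \<in> AH" "u \<notin> {z}" "v \<notin> {z}" for u v using mono[OF that(1)] that(2) by auto
      show "arc E F x x" if "(u, v) \<in> AH" "u \<in> {z}" "v \<in> {z}" for u v using that AH(2) by auto
      show "arc E F x w" if "(u, v) \<in> AH" "u \<in> {z}" "v \<notin> {z}"
        "w \<in> (if c v = i \<or> (z, v) \<in> AH then {y \<in> P (c v). arc E F x y} else {y \<in> P (c v). arc E F y x})" for u v w
        using that by auto
      show "arc E F w x" if uv: "(u, v) \<in> AH" "u \<notin> {z}" "v \<in> {z}"
        and w: "w \<in> (if c u = i \<or> (z, u) \<in> AH then {y \<in> P (c u). arc E F x y} else {y \<in> P (c u). arc E F y x})" for u v w
      proof -
        have "c u \<noteq> i" using mono[OF uv(1)] uv(2,3) z(3) by auto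
        moreover have "(z, u) \<notin> AH" using AH(2) uv by auto
        ultimately show ?thesis using w by simp
      qed
    qed (use z x in auto)
  next
    case 2
    obtain z c where z: "z \<in> VH" "\<forall>l\<in>VH. c l < p" "c z = i" and col: "\<forall>(x, y)\<in>AH. c x = c y \<longrightarrow> y = z"
      using star_colourings(2)[OF i(1)] by blast
    have mono: "l' = z" if "(l, l') \<in> AH" "c l = c l'" for l l' using col that by auto
    show ?thesis
    proof (rule emb_via_univ_partition[where c = c and Q = "{z}" and g = "\<lambda>_. x" and S = "{x}"
          and X = "\<lambda>l. if c l \<noteq> i \<and> (z, l) \<in> AH then {y \<in> P (c l). arc E F x y} else {y \<in> P (c l). arc E F y x}", OF univ P])
      show "c l < p \<and> (if c l \<noteq> i \<and> (z, l) \<in> AH then {y \<in> P (c l). arc E F x y} else {y \<in> P (c l). arc E F y x})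
          \<subseteq> P (c l) - {x} \<and> d \<le> card (if c l \<noteq> i \<and> (z, l) \<in> AH then {y \<in> P (c l). arc E F x y} else {y \<in> P (c l). arc E F y x})"
        if "l \<in> VH - {z}" for l
        using that z(2) 2 out[of "c l"] inn[of "c l"] loop by (cases "c l = i") auto
      show "c u \<noteq> c v" if "(u, v) \<in> AH" "u \<notin> {z}" "v \<notin> {z}" for u v using mono[OF that(1)] that(3) by auto
      show "arc E F x x" if "(u, v) \<in> AH" "u \<in> {z}" "v \<in> {z}" for u v using that AH(2) by auto
      show "arc E F x w" if uv: "(u, v) \<in> AH" "u \<in> {z}" "v \<notin> {z}"
        and w: "w \<in> (if c v \<noteq> i \<and> (z, v) \<in> AH then {y \<in> P (c v). arc E F x y} else {y \<in> P (c v). arc E F y x})" for u v w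
      proof -
        have "c v \<noteq> i" using mono[OF uv(1)] uv(2,3) z(3) by auto
        then show ?thesis using w uv by simp
      qed
      show "arc E F w x" if uv: "(u, v) \<in> AH" "u \<notin> {z}" "v \<in> {z}"
        and w: "w \<in> (if c u \<noteq> i \<and> (z, u) \<in> AH then {y \<in> P (c u). arc E F x y} else {y \<in> P (c u). arc E F y x})" for u v w
      proof -
        have "(z, u) \<notin> AH" using AH(2) uv by auto
        then show ?thesis using w by simp
      qed
    qed (use z x in auto)
  qed
  then show False using free by simp
qed

text \<open>If every pattern of arcs towards \<open>S\<close> occurred at \<open>d\<close> common
  neighbours in each other class, then each label outside class i could be confined to vertices
  whose arcs to \<open>S\<close> are as required, and the colouring given by \<open>forcing\<close>
  would complete to a copy.\<close>

lemma forcing_set_pattern_rare: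
  assumes rich: "rich_parts V E P d" and univ: "univ VH AH p P E d F" and F: "F \<subseteq> E"
    and free: "\<not> emb V E F VH AH" and i: "i < p" and S: "S \<subseteq> P i" "card S \<le> card VH" "forcing E S"
  shows "\<exists>j<p. j \<noteq> i \<and> (\<exists>\<pi>\<subseteq>S. card {w \<in> P j. (\<forall>x\<in>S. {x, w} \<in> E) \<and> {x \<in> S. arc E F x w} = \<pi>} < d)"
proof (rule ccontr)
  assume no: "\<not> ?thesis"
  let ?X = "\<lambda>j \<pi>. {w \<in> P j. (\<forall>x\<in>S. {x, w} \<in> E) \<and> {x \<in> S. arc E F x w} = \<pi>}"
  have many: "d \<le> card (?X j \<pi>)" if "j < p" "j \<noteq> i" "\<pi> \<subseteq> S" for j \<pi>
    using no that not_less by blast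
  have G: "graph (V, E)" and part: "is_partition (V, E) p P" using rich unfolding rich_parts_def by auto
  have P: "P j \<subseteq> V \<and> d \<le> card (P j)" if "j < p" for j
    using rich that partition_subset[OF part that] unfolding rich_parts_def by auto
  have SV: "S \<subseteq> V" using S(1) P[OF i] by auto
  have fS: "finite S" using finite_subset[OF SV] graph_finite[OF G] by simp
  from S(3)[unfolded forcing_def, rule_format, OF F]
  obtain c0 :: "'a \<Rightarrow> nat" and Q g where cQg: "Q \<subseteq> VH \<and> (\<forall>l\<in>VH. c0 l < p) \<and> (\<forall>l\<in>Q. c0 l = 0) \<and>
      inj_on g Q \<and> g ` Q \<subseteq> S \<and>
      (\<forall>(x, y)\<in>AH. c0 x = c0 y \<longrightarrow> x \<in> Q \<and> y \<in> Q \<and> arc E F (g x) (g y))"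
    by (elim exE)
  then have Q: "Q \<subseteq> VH" "\<forall>l\<in>VH. c0 l < p" "\<forall>l\<in>Q. c0 l = 0" "inj_on g Q" "g ` Q \<subseteq> S" by simp_all
  from cQg have col: "\<forall>(x, y)\<in>AH. c0 x = c0 y \<longrightarrow> x \<in> Q \<and> y \<in> Q \<and> arc E F (g x) (g y)" by (elim conjE)
  have mono: "x \<in> Q \<and> y \<in> Q \<and> arc E F (g x) (g y)" if "(x, y) \<in> AH" "c0 x = c0 y" for x y
    using col that by auto
  \<comment> \<open>\<open>forcing\<close> puts \<open>Q\<close> into colour 0; the transposition
    moves it to the class i that contains \<open>S\<close>.\<close>
  define c where "c l = Transposition.transpose 0 i (c0 l)" for l
  have c_eq: "c x = c y \<longleftrightarrow> c0 x = c0 y" for x y unfolding c_def by (metis transpose_involutory)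
  have cp: "c l < p" if "l \<in> VH" for l
    using Q(2) that i p2 unfolding c_def Transposition.transpose_def by auto
  have cQ: "c l = i" if "l \<in> Q" for l using Q(3) that unfolding c_def by simp
  \<comment> \<open>The vertices of \<open>S\<close> that need an arc into the label
    \<open>l\<close>. All other vertices of \<open>S\<close> receive an arc from the vertex chosen
    for \<open>l\<close>, which is what the arcs out of \<open>l\<close> need.\<close>
  define \<pi> where "\<pi> l = {g k | k. k \<in> Q \<and> (k, l) \<in> AH}" for l
  have \<pi>S: "\<pi> l \<subseteq> S" for l using Q(5) unfolding \<pi>_def by auto
  have "emb V E F VH AH"
  proof (rule emb_via_univ_partition[where c = c and Q = Q and g = g and S = S
        and X = "\<lambda>l. if c l = i then P i - S else ?X (c l) (\<pi> l)", OF univ P Q(1,4,5)])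
    show "S \<subseteq> V" by (rule SV)
    fix l assume l: "l \<in> VH - Q"
    have disj: "P (c l) \<inter> S = {}" if "c l \<noteq> i"
      using part S(1) that cp[of l] l i unfolding is_partition_def by auto
    show "c l < p \<and> (if c l = i then P i - S else ?X (c l) (\<pi> l)) \<subseteq> P (c l) - S \<and>
        d \<le> card (if c l = i then P i - S else ?X (c l) (\<pi> l))"
    proof (cases "c l = i")
      case True
      have "d + card VH \<le> card (P i)" using rich i unfolding rich_parts_def by auto
      moreover have "card (P i - S) = card (P i) - card S" using S(1) fS by (simp add: card_Diff_subset)
      ultimately have "d \<le> card (P i - S)" using S(2) by linarith
      then show ?thesis using True cp[of l] l by auto
    next
      case False
      then show ?thesis using many[OF cp[of l] False \<pi>S] cp[of l] l disj by auto
    qed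
  next
    fix x y assume xy: "(x, y) \<in> AH"
    show "c x \<noteq> c y" if "x \<notin> Q" "y \<notin> Q" using mono[OF xy] that c_eq by auto
    show "arc E F (g x) (g y)" if "x \<in> Q" "y \<in> Q"
      using mono[OF xy] c_eq[of x y] cQ[OF that(1)] cQ[OF that(2)] by auto
    show "arc E F (g x) w" if Q': "x \<in> Q" "y \<notin> Q" and w: "w \<in> (if c y = i then P i - S else ?X (c y) (\<pi> y))" for w
    proof -
      have "c y \<noteq> i" using mono[OF xy] c_eq[of x y] cQ[OF Q'(1)] Q'(2) by auto
      then have "{x \<in> S. arc E F x w} = \<pi> y" using w by simp
      moreover have "g x \<in> \<pi> y" unfolding \<pi>_def using Q' xy by auto
      ultimately show ?thesis by auto
    qed
    show "arc E F w (g y)" if Q': "x \<notin> Q" "y \<in> Q" and w: "w \<in> (if c x = i then P i - S else ?X (c x) (\<pi> x))" for w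
    proof -
      have "c x \<noteq> i" using mono[OF xy] c_eq[of x y] cQ[OF Q'(2)] Q'(1) by auto
      then have w': "{x \<in> S. arc E F x w} = \<pi> x" "\<forall>v\<in>S. {v, w} \<in> E" using w by auto
      have gy: "g y \<in> S" using Q(5) Q'(2) by auto
      have "g y \<notin> \<pi> x"
      proof
        assume "g y \<in> \<pi> x"
        then obtain k where k: "k \<in> Q" "(k, x) \<in> AH" "g y = g k" unfolding \<pi>_def by auto
        then have "y = k" using Q(4) Q'(2) by (auto dest: inj_onD)
        then show False using AH(2)[OF xy] k(2) by simp
      qed
      then have "\<not> arc E F (g y) w" using w'(1) gy by auto
      moreover have e: "{g y, w} \<in> E" using w'(2) gy by auto
      moreover have "g y \<noteq> w" using e G by (auto elim!: graph_edgeD)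
      ultimately show ?thesis using arc_flip[of "g y" w E F] by blast
    qed
  qed
  then show False using free by simp
qed

end

text \<open>In a fibre only the edges between \<open>S\<close> and its complement vary, so the arcs
  there determine the member.\<close>

lemma fibre_eqI:
  assumes G: "graph (V, E)" and \<E>: "agree_off E S \<E>" "\<E> \<subseteq> Pow E" and F: "F \<in> \<E>" "F' \<in> \<E>"
    and arcs: "\<And>z w. z \<in> S \<Longrightarrow> w \<in> V - S \<Longrightarrow> {z, w} \<in> E \<Longrightarrow> arc E F z w \<longleftrightarrow> arc E F' z w"
  shows "F = F'"
proof (rule set_eqI)
  fix e
  show "e \<in> F \<longleftrightarrow> e \<in> F'"
  proof (cases "e \<in> E")
    case eE: True
    show ?thesis
    proof (cases "e \<inter> S = {} \<or> e \<subseteq> S")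
      case True
      then show ?thesis using \<E>(1) F eE unfolding agree_off_def by blast
    next
      case False
      then have "e \<in> cross_edges E S" using eE unfolding cross_edges_def by simp
      then obtain z w where zw: "z \<in> S" "w \<in> V - S" "e = {z, w}" by (rule cross_edgesE[OF G])
      then show ?thesis using arcs[OF zw(1,2)] eE unfolding arc_def by auto
    qed
  qed (use F \<E>(2) in auto)
qed

context oriented_pattern
begin

text \<open>A member of the fibre over one vertex is determined by the out-neighbourhood of
  \<open>x\<close>, so this fibre has at most 2^deg(x) members, whereas goodness makes it
  large.\<close>

lemma degree_lower_bound:
  assumes good: "good s0 (card V)" "1 \<le> s0" and ext: "extremal V E" and x: "x \<in> V"
  shows "\<beta> * card V - 2 - K \<le> card {y \<in> V. {x, y} \<in> E}"
proof -
  have G: "graph (V, E)" using ext unfolding extremal_def by simp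
  have fin: "finite V" "finite E" using graph_finite[OF G] by auto
  have D1: "D (card V) \<le> 1 * real (card (hfree V E))" using ext unfolding extremal_def by simp
  obtain \<E> where \<E>: "\<E> \<subseteq> hfree V E" "agree_off E {x} \<E>"
    and big: "2 powr (\<beta> * card {x} * card V - 2 * real (card {x}) ^ 2 - K) / 1 \<le> card \<E>"
    by (rule ex_large_fibre[OF good(1) ext, of "{x}" "hfree V E" 1]) (use x good(2) D1 in auto)
  have \<E>E: "\<E> \<subseteq> Pow E" using \<E>(1) unfolding hfree_def by auto
  let ?N = "{y \<in> V. {x, y} \<in> E}"
  have "card \<E> \<le> card (Pow ?N)"
  proof (rule card_inj_on_le)
    show "inj_on (\<lambda>F. {y \<in> V. arc E F x y}) \<E>"
    proof (rule inj_onI)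
      fix F F' assume FF: "F \<in> \<E>" "F' \<in> \<E>" and eq: "{y \<in> V. arc E F x y} = {y \<in> V. arc E F' x y}"
      show "F = F'" by (rule fibre_eqI[OF G \<E>(2) \<E>E FF]) (use eq in auto)
    qed
  qed (use fin in \<open>auto simp: arc_def\<close>)
  also have "\<dots> = 2 ^ card ?N" using fin by (simp add: card_Pow)
  finally have "real (card \<E>) \<le> real (2 ^ card ?N)" by (simp only: of_nat_le_iff)
  also have "\<dots> = 2 powr (card ?N)" by (simp add: powr_realpow)
  finally have le: "real (card \<E>) \<le> 2 powr (card ?N)" .
  have "2 powr (\<beta> * card V - 2 - K) \<le> card \<E>" using big by simp
  from order_trans[OF this le] have "2 powr (\<beta> * card V - 2 - K) \<le> 2 powr (card ?N)" .
  then show ?thesis by simp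
qed

text \<open>Each member has a class and a direction in which \<open>x\<close> has fewer than
  \<open>d\<close> arcs, and there are two such classes. Two classes with almost no freedom cut the
  fibre to the rate n - 2 m, whereas a fibre over one vertex needs \<beta> n.\<close>

lemma card_fibre_large_degrees_le:
  assumes rich: "rich_parts V E P d" and d: "d \<ge> 1" and x: "x \<in> V"
    and \<E>: "\<E> \<subseteq> {F \<in> hfree V E. univ VH AH p P E d F}" "agree_off E {x} \<E>"
    and deg: "\<And>i. i < p \<Longrightarrow> 2 * d \<le> card {y \<in> P i. {x, y} \<in> E}"
    and m: "\<And>j. j < p \<Longrightarrow> m \<le> card (P j)"
  shows "card \<E> \<le> 4 * p ^ 2 * (2 ^ (card V - 2 * m) * card {r. r \<subseteq> V \<and> card r < d} ^ 2)"
proof -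
  have G: "graph (V, E)" and part: "is_partition (V, E) p P" using rich unfolding rich_parts_def by auto
  have fin: "finite V" "finite E" using graph_finite[OF G] by auto
  have sub: "P j \<subseteq> V" if "j < p" for j by (rule partition_subset[OF part that])
  have fP: "finite (P j)" if "j < p" for j using finite_subset[OF sub[OF that] fin(1)] .
  have \<E>E: "\<E> \<subseteq> Pow E" using \<E>(1) unfolding hfree_def by auto
  have f\<E>: "finite \<E>" using \<E>E fin by (auto intro: finite_subset)
  define T where "T F j \<sigma> = {y \<in> P j. if \<sigma> then arc E F x y else arc E F y x}" for F j \<sigma>
  have step: "\<exists>j \<sigma>. j < p \<and> j \<noteq> i \<and> card (T F j \<sigma>) < d" if FE: "F \<in> \<E>" and ip: "i < p" for F i
  proof -
    have F: "univ VH AH p P E d F" "\<not> emb V E F VH AH" using FE \<E>(1) unfolding hfree_def by auto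
    obtain j where j: "j < p" "j \<noteq> i" "card {y \<in> P j. arc E F x y} < d \<or> card {y \<in> P j. arc E F y x} < d"
      using vertex_with_large_degrees[OF rich d F x ip deg[OF ip]] by auto
    from j(3) show ?thesis
    proof
      assume "card {y \<in> P j. arc E F x y} < d"
      then show ?thesis using j(1,2) by (intro exI[of _ j] exI[of _ True]) (simp add: T_def)
    next
      assume "card {y \<in> P j. arc E F y x} < d"
      then show ?thesis using j(1,2) by (intro exI[of _ j] exI[of _ False]) (simp add: T_def)
    qed
  qed
  let ?C = "({..<p} \<times> (UNIV :: bool set)) \<times> ({..<p} \<times> (UNIV :: bool set))"
  have "\<exists>t. t \<in> ?C \<and> fst (fst t) \<noteq> fst (snd t) \<and> card (T F (fst (fst t)) (snd (fst t))) < d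
      \<and> card (T F (fst (snd t)) (snd (snd t))) < d" if F: "F \<in> \<E>" for F
  proof -
    \<comment> \<open>The first application may start from any class; the second starts from the
      class \<open>j\<close> just found, which makes the two classes distinct.\<close>
    obtain j \<sigma> where j: "j < p" "card (T F j \<sigma>) < d" using step[OF F, of 0] p2 by auto
    obtain j' \<sigma>' where j': "j' < p" "j' \<noteq> j" "card (T F j' \<sigma>') < d" using step[OF F j(1)] by auto
    show ?thesis by (rule exI[of _ "((j, \<sigma>), (j', \<sigma>'))"]) (use j j' in auto)
  qed
  then have "\<exists>t. \<forall>F\<in>\<E>. t F \<in> ?C \<and> fst (fst (t F)) \<noteq> fst (snd (t F)) \<and> card (T F (fst (fst (t F))) (snd (fst (t F)))) < d
      \<and> card (T F (fst (snd (t F))) (snd (snd (t F)))) < d"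
    by (intro bchoice) blast
  then obtain t where t: "\<And>F. F \<in> \<E> \<Longrightarrow> t F \<in> ?C" "\<And>F. F \<in> \<E> \<Longrightarrow> fst (fst (t F)) \<noteq> fst (snd (t F))"
    "\<And>F. F \<in> \<E> \<Longrightarrow> card (T F (fst (fst (t F))) (snd (fst (t F)))) < d"
    "\<And>F. F \<in> \<E> \<Longrightarrow> card (T F (fst (snd (t F))) (snd (snd (t F)))) < d" by blast
  have C0: "?C \<noteq> {}" using p2 by (auto simp: lessThan_empty_iff)
  have tC: "t ` \<E> \<subseteq> ?C" using t(1) by blast
  have fC: "finite ?C" by simp
  obtain y where y: "y \<in> ?C" "card \<E> \<le> card ?C * card {F \<in> \<E>. t F = y}"
    using pigeonhole_fibre[OF f\<E> fC tC C0] by blast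
  obtain j \<sigma> j' \<sigma>' where yj: "y = ((j, \<sigma>), (j', \<sigma>'))" by (metis surj_pair)
  have jp: "j < p" "j' < p" using y(1) unfolding yj by auto
  let ?\<E> = "{F \<in> \<E>. t F = y}"
  let ?L = "{r. r \<subseteq> V \<and> card r < d}"
  show ?thesis
  proof (cases "?\<E> = {}")
    case True
    then have "card ?\<E> = 0" by (simp only: card.empty)
    then show ?thesis using y(2) by simp
  next
    case False
    have jj: "j \<noteq> j'" using False t(2) unfolding yj by force
    have small: "card (T F j \<sigma>) < d" "card (T F j' \<sigma>') < d" if "F \<in> ?\<E>" for F
      using t(3,4)[of F] that unfolding yj by auto
    let ?R = "V - P j - P j'"
    have "card ?\<E> \<le> card (Pow ?R \<times> (?L \<times> ?L))"
    proof (rule card_inj_on_le)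
      let ?f = "\<lambda>F. ({y \<in> ?R. arc E F x y}, T F j \<sigma>, T F j' \<sigma>')"
      show "inj_on ?f ?\<E>"
      proof (rule inj_onI)
        fix F F' assume FF: "F \<in> ?\<E>" "F' \<in> ?\<E>" and eq: "?f F = ?f F'"
        have FE: "F \<in> \<E>" "F' \<in> \<E>" using FF by auto
        show "F = F'"
        proof (rule fibre_eqI[OF G \<E>(2) \<E>E FE])
          fix z w assume z: "z \<in> {x}" and w: "w \<in> V - {x}" and zw: "{z, w} \<in> E"
          have e: "{x, w} \<in> E" "x \<noteq> w" using z w zw by auto
          \<comment> \<open>For an edge at \<open>x\<close> either direction determines the other,
            so the sparse direction alone recovers all arcs between \<open>x\<close> and the
            class.\<close>
          have T: "arc E F x w \<longleftrightarrow> arc E F' x w" if "w \<in> P k" "T F k \<tau> = T F' k \<tau>" for k \<tau>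
          proof -
            have "w \<in> T F k \<tau> \<longleftrightarrow> w \<in> T F' k \<tau>" using that(2) by simp
            then show ?thesis using that(1) arc_flip[OF e] unfolding T_def by (cases \<tau>) auto
          qed
          consider "w \<in> ?R" | "w \<in> P j" | "w \<in> P j'" using w by auto
          then have "arc E F x w \<longleftrightarrow> arc E F' x w"
          proof cases
            case 1
            then show ?thesis using eq by auto
          next
            case 2
            then show ?thesis using T[of j \<sigma>] eq by auto
          next
            case 3
            then show ?thesis using T[of j' \<sigma>'] eq by auto
          qed
          then show "arc E F z w \<longleftrightarrow> arc E F' z w" using z by simp
        qed
      qed
      show "?f ` ?\<E> \<subseteq> Pow ?R \<times> (?L \<times> ?L)"
      proof
        fix r assume "r \<in> ?f ` ?\<E>"
        then obtain F where F: "F \<in> ?\<E>" "r = ?f F" by auto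
        have "T F k \<tau> \<subseteq> V" if "k < p" for k \<tau> using sub[OF that] unfolding T_def by auto
        then show "r \<in> Pow ?R \<times> (?L \<times> ?L)" using small[OF F(1)] jp unfolding F(2) by auto
      qed
      show "finite (Pow ?R \<times> (?L \<times> ?L))" using fin by simp
    qed
    also have "\<dots> = 2 ^ card ?R * card ?L ^ 2"
      using fin by (simp add: card_cartesian_product card_Pow power2_eq_square)
    also have "\<dots> \<le> 2 ^ (card V - 2 * m) * card ?L ^ 2"
    proof -
      have "P j \<inter> P j' = {}" using part jp jj unfolding is_partition_def by auto
      then have "P j' \<subseteq> V - P j" using sub[OF jp(2)] by auto
      then have "card ?R = card V - card (P j) - card (P j')"
        using fP[OF jp(1)] fP[OF jp(2)] sub[OF jp(1)] by (simp add: card_Diff_subset)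
      then have "card ?R \<le> card V - 2 * m" using m[OF jp(1)] m[OF jp(2)] by linarith
      then show ?thesis by (intro mult_right_mono power_increasing) auto
    qed
    finally have "card ?\<E> \<le> 2 ^ (card V - 2 * m) * card ?L ^ 2" .
    then have "card \<E> \<le> card ?C * (2 ^ (card V - 2 * m) * card ?L ^ 2)" using y(2) by (meson le_trans mult_le_mono2)
    moreover have "card ?C = 4 * p ^ 2" by (simp add: card_cartesian_product power2_eq_square)
    ultimately show ?thesis by simp
  qed
qed

text \<open>In each member some pattern \<pi> on \<open>S\<close> is rare at the common neighbours
  in some class j. After j and \<pi> are fixed by pigeonhole, each common neighbour, up to fewer
  than \<open>d\<close> exceptions, loses one of its 2^s patterns, which gives the exponentially
  small last factor. All other cross edges are counted as free.\<close>

lemma card_fibre_forcing_le: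
  assumes rich: "rich_parts V E P d"
    and \<E>: "\<E> \<subseteq> {F \<in> hfree V E. univ VH AH p P E d F}" "agree_off E S \<E>"
    and i: "i < p" and S: "S \<subseteq> P i" "card S \<le> card VH" "forcing E S"
    and deg: "\<And>x. x \<in> S \<Longrightarrow> card {y \<in> P i. {x, y} \<in> E} \<le> k"
  shows "\<exists>j<p. j \<noteq> i \<and> real (card \<E>) \<le> p * 2 ^ card S *
     (2 powr (card S * (real k + card V - card (P i)) + d) *
      (1 - 1 / 2 ^ (card S + 1)) ^ card {w \<in> P j. \<forall>x\<in>S. {x, w} \<in> E})"
proof -
  have G: "graph (V, E)" and part: "is_partition (V, E) p P" using rich unfolding rich_parts_def by auto
  have fin: "finite V" "finite E" using graph_finite[OF G] by auto
  have sub: "P j \<subseteq> V" if "j < p" for j by (rule partition_subset[OF part that])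
  have fP: "finite (P j)" if "j < p" for j using finite_subset[OF sub[OF that] fin(1)] .
  have SV: "S \<subseteq> V" using S(1) sub[OF i] by auto
  have fS: "finite S" using finite_subset[OF SV fin(1)] .
  let ?s = "card S"
  have \<E>E: "\<E> \<subseteq> Pow E" using \<E>(1) unfolding hfree_def by auto
  have f\<E>: "finite \<E>" using \<E>E fin by (auto intro: finite_subset)
  define W where "W j = {w \<in> P j. \<forall>x\<in>S. {x, w} \<in> E}" for j
  define ro where "ro F w = {x \<in> S. arc E F x w}" for F w
  let ?C = "({..<p} - {i}) \<times> Pow S"
  have "\<exists>t. t \<in> ?C \<and> card {w \<in> W (fst t). ro F w = snd t} < d" if F: "F \<in> \<E>" for F
  proof -
    have F': "univ VH AH p P E d F" "\<not> emb V E F VH AH" "F \<subseteq> E" using F \<E>(1) unfolding hfree_def by auto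
    obtain j \<pi> where j: "j < p" "j \<noteq> i" "\<pi> \<subseteq> S"
      "card {w \<in> P j. (\<forall>x\<in>S. {x, w} \<in> E) \<and> {x \<in> S. arc E F x w} = \<pi>} < d"
      using forcing_set_pattern_rare[OF rich F'(1,3,2) i S] by auto
    have "{w \<in> W j. ro F w = \<pi>} = {w \<in> P j. (\<forall>x\<in>S. {x, w} \<in> E) \<and> {x \<in> S. arc E F x w} = \<pi>}"
      unfolding W_def ro_def by auto
    then show ?thesis using j by (intro exI[of _ "(j, \<pi>)"]) auto
  qed
  then have "\<exists>t. \<forall>F\<in>\<E>. t F \<in> ?C \<and> card {w \<in> W (fst (t F)). ro F w = snd (t F)} < d"
    by (intro bchoice) blast
  then obtain t where t: "\<And>F. F \<in> \<E> \<Longrightarrow> t F \<in> ?C"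
    "\<And>F. F \<in> \<E> \<Longrightarrow> card {w \<in> W (fst (t F)). ro F w = snd (t F)} < d" by blast
  have C0: "?C \<noteq> {}"
  proof -
    have "(if i = 0 then 1 else 0) \<in> {..<p} - {i}" using p2 by auto
    then show ?thesis by auto
  qed
  have tC: "t ` \<E> \<subseteq> ?C" using t(1) by blast
  have fC: "finite ?C" using fS by simp
  obtain y where y: "y \<in> ?C" "card \<E> \<le> card ?C * card {F \<in> \<E>. t F = y}"
    using pigeonhole_fibre[OF f\<E> fC tC C0] by blast
  obtain j \<pi> where yj: "y = (j, \<pi>)" by force
  have j: "j < p" "j \<noteq> i" "\<pi> \<subseteq> S" using y(1) unfolding yj by auto
  have disj: "P j \<inter> P i = {}" using part j i unfolding is_partition_def by auto
  have WP: "W j \<subseteq> P j" unfolding W_def by auto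
  have fW: "finite (W j)" using finite_subset[OF WP fP[OF j(1)]] .
  let ?w = "card (W j)"
  let ?\<E> = "{F \<in> \<E>. t F = y}"
  define C' where "C' = {e \<in> cross_edges E S. e \<inter> W j = {}}"
  define H where "H = {g \<in> PiE (W j) (\<lambda>_. Pow S). ?w - d \<le> card {v \<in> W j. g v \<in> Pow S - {\<pi>}}}"
  have fC': "finite C'" unfolding C'_def cross_edges_def using fin by simp
  have fH: "finite H" unfolding H_def using fW fS by (auto intro!: finite_subset[OF _ finite_PiE[of "W j" "\<lambda>_. Pow S"]])
  have "card ?\<E> \<le> card (Pow C' \<times> H)"
  proof (rule card_inj_on_le)
    let ?f = "\<lambda>F. (F \<inter> C', restrict (ro F) (W j))"
    show "inj_on ?f ?\<E>"
    proof (rule inj_onI)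
      fix F F' assume FF: "F \<in> ?\<E>" "F' \<in> ?\<E>" and eq: "?f F = ?f F'"
      have FE: "F \<in> \<E>" "F' \<in> \<E>" using FF by auto
      show "F = F'"
      proof (rule fibre_eqI[OF G \<E>(2) \<E>E FE])
        fix z w assume z: "z \<in> S" and w: "w \<in> V - S" and zw: "{z, w} \<in> E"
        show "arc E F z w \<longleftrightarrow> arc E F' z w"
        proof (cases "w \<in> W j")
          case True
          have "restrict (ro F) (W j) w = restrict (ro F') (W j) w" using eq by simp
          then have "ro F w = ro F' w" using True by simp
          then show ?thesis using z unfolding ro_def by auto
        next
          case False
          have "z \<notin> W j" using z S(1) disj WP by auto
          then have "{z, w} \<in> C'" using False z w zw unfolding C'_def cross_edges_def by auto
          moreover have "F \<inter> C' = F' \<inter> C'" using eq by simp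
          ultimately show ?thesis unfolding arc_def by blast
        qed
      qed
    qed
    show "?f ` ?\<E> \<subseteq> Pow C' \<times> H"
    proof
      fix r assume "r \<in> ?f ` ?\<E>"
      then obtain F where F: "F \<in> ?\<E>" "r = ?f F" by auto
      let ?g = "restrict (ro F) (W j)"
      have rS: "ro F w \<subseteq> S" for w unfolding ro_def by auto
      have "card {w \<in> W j. ro F w = \<pi>} < d" using t(2)[of F] F(1) unfolding yj by auto
      moreover have "{v \<in> W j. ?g v \<in> Pow S - {\<pi>}} = W j - {w \<in> W j. ro F w = \<pi>}" using rS by auto
      then have "card {v \<in> W j. ?g v \<in> Pow S - {\<pi>}} = ?w - card {w \<in> W j. ro F w = \<pi>}"
        using fW by (simp add: card_Diff_subset)
      ultimately have "?w - d \<le> card {v \<in> W j. ?g v \<in> Pow S - {\<pi>}}" by linarith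
      moreover have "?g \<in> PiE (W j) (\<lambda>_. Pow S)" using rS by auto
      ultimately have "?g \<in> H" unfolding H_def by (intro CollectI conjI)
      then show "r \<in> Pow C' \<times> H" unfolding F(2) by auto
    qed
    show "finite (Pow C' \<times> H)" using fC' fH by simp
  qed
  then have c1: "card ?\<E> \<le> 2 ^ card C' * card H" using fC' by (simp add: card_cartesian_product card_Pow)
  have wle: "card (P i) + ?w \<le> card V"
  proof -
    have "card (P i \<union> W j) \<le> card V" by (rule card_mono) (use fin sub[OF i] sub[OF j(1)] WP in auto)
    moreover have "card (P i \<union> W j) = card (P i) + ?w"
      by (rule card_Un_disjoint) (use fP[OF i] fW WP disj in auto)
    ultimately show ?thesis by simp
  qed
  have "card C' \<le> ?s * (k + (card V - card (P i) - ?w))"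
  proof -
    have "C' \<subseteq> (\<Union>x\<in>S. (\<lambda>y. {x, y}) ` ({y \<in> P i. {x, y} \<in> E} \<union> (V - P i - W j)))"
    proof
      fix e assume e: "e \<in> C'"
      then have "e \<in> cross_edges E S" unfolding C'_def by simp
      then obtain x w where xw: "x \<in> S" "w \<in> V - S" "e = {x, w}" by (rule cross_edgesE[OF G])
      have "{x, w} \<in> E" "w \<notin> W j" using e xw(3) unfolding C'_def cross_edges_def by auto
      then have "w \<in> {y \<in> P i. {x, y} \<in> E} \<union> (V - P i - W j)" using xw(2) by auto
      then show "e \<in> (\<Union>x\<in>S. (\<lambda>y. {x, y}) ` ({y \<in> P i. {x, y} \<in> E} \<union> (V - P i - W j)))"
        using xw by blast
    qed
    then have "card C' \<le> card (\<Union>x\<in>S. (\<lambda>y. {x, y}) ` ({y \<in> P i. {x, y} \<in> E} \<union> (V - P i - W j)))"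
      by (rule card_mono[rotated]) (use fS fin fP[OF i] in auto)
    also have "\<dots> \<le> (\<Sum>x\<in>S. card ((\<lambda>y. {x, y}) ` ({y \<in> P i. {x, y} \<in> E} \<union> (V - P i - W j))))"
      by (rule card_UN_le[OF fS])
    also have "\<dots> \<le> (\<Sum>x\<in>S. k + (card V - card (P i) - ?w))"
    proof (rule sum_mono)
      fix x assume x: "x \<in> S"
      have "card ((\<lambda>y. {x, y}) ` ({y \<in> P i. {x, y} \<in> E} \<union> (V - P i - W j))) \<le> card ({y \<in> P i. {x, y} \<in> E} \<union> (V - P i - W j))"
        by (rule card_image_le) (use fin fP[OF i] in auto)
      also have "\<dots> \<le> card {y \<in> P i. {x, y} \<in> E} + card (V - P i - W j)" by (rule card_Un_le)
      also have "card (V - P i - W j) = card V - card (P i) - ?w"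
      proof -
        have "W j \<subseteq> V - P i" using WP sub[OF j(1)] disj by auto
        then show ?thesis using fP[OF i] fW sub[OF i] by (simp add: card_Diff_subset)
      qed
      finally show "card ((\<lambda>y. {x, y}) ` ({y \<in> P i. {x, y} \<in> E} \<union> (V - P i - W j))) \<le> k + (card V - card (P i) - ?w)"
        using deg[OF x] by linarith
    qed
    finally show ?thesis by simp
  qed
  then have "real (card C') \<le> real (?s * (k + (card V - card (P i) - ?w)))" by (simp only: of_nat_le_iff)
  also have "\<dots> = ?s * (real k + card V - card (P i) - ?w)"
  proof -
    have "real (k + (card V - card (P i) - ?w)) = real k + card V - card (P i) - ?w" using wle by linarith
    then show ?thesis by (simp only: of_nat_mult)
  qed
  finally have c2: "real (card C') \<le> ?s * (real k + card V - card (P i) - ?w)" .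
  let ?q = "1 - 1 / 2 ^ (?s + 1) :: real"
  have "(1::real) / 2 ^ (?s + 1) \<le> 1 / 1" by (intro divide_left_mono one_le_power) auto
  then have q0: "0 \<le> ?q" by simp
  have c3: "real (card H) \<le> 2 powr (?s * ?w + d) * ?q ^ ?w"
  proof -
    \<comment> \<open>Weight 2 on the values other than \<pi> gives 2^s + (2^s - 1) = 2^(s+1) - 1
      per vertex, whence the base 1 - 1 / 2^(s+1). Division by 2^(w - d) leaves the surplus
      2^d.\<close>
    have "real (card H) * 2 ^ (?w - d) \<le> (\<Prod>v\<in>W j. card (Pow S) + (2 - 1) * real (card (Pow S - {\<pi>})))"
      unfolding H_def by (rule card_PiE_hits_le) (use fW fS in auto)
    also have "\<dots> = (2 ^ (?s + 1) - 1) ^ ?w" using fS j(3) by (simp add: card_Pow of_nat_diff)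
    also have "(2::real) ^ (?s + 1) - 1 = 2 ^ (?s + 1) * ?q" by (simp add: field_simps)
    finally have *: "real (card H) * 2 ^ (?w - d) \<le> (2 ^ (?s + 1)) ^ ?w * ?q ^ ?w" by (simp only: power_mult_distrib)
    have "2 powr (real ?w - d) \<le> 2 powr (?w - d)" by (intro powr_mono) auto
    then have "real (card H) * 2 powr (real ?w - d) \<le> real (card H) * 2 ^ (?w - d)"
      by (intro mult_left_mono) (auto simp: powr_realpow)
    also note *
    also have "((2::real) ^ (?s + 1)) ^ ?w = 2 powr (?s * ?w + d) * 2 powr (real ?w - d)"
    proof -
      have "((2::real) ^ (?s + 1)) ^ ?w = 2 ^ ((?s + 1) * ?w)" by (simp only: power_mult)
      also have "\<dots> = 2 powr real ((?s + 1) * ?w)" by (rule powr_realpow[symmetric]) simp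
      also have "real ((?s + 1) * ?w) = (?s * ?w + d) + (real ?w - d)" by (simp add: algebra_simps)
      finally show ?thesis by (simp only: powr_add)
    qed
    finally have "2 powr (real ?w - d) * card H \<le> 2 powr (real ?w - d) * (2 powr (?s * ?w + d) * ?q ^ ?w)"
      by (simp only: mult_ac)
    then show ?thesis by (simp only: mult_le_cancel_left_pos powr_gt_zero)
  qed
  have "real (card ?\<E>) \<le> real (2 ^ card C' * card H)" using c1 by (simp only: of_nat_le_iff)
  also have "\<dots> = 2 powr (card C') * card H" by (simp add: powr_realpow)
  also have "\<dots> \<le> 2 powr (?s * (real k + card V - card (P i) - ?w)) * (2 powr (?s * ?w + d) * ?q ^ ?w)"
    using c2 c3 by (intro mult_mono) auto
  also have "\<dots> = 2 powr (?s * (real k + card V - card (P i)) + d) * ?q ^ ?w"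
    unfolding mult.assoc[symmetric] powr_add[symmetric] by (simp add: algebra_simps)
  finally have c4: "real (card ?\<E>) \<le> 2 powr (?s * (real k + card V - card (P i)) + d) * ?q ^ ?w" .
  have "card ?C \<le> p * 2 ^ ?s"
    using i fS by (simp add: card_cartesian_product card_Pow)
  then have "real (card ?C) \<le> real (p * 2 ^ ?s)" by (simp only: of_nat_le_iff)
  then have c5: "real (card ?C) \<le> p * 2 ^ ?s" by simp
  have "real (card \<E>) \<le> real (card ?C * card ?\<E>)" using y(2) by (simp only: of_nat_le_iff)
  also have "\<dots> = real (card ?C) * card ?\<E>" by simp
  also have "\<dots> \<le> p * 2 ^ ?s * (2 powr (?s * (real k + card V - card (P i)) + d) * ?q ^ ?w)"
    using c4 c5 by (intro mult_mono) auto
  finally show ?thesis using j(1,2) unfolding W_def by (intro exI[of _ j]) simp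
qed

end

section \<open>Class sizes, missing cross pairs and the structure of optimal partitions\<close>

lemma sum_squares_partition:
  assumes part: "is_partition (V, E) p P" and V: "finite V" and p: "p > 0"
  shows "(\<Sum>i<p. (real (card (P i)) - card V / p) ^ 2) = real (\<Sum>i<p. card (P i) ^ 2) - real (card V) ^ 2 / p"
proof -
  let ?n = "real (card V)"
  have s: "(\<Sum>i<p. real (card (P i))) = ?n"
    using sum_card_partition[OF part V] by (metis of_nat_sum)
  have "(\<Sum>i<p. (real (card (P i)) - ?n / p) ^ 2)
      = (\<Sum>i<p. real (card (P i)) ^ 2 - 2 * (?n / p) * real (card (P i)) + (?n / p) ^ 2)"
    by (intro sum.cong) (auto simp: power2_eq_square algebra_simps)
  also have "\<dots> = (\<Sum>i<p. real (card (P i)) ^ 2) - 2 * (?n / p) * ?n + p * (?n / p) ^ 2"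
  proof -
    have "(\<Sum>i<p. 2 * (?n / p) * real (card (P i))) = 2 * (?n / p) * ?n"
      by (simp only: sum_distrib_left[symmetric] s)
    then show ?thesis by (simp only: sum.distrib sum_subtractf) simp
  qed
  also have "\<dots> = (\<Sum>i<p. real (card (P i)) ^ 2) - ?n ^ 2 / p"
    using p by (simp add: power2_eq_square field_simps)
  finally show ?thesis by simp
qed

context oriented_pattern
begin

text \<open>\<open>D\<close> is at most 2^|E|, so its lower bound forces |E| \<ge> \<beta> n^2 / 2 -
  n. On the other hand 2 |E| is at most n^2 minus the sum of the squared class sizes minus the
  missing cross pairs, up to twice the cost. That sum is at least n^2 / p, so both the missing pairs
  and the deviation of the class sizes are small.\<close>

lemma near_turan_partition:
  assumes ext: "extremal V E" and part: "is_partition (V, E) p P"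
    and cost: "real (part_cost (V, E) p P) \<le> \<eta> * real (card V) ^ 2"
    and C: "C = {(u, v). \<exists>i<p. \<exists>j<p. i \<noteq> j \<and> u \<in> P i \<and> v \<in> P j}"
  shows "card {(u, v) \<in> C. {u, v} \<notin> E} \<le> 2 * real (card V) + 2 * \<eta> * real (card V) ^ 2"
    and "(\<Sum>i<p. (real (card (P i)) - card V / p) ^ 2) \<le> 2 * real (card V) + 2 * \<eta> * real (card V) ^ 2"
    and "real (card E) \<le> \<beta> * real (card V) ^ 2 / 2 + \<eta> * real (card V) ^ 2"
proof -
  let ?n = "real (card V)"
  have G: "graph (V, E)" using ext unfolding extremal_def by simp
  have fin: "finite V" "finite E" using graph_finite[OF G] by auto
  have p0: "p > 0" using p2 by simp
  note cp = cross_pairs[OF G part, folded C]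
  let ?A = "{(u, v) \<in> C. {u, v} \<in> E}" and ?B = "{(u, v) \<in> C. {u, v} \<notin> E}"
  have fAB: "finite ?A" "finite ?B" using cp(1) by (auto intro: rev_finite_subset)
  have "card (?A \<union> ?B) = card ?A + card ?B" by (rule card_Un_disjoint) (use fAB in auto)
  moreover have "?A \<union> ?B = C" by auto
  ultimately have AB: "card C = card ?A + card ?B" by simp
  let ?Q = "(\<Sum>i<p. card (P i) ^ 2)"
  have "real (card C) + real ?Q = real (card C + ?Q)" by (simp only: of_nat_add)
  also have "\<dots> = ?n ^ 2" unfolding cp(2) by simp
  finally have CQ: "real (card C) + real ?Q = ?n ^ 2" .
  have dev: "(\<Sum>i<p. (real (card (P i)) - card V / p) ^ 2) = real ?Q - ?n ^ 2 / p"
    by (rule sum_squares_partition[OF part fin(1) p0])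
  have "0 \<le> (\<Sum>i<p. (real (card (P i)) - card V / p) ^ 2)" by (rule sum_nonneg) simp
  then have Q0: "?n ^ 2 / p \<le> real ?Q" using dev by linarith
  have "\<beta> * ?n ^ 2 = ?n ^ 2 - ?n ^ 2 / p" unfolding \<beta>_def by (simp add: left_diff_distrib)
  then have \<beta>n: "\<beta> * ?n ^ 2 = ?n ^ 2 - ?n ^ 2 / p" .
  have "real (2 * card E) \<le> real (card ?A + 2 * part_cost (V, E) p P)" using cp(3) by (simp only: of_nat_le_iff)
  then have E2: "2 * real (card E) \<le> real (card ?A) + 2 * (\<eta> * ?n ^ 2)" using cost by simp
  have "2 powr (\<beta> * ?n ^ 2 / 2 - ?n) \<le> D (card V)" using D_lower[of "card V"] unfolding \<beta>_def .
  also have "real (D (card V)) \<le> 2 powr (card E)"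
  proof -
    have "card (hfree V E) \<le> card (Pow E)" by (rule card_mono) (use fin in \<open>auto simp: hfree_def\<close>)
    then have "D (card V) \<le> 2 ^ card E" using ext fin unfolding extremal_def by (simp add: card_Pow)
    then have "real (D (card V)) \<le> real (2 ^ card E)" by (simp only: of_nat_le_iff)
    then show ?thesis by (simp add: powr_realpow)
  qed
  finally have E1: "\<beta> * ?n ^ 2 / 2 - ?n \<le> card E" by simp
  have ABr: "real (card C) = real (card ?A) + real (card ?B)" using AB by simp
  have two\<eta>: "2 * \<eta> * ?n ^ 2 = 2 * (\<eta> * ?n ^ 2)" by simp
  show "real (card ?B) \<le> 2 * ?n + 2 * \<eta> * ?n ^ 2" unfolding two\<eta> using E1 E2 ABr CQ Q0 \<beta>n by linarith
  show "(\<Sum>i<p. (real (card (P i)) - card V / p) ^ 2) \<le> 2 * ?n + 2 * \<eta> * ?n ^ 2"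
    unfolding two\<eta> dev using E1 E2 ABr CQ \<beta>n by linarith
  show "real (card E) \<le> \<beta> * ?n ^ 2 / 2 + \<eta> * ?n ^ 2" using E2 ABr CQ Q0 \<beta>n by linarith
qed

text \<open>At least half of the pattern-free orientations are universal for the optimal classes, as
  few cross pairs are missing. A vertex with large degree into every class would have too small a
  fibre, so each vertex has few neighbours in some class and, by optimality, in its own. The degree
  bound then makes it adjacent to almost all of every other class; hence a forcing set has many
  common neighbours there, and its fibre would again be too small.\<close>

lemma optimal_structure:
  "\<exists>s0 n0. \<forall>V E P. n0 \<le> card V \<longrightarrow> good s0 (card V) \<longrightarrow> extremal V E \<longrightarrow> optimal_partition (V, E) p P \<longrightarrow>
     (\<forall>i<p. real (card V) / (2 * p) \<le> card (P i)) \<and>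
     (\<forall>i<p. \<forall>S\<subseteq>P i. S \<noteq> {} \<longrightarrow> card S \<le> card VH \<longrightarrow> \<not> forcing E S)"
proof -
  define q where "q = card VH"
  have p1: "1 \<le> p" and p0: "real p > 0" using p2 by auto
  obtain z where "z \<in> VH" using star_colourings(1)[of 0] p2 by auto
  then have q1: "1 \<le> q" unfolding q_def using finite_VH by (auto simp: Suc_le_eq card_gt_0_iff)
  define g where "g = - log 2 (1 - 1 / 2 ^ (q + 1) :: real)"
  have q2: "(1::real) < 2 ^ (q + 1)" by (rule one_less_power) auto
  then have g01: "(0::real) < 1 - 1 / 2 ^ (q + 1)" "(1::real) - 1 / 2 ^ (q + 1) < 1" by (auto simp: divide_less_eq)
  have g: "g > 0" unfolding g_def using g01 by simp
  \<comment> \<open>Chosen so that (q + 1) \<epsilon> n is at most both X / 16 and g X / 16 for X =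
    n / p. The losses below are small multiples of it, the gains are of order X and g X.\<close>
  define \<epsilon> where "\<epsilon> = min 1 g / (16 * real p * (real q + 1))"
  have den: "16 * real p * (real q + 1) > 0" using p0 by simp
  have \<epsilon>: "\<epsilon> > 0" unfolding \<epsilon>_def by (rule divide_pos_pos[OF _ den]) (use g in simp)
  have \<epsilon>1: "(real q + 1) * (\<epsilon> * x) \<le> x / p / 16" and \<epsilon>g: "(real q + 1) * (\<epsilon> * x) \<le> g * (x / p) / 16" if "x \<ge> 0" for x :: real
  proof -
    have "(real q + 1) * (\<epsilon> * x) = (real q + 1) / (real q + 1) * (min 1 g * (x / p) / 16)" unfolding \<epsilon>_def by simp
    then have eq: "(real q + 1) * (\<epsilon> * x) = min 1 g * (x / p) / 16" by simp
    have "0 \<le> x / p" using that p0 by simp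
    then have "min 1 g * (x / p) \<le> 1 * (x / p)" "min 1 g * (x / p) \<le> g * (x / p)" by (intro mult_right_mono; simp)+
    then show "(real q + 1) * (\<epsilon> * x) \<le> x / p / 16" "(real q + 1) * (\<epsilon> * x) \<le> g * (x / p) / 16" unfolding eq by simp_all
  qed
  obtain \<delta>0 :: real where \<delta>0: "\<delta>0 > 0" "\<delta>0 \<le> 1" and small0: "\<And>A :: nat set. finite A \<Longrightarrow>
      card {r. r \<subseteq> A \<and> real (card r) < \<delta>0 * card A} \<le> 2 powr (\<epsilon> * card A)"
    using card_small_subsets_le[OF \<epsilon>] by blast
  define \<delta> where "\<delta> = min \<delta>0 \<epsilon>"
  have \<delta>: "\<delta> > 0" "\<delta> \<le> \<epsilon>" "\<delta> \<le> \<delta>0" unfolding \<delta>_def using \<delta>0 \<epsilon> by auto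
  have AH2: "\<forall>x y. (x, y) \<in> AH \<longrightarrow> (y, x) \<notin> AH" using AH(2) by blast
  obtain \<alpha> :: real and n1 :: nat where \<alpha>: "\<alpha> > 0" and small: "\<forall>V P E Ms. n1 \<le> card V \<longrightarrow> finite V \<longrightarrow> (\<forall>i<p. P i \<subseteq> V) \<longrightarrow> finite E \<longrightarrow>
    (\<forall>i<p. \<forall>j<p. i \<noteq> j \<longrightarrow> (\<forall>u\<in>P i. \<forall>v\<in>P j. {u, v} \<notin> E \<longrightarrow> (u, v) \<in> Ms)) \<longrightarrow>
    finite Ms \<longrightarrow> real (card Ms) \<le> \<alpha> * real (card V) ^ 2 \<longrightarrow>
     real (card {F. F \<subseteq> E \<and> \<not> univ VH AH p P E (nat \<lceil>\<delta> * card V\<rceil>) F})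
       \<le> 2 ^ card E * 2 powr (- (\<alpha> * real (card V) ^ 2))"
    using card_not_univ_small[OF finite_VH AH(1) AH2 p1 \<delta>(1)] by (elim exE conjE)
  \<comment> \<open>The first bound keeps the missing cross pairs and the possible surplus of |E|
    below what universality tolerates; the second confines the class sizes to n / p up to \<epsilon>
    n.\<close>
  define \<eta> where "\<eta> = min (\<alpha> / 4) (\<epsilon> ^ 2 / 4)"
  have \<eta>: "\<eta> > 0" unfolding \<eta>_def using \<alpha> \<epsilon> by simp
  obtain s1 n2 where sparse: "\<And>V E. n2 \<le> card V \<Longrightarrow> good s1 (card V) \<Longrightarrow> extremal V E \<Longrightarrow>
    \<exists>P. is_partition (V, E) p P \<and> real (part_cost (V, E) p P) \<le> \<eta> * real (card V) ^ 2"
    using sparse_partition[OF \<eta>] by blast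
  have p2i: "1 / (2 * real p) > 0" and p4i: "1 / (4 * real p) > 0" and gp: "g / (4 * real p) > 0" and \<epsilon>2: "\<epsilon> ^ 2 > 0"
    using p0 g \<epsilon> by auto
  define c6 where "c6 = log 2 p + q + 2 * real q ^ 2 + \<bar>K\<bar> + 2 * q + 3"
  obtain t1 where t1: "\<forall>n\<ge>t1. 1 \<le> \<delta> * real n" using eventually_const_le_linear[OF \<delta>(1)] by blast
  obtain t2 where t2: "\<forall>n\<ge>t2. 4 \<le> \<alpha> * real n" using eventually_const_le_linear[OF \<alpha>] by blast
  obtain t3 where t3: "\<forall>n\<ge>t3. 4 \<le> \<epsilon> ^ 2 * real n" using eventually_const_le_linear[OF \<epsilon>2] by blast
  obtain t4 where t4: "\<forall>n\<ge>t4. log 2 (4 * real p ^ 2) + 4 + \<bar>K\<bar> \<le> 1 / (2 * real p) * real n"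
    using eventually_const_le_linear[OF p2i] by blast
  obtain t5 where t5: "\<forall>n\<ge>t5. real q * (4 + \<bar>K\<bar>) \<le> 1 / (4 * real p) * real n"
    using eventually_const_le_linear[OF p4i] by blast
  obtain t6 where t6: "\<forall>n\<ge>t6. c6 \<le> g / (4 * real p) * real n" using eventually_const_le_linear[OF gp] by blast
  let ?n0 = "max (max (max n1 n2) (max t1 t2)) (max (max t3 t4) (max (max t5 t6) 1))"
  have "(\<forall>i<p. real (card V) / (2 * p) \<le> card (P i)) \<and>
     (\<forall>i<p. \<forall>S\<subseteq>P i. S \<noteq> {} \<longrightarrow> card S \<le> card VH \<longrightarrow> \<not> forcing E S)"
    if n: "?n0 \<le> card V" and good: "good (max s1 q) (card V)" and ext: "extremal V E"
      and opt: "optimal_partition (V, E) p P" for V E P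
  proof -
    define n where "n = card V"
    have n_ge: "n1 \<le> n" "n2 \<le> n" "t1 \<le> n" "t2 \<le> n" "t3 \<le> n" "t4 \<le> n" "t5 \<le> n" "t6 \<le> n" "1 \<le> n"
      using n unfolding n_def by auto
    have nr: "real n \<ge> 1" using n_ge(9) by simp
    have G: "graph (V, E)" using ext unfolding extremal_def by simp
    have fin: "finite V" "finite E" using graph_finite[OF G] by auto
    have part: "is_partition (V, E) p P" using opt unfolding optimal_partition_def by simp
    have sub: "P j \<subseteq> V" if "j < p" for j by (rule partition_subset[OF part that])
    have fP: "finite (P j)" if "j < p" for j using finite_subset[OF sub[OF that] fin(1)] .
    have disj: "P i \<inter> P j = {}" if "i < p" "j < p" "i \<noteq> j" for i j
      using part that unfolding is_partition_def by auto
    have n2n: "n2 \<le> card V" using n_ge(2) unfolding n_def .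
    obtain P' where P': "is_partition (V, E) p P'" "real (part_cost (V, E) p P') \<le> \<eta> * real (card V) ^ 2"
      using sparse[OF n2n good_mono[OF good] ext] by auto
    have "part_cost (V, E) p P \<le> part_cost (V, E) p P'" using opt P'(1) unfolding optimal_partition_def by blast
    then have cost: "real (part_cost (V, E) p P) \<le> \<eta> * real (card V) ^ 2" using P'(2) by linarith
    define C where "C = {(u, v). \<exists>i<p. \<exists>j<p. i \<noteq> j \<and> u \<in> P i \<and> v \<in> P j}"
    note near = near_turan_partition[OF ext part cost C_def]
    have nn: "real n * real n = real n ^ 2" by (simp add: power2_eq_square)
    have a4: "4 * real n \<le> \<alpha> * real n ^ 2"
      using mult_right_mono[OF t2[rule_format, OF n_ge(4)], of "real n"] nn by (simp add: mult.assoc)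
    have e4: "4 * real n \<le> \<epsilon> ^ 2 * real n ^ 2"
      using mult_right_mono[OF t3[rule_format, OF n_ge(5)], of "real n"] nn by (simp add: mult.assoc)
    have "4 * \<eta> \<le> \<alpha>" "4 * \<eta> \<le> \<epsilon> ^ 2" unfolding \<eta>_def by linarith+
    from this[THEN mult_right_mono, of "real n ^ 2"]
    have \<eta>a: "4 * (\<eta> * real n ^ 2) \<le> \<alpha> * real n ^ 2" and \<eta>e: "4 * (\<eta> * real n ^ 2) \<le> \<epsilon> ^ 2 * real n ^ 2"
      by simp_all
    have size: "\<bar>real (card (P i)) - real n / p\<bar> \<le> \<epsilon> * n" if "i < p" for i
    proof -
      have "(real (card (P i)) - real n / p) ^ 2 \<le> (\<Sum>i<p. (real (card (P i)) - real n / p) ^ 2)"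
        by (rule member_le_sum) (use that in auto)
      also have "\<dots> \<le> 2 * real n + 2 * (\<eta> * real n ^ 2)" using near(2) unfolding n_def by simp
      also have "\<dots> \<le> \<epsilon> ^ 2 * real n ^ 2" using e4 \<eta>e by linarith
      finally have "(real (card (P i)) - real n / p) ^ 2 \<le> (\<epsilon> * n) ^ 2" by (simp add: power_mult_distrib)
      then have "\<bar>real (card (P i)) - real n / p\<bar> \<le> \<bar>\<epsilon> * n\<bar>" by (simp only: abs_le_square_iff)
      then show ?thesis using \<epsilon> by simp
    qed
    \<comment> \<open>With names for n / p, \<epsilon> n and q \<epsilon> n the remaining estimates
      become linear.\<close>
    define X where "X = real n / p"
    have X0: "X > 0" unfolding X_def using nr p0 by simp
    define En where "En = \<epsilon> * n"
    have En0: "En \<ge> 0" unfolding En_def using \<epsilon> by simp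
    define qE where "qE = q * En"
    have qE0: "qE \<ge> En" unfolding qE_def using q1 En0 mult_right_mono[of 1 "real q" En] by simp
    have qE1: "qE + En \<le> X / 16" using \<epsilon>1[of n] unfolding qE_def En_def X_def by (simp add: distrib_right)
    have qEg: "qE + En \<le> g * X / 16" using \<epsilon>g[of n] unfolding qE_def En_def X_def by (simp add: distrib_right)
    have size': "X - En \<le> card (P i)" "card (P i) \<le> X + En" if "i < p" for i
      using size[OF that] unfolding X_def En_def by linarith+
    have \<beta>n: "\<beta> * n = n - X" unfolding \<beta>_def X_def by (simp add: left_diff_distrib)
    have T5: "q * (4 + \<bar>K\<bar>) \<le> X / 4" using t5[rule_format, OF n_ge(7)] unfolding X_def by simp
    have q4: "real q * 4 \<le> q * (4 + \<bar>K\<bar>)" by (rule mult_left_mono) auto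
    define d where "d = nat \<lceil>\<delta> * n\<rceil>"
    have d1: "d \<ge> 1" using t1[rule_format, OF n_ge(3)] unfolding d_def by linarith
    have dE: "d \<le> En + 1"
    proof -
      have "\<delta> * n \<le> En" unfolding En_def using \<delta>(2) by (intro mult_right_mono) auto
      moreover have "0 \<le> \<delta> * n" using \<delta>(1) by simp
      ultimately show ?thesis unfolding d_def by linarith
    qed
    have rich: "rich_parts V E P d"
      unfolding rich_parts_def
    proof (intro conjI allI impI G part)
      fix j assume "j < p"
      then have "X - En \<le> card (P j)" by (rule size'(1))
      moreover have "real q \<ge> 1" using q1 by simp
      moreover have "real (d + card VH) = real d + real q" unfolding q_def by simp
      ultimately have "real (d + card VH) \<le> card (P j)"
        using dE qE0 qE1 T5 q4 X0 En0 by linarith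
      then show "d + card VH \<le> card (P j)" by simp
    qed
    let ?U = "{F. F \<subseteq> E \<and> \<not> univ VH AH p P E d F}"
    have bad: "real (card ?U) \<le> 2 ^ card E * 2 powr (- (\<alpha> * real n ^ 2))"
      unfolding d_def n_def
    proof (rule small[rule_format])
      show "n1 \<le> card V" using n_ge(1) unfolding n_def .
      show "(u, v) \<in> {(u, v) \<in> C. {u, v} \<notin> E}" if "i < p" "j < p" "i \<noteq> j" "u \<in> P i" "v \<in> P j" "{u, v} \<notin> E" for i j u v
        using that unfolding C_def by auto
      have "finite C" unfolding C_def by (rule cross_pairs(1)[OF G part])
      then show "finite {(u, v) \<in> C. {u, v} \<notin> E}" by (rule rev_finite_subset) auto
      have "2 * real n + 2 * \<eta> * real n ^ 2 \<le> \<alpha> * real n ^ 2" using a4 \<eta>a by simp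
      then show "real (card {(u, v) \<in> C. {u, v} \<notin> E}) \<le> \<alpha> * real (card V) ^ 2"
        using near(1) unfolding n_def by linarith
    qed (use fin sub in auto)
    \<comment> \<open>The bound on |E| allows a comparison with \<open>D n\<close>: the gain
      \<alpha> n^2 covers \<eta> n^2 + n + 1.\<close>
    also have "\<dots> \<le> 2 powr (\<beta> * real n ^ 2 / 2 + \<eta> * real n ^ 2) * 2 powr (- (\<alpha> * real n ^ 2))"
    proof (intro mult_right_mono)
      have "(2::real) ^ card E = 2 powr (card E)" by (simp add: powr_realpow)
      also have "\<dots> \<le> 2 powr (\<beta> * real n ^ 2 / 2 + \<eta> * real n ^ 2)" using near(3) unfolding n_def by (intro powr_mono) auto
      finally show "(2::real) ^ card E \<le> 2 powr (\<beta> * real n ^ 2 / 2 + \<eta> * real n ^ 2)" .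
    qed auto
    also have "\<dots> = 2 powr (\<beta> * real n ^ 2 / 2 + \<eta> * real n ^ 2 + - (\<alpha> * real n ^ 2))"
      by (simp only: powr_add)
    also have "\<dots> \<le> 2 powr (\<beta> * real n ^ 2 / 2 - n - 1)"
    proof (rule powr_mono)
      show "\<beta> * real n ^ 2 / 2 + \<eta> * real n ^ 2 + - (\<alpha> * real n ^ 2) \<le> \<beta> * real n ^ 2 / 2 - n - 1"
        using a4 \<eta>a nr by linarith
    qed simp
    also have "\<dots> = 2 powr (\<beta> * real n ^ 2 / 2 - n) / 2" by (simp add: powr_diff)
    also have "\<dots> \<le> D n / 2" using D_lower[of n] unfolding \<beta>_def by simp
    finally have bad': "real (card ?U) \<le> D n / 2" .
    define \<G> where "\<G> = {F \<in> hfree V E. univ VH AH p P E d F}"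
    have \<G>h: "\<G> \<subseteq> hfree V E" unfolding \<G>_def by auto
    have D\<G>: "D (card V) \<le> 2 * real (card \<G>)"
    proof -
      have "D n = card (hfree V E)" using ext unfolding extremal_def n_def by simp
      also have "\<dots> \<le> card (\<G> \<union> ?U)" by (rule card_mono) (use fin in \<open>auto simp: \<G>_def hfree_def\<close>)
      also have "\<dots> \<le> card \<G> + card ?U" by (rule card_Un_le)
      finally show ?thesis using bad' unfolding n_def by linarith
    qed
    have exceptional: "\<exists>j<p. card {y \<in> P j. {x, y} \<in> E} < 2 * d" if x: "x \<in> V" for x
    proof (rule ccontr)
      assume "\<not> ?thesis"
      then have deg: "2 * d \<le> card {y \<in> P i. {x, y} \<in> E}" if "i < p" for i using that not_less by blast
      obtain \<E> where \<E>: "\<E> \<subseteq> \<G>" "agree_off E {x} \<E>"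
        and big: "2 powr (\<beta> * card {x} * card V - 2 * real (card {x}) ^ 2 - K) / 2 \<le> card \<E>"
        by (rule ex_large_fibre[OF good ext, of "{x}" \<G> 2]) (use x q1 D\<G> \<G>h in auto)
      define m where "m = nat \<lceil>X - En\<rceil>"
      have m: "m \<le> card (P j)" if "j < p" for j using size'(1)[OF that] unfolding m_def by linarith
      have mr: "X - En \<le> m" unfolding m_def by linarith
      have np: "X \<le> real n / 2" unfolding X_def using p2 by (intro divide_left_mono) auto
      have "card \<E> \<le> 4 * p ^ 2 * (2 ^ (card V - 2 * m) * card {r. r \<subseteq> V \<and> card r < d} ^ 2)"
        by (rule card_fibre_large_degrees_le[OF rich d1 x _ \<E>(2) deg m]) (use \<E>(1) in \<open>auto simp: \<G>_def\<close>)
      then have "real (card \<E>) \<le> real (4 * p ^ 2 * (2 ^ (card V - 2 * m) * card {r. r \<subseteq> V \<and> card r < d} ^ 2))"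
        by (simp only: of_nat_le_iff)
      also have "\<dots> = 4 * real p ^ 2 * (2 powr (n - 2 * m) * real (card {r. r \<subseteq> V \<and> card r < d}) ^ 2)"
        unfolding n_def by (simp add: powr_realpow)
      also have "\<dots> \<le> 4 * real p ^ 2 * (2 powr (n - 2 * X + 2 * En) * (2 powr En) ^ 2)"
      proof (intro mult_left_mono mult_mono powr_mono power_mono)
        show "real (n - 2 * m) \<le> n - 2 * X + 2 * En"
        proof (cases "2 * m \<le> n")
          case True
          then show ?thesis using mr by (simp add: of_nat_diff)
        next
          case False
          then show ?thesis using np En0 by simp
        qed
        have "real (card {r. r \<subseteq> V \<and> card r < d}) \<le> real (card {r. r \<subseteq> V \<and> real (card r) < \<delta>0 * card V})"
        proof -
          have "\<delta> * real n \<le> \<delta>0 * n" using \<delta>(3) by (intro mult_right_mono) auto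
          then have "{r. r \<subseteq> V \<and> card r < d} \<subseteq> {r. r \<subseteq> V \<and> real (card r) < \<delta>0 * card V}"
            unfolding d_def ceil_less_iff n_def by auto
          then show ?thesis using fin by (simp add: card_mono)
        qed
        also have "\<dots> \<le> 2 powr En" using small0[OF fin(1)] unfolding En_def n_def .
        finally show "real (card {r. r \<subseteq> V \<and> card r < d}) \<le> 2 powr En" .
      qed auto
      also have "\<dots> = 2 powr (log 2 (4 * real p ^ 2) + (n - 2 * X + 2 * En + 2 * En))"
      proof -
        have "2 powr (log 2 (4 * real p ^ 2)) = 4 * real p ^ 2" using p0 by simp
        moreover have "(2 powr En) ^ 2 = 2 powr (2 * En)" by (simp add: powr_power)
        ultimately show ?thesis by (simp only: powr_add)
      qed
      finally have up: "real (card \<E>) \<le> 2 powr (log 2 (4 * real p ^ 2) + (n - 2 * X + 2 * En + 2 * En))" .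
      have "2 powr (\<beta> * n - 2 - K - 1) = 2 powr (\<beta> * card {x} * card V - 2 * real (card {x}) ^ 2 - K) / 2"
        by (simp add: powr_diff n_def)
      also note big
      also note up
      finally have "\<beta> * n - 2 - K - 1 \<le> log 2 (4 * real p ^ 2) + (n - 2 * X + 2 * En + 2 * En)" by simp
      \<comment> \<open>The fibre needs the rate n - X, and at most n - 2 X + 4 \<open>En\<close> is
        available.\<close>
      then have "X - 4 * En \<le> log 2 (4 * real p ^ 2) + 3 + K" unfolding \<beta>n by linarith
      moreover have "log 2 (4 * real p ^ 2) + 4 + \<bar>K\<bar> \<le> X / 2" using t4[rule_format, OF n_ge(6)] unfolding X_def by simp
      ultimately show False using qE0 qE1 X0 by linarith
    qed
    have own: "card {y \<in> P i. {x, y} \<in> E} \<le> 2 * d" if i: "i < p" and x: "x \<in> P i" for i x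
    proof -
      have "x \<in> V" using sub[OF i] x by auto
      then obtain j where j: "j < p" "card {y \<in> P j. {x, y} \<in> E} < 2 * d" using exceptional by blast
      then show ?thesis using optimal_partition_degree_le[OF G opt i j(1) x] by linarith
    qed
    \<comment> \<open>The degree of \<open>x\<close> is at least n - X up to a constant, and its own
      class absorbs at most 2 d of it, so little can be missing in any other class.\<close>
    have nonadj: "card {w \<in> P j. {x, w} \<notin> E} \<le> En + 2 * d + 2 + K"
      if i: "i < p" and j: "j < p" "j \<noteq> i" and x: "x \<in> P i" for i j x
    proof -
      let ?N = "{y \<in> V. {x, y} \<in> E}"
      have xV: "x \<in> V" using sub[OF i] x by auto
      have "\<beta> * card V - 2 - K \<le> card ?N"
        by (rule degree_lower_bound[OF good _ ext xV]) (use q1 in auto)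
      moreover have "card ?N \<le> card ({y \<in> P i. {x, y} \<in> E} \<union> (V - P i - {w \<in> P j. {x, w} \<notin> E}))"
        by (rule card_mono) (use fin fP[OF i] in auto)
      moreover have "\<dots> \<le> card {y \<in> P i. {x, y} \<in> E} + card (V - P i - {w \<in> P j. {x, w} \<notin> E})"
        by (rule card_Un_le)
      moreover have "card (V - P i - {w \<in> P j. {x, w} \<notin> E}) + card (P i) + card {w \<in> P j. {x, w} \<notin> E} = card V"
      proof -
        have sub': "{w \<in> P j. {x, w} \<notin> E} \<subseteq> V - P i" using sub[OF j(1)] disj[OF j(1) i j(2)] by auto
        have "card (V - P i - {w \<in> P j. {x, w} \<notin> E}) + card {w \<in> P j. {x, w} \<notin> E} = card (V - P i)"
          using card_Diff_subset[OF finite_subset[OF sub'] sub'] card_mono[OF _ sub'] fin by simp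
        moreover have "card (V - P i) + card (P i) = card V"
          using card_Diff_subset[OF fP[OF i] sub[OF i]] card_mono[OF fin(1) sub[OF i]] by simp
        ultimately show ?thesis by simp
      qed
      moreover have "card {y \<in> P i. {x, y} \<in> E} \<le> 2 * d" by (rule own[OF i x])
      ultimately have "\<beta> * n - 2 - K \<le> 2 * real d + (real n - card (P i) - card {w \<in> P j. {x, w} \<notin> E})"
        unfolding n_def by linarith
      then show ?thesis using size'(1)[OF i] unfolding \<beta>n by linarith
    qed
    show ?thesis
    proof (intro conjI allI impI)
      fix i assume i: "i < p"
      have "X / 2 \<le> card (P i)" using size'(1)[OF i] qE0 qE1 X0 En0 by linarith
      then show "real (card V) / (2 * p) \<le> card (P i)" unfolding X_def n_def by simp
    next
      fix i S assume i: "i < p" and S: "S \<subseteq> P i" "S \<noteq> {}" "card S \<le> card VH"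
      show "\<not> forcing E S"
      proof
        assume forc: "forcing E S"
        have SV: "S \<subseteq> V" using S(1) sub[OF i] by auto
        have fS: "finite S" using finite_subset[OF SV fin(1)] .
        define s where "s = card S"
        have s1: "1 \<le> s" unfolding s_def using S(2) fS by (simp add: Suc_le_eq card_gt_0_iff)
        have sq: "s \<le> q" unfolding s_def q_def using S(3) .
        obtain \<E> where \<E>: "\<E> \<subseteq> \<G>" "agree_off E S \<E>"
          and big: "2 powr (\<beta> * card S * card V - 2 * real (card S) ^ 2 - K) / 2 \<le> card \<E>"
          by (rule ex_large_fibre[OF good ext SV, of \<G> 2]) (use s1 sq D\<G> \<G>h in \<open>auto simp: s_def\<close>)
        obtain j where j: "j < p" "j \<noteq> i" and up: "real (card \<E>) \<le> p * 2 ^ card S *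
           (2 powr (card S * (real (2 * d) + card V - card (P i)) + d) *
            (1 - 1 / 2 ^ (card S + 1)) ^ card {w \<in> P j. \<forall>x\<in>S. {x, w} \<in> E})"
          using card_fibre_forcing_le[OF rich _ \<E>(2) i S(1,3) forc own[OF i]] \<E>(1) S(1) unfolding \<G>_def by blast
        define W where "W = {w \<in> P j. \<forall>x\<in>S. {x, w} \<in> E}"
        define w where "w = card W"
        \<comment> \<open>\<open>S\<close> has at most q vertices, each non-adjacent to only a few
          vertices of class j, so at least X / 2 vertices of that class are adjacent to all of
          \<open>S\<close>.\<close>
        have w: "X / 2 \<le> w"
        proof -
          have "card (P j) \<le> card (W \<union> (\<Union>x\<in>S. {w \<in> P j. {x, w} \<notin> E}))"
            by (rule card_mono) (use fP[OF j(1)] fS in \<open>auto simp: W_def\<close>)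
          also have "\<dots> \<le> w + card (\<Union>x\<in>S. {w \<in> P j. {x, w} \<notin> E})" unfolding w_def by (rule card_Un_le)
          also have "card (\<Union>x\<in>S. {w \<in> P j. {x, w} \<notin> E}) \<le> (\<Sum>x\<in>S. card {w \<in> P j. {x, w} \<notin> E})"
            by (rule card_UN_le[OF fS])
          finally have "real (card (P j)) \<le> real (w + (\<Sum>x\<in>S. card {w \<in> P j. {x, w} \<notin> E}))"
            by (simp only: of_nat_le_iff)
          also have "\<dots> = w + (\<Sum>x\<in>S. real (card {w \<in> P j. {x, w} \<notin> E}))" by simp
          also have "(\<Sum>x\<in>S. real (card {w \<in> P j. {x, w} \<notin> E})) \<le> (\<Sum>x\<in>S. En + 2 * d + 2 + \<bar>K\<bar>)"
          proof (rule sum_mono)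
            fix x assume "x \<in> S"
            then have "x \<in> P i" using S(1) by auto
            from nonadj[OF i j this] show "real (card {w \<in> P j. {x, w} \<notin> E}) \<le> En + 2 * d + 2 + \<bar>K\<bar>" by linarith
          qed
          also have "\<dots> = s * (En + 2 * d + 2 + \<bar>K\<bar>)" unfolding s_def by simp
          also have "\<dots> \<le> q * (3 * En + (4 + \<bar>K\<bar>))" using sq dE En0 by (intro mult_mono) auto
          also have "\<dots> = 3 * qE + q * (4 + \<bar>K\<bar>)" unfolding qE_def by (simp add: distrib_left)
          finally show ?thesis using size'(1)[OF j(1)] qE1 T5 qE0 En0 X0 by linarith
        qed
        have sr: "real s \<le> q" "real s \<ge> 1" using sq s1 by auto
        have "(1 - 1 / 2 ^ (s + 1) :: real) \<le> 1 - 1 / 2 ^ (q + 1)"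
        proof -
          have "(1::real) / 2 ^ (q + 1) \<le> 1 / 2 ^ (s + 1)"
            by (intro divide_left_mono power_increasing) (use sq in auto)
          then show ?thesis by simp
        qed
        moreover have "(0::real) \<le> 1 - 1 / 2 ^ (s + 1)"
        proof -
          have "(1::real) / 2 ^ (s + 1) \<le> 1 / 1" by (intro divide_left_mono one_le_power) auto
          then show ?thesis by simp
        qed
        ultimately have "(1 - 1 / 2 ^ (s + 1) :: real) ^ w \<le> (1 - 1 / 2 ^ (q + 1)) ^ w" by (intro power_mono)
        also have "(1 - 1 / 2 ^ (q + 1) :: real) ^ w = (2 powr (- g)) ^ w" unfolding g_def using g01 by simp
        also have "\<dots> = 2 powr (- (g * w))" by (simp add: powr_power mult.commute)
        also have "\<dots> \<le> 2 powr (- (g * X / 2))"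
        proof (rule powr_mono)
          have "g * (X / 2) \<le> g * w" using w g by (intro mult_left_mono) auto
          then show "- (g * w) \<le> - (g * X / 2)" by simp
        qed simp
        finally have pw: "(1 - 1 / 2 ^ (s + 1) :: real) ^ w \<le> 2 powr (- (g * X / 2))" .
        have "real (card \<E>) \<le> p * 2 ^ s * (2 powr (s * (real (2 * d) + n - card (P i)) + d) * 2 powr (- (g * X / 2)))"
          using up pw unfolding s_def[symmetric] w_def W_def[symmetric] n_def[symmetric]
          by (elim order_trans) (intro mult_left_mono, auto)
        also have "\<dots> = 2 powr (log 2 p + s + (s * (real (2 * d) + n - card (P i)) + d) - g * X / 2)"
        proof -
          have "real (p * 2 ^ s) = 2 powr (log 2 p + s)" using p0 by (simp add: powr_add powr_realpow)
          then have "real (p * 2 ^ s) * (2 powr (s * (real (2 * d) + n - card (P i)) + d) * 2 powr (- (g * X / 2)))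
            = 2 powr (log 2 p + s + ((s * (real (2 * d) + n - card (P i)) + d) + - (g * X / 2)))"
            by (simp only: powr_add)
          also have "log 2 p + s + ((s * (real (2 * d) + n - card (P i)) + d) + - (g * X / 2))
            = log 2 p + s + (s * (real (2 * d) + n - card (P i)) + d) - g * X / 2" by simp
          finally show ?thesis .
        qed
        finally have up': "real (card \<E>) \<le> 2 powr (log 2 p + s + (s * (real (2 * d) + n - card (P i)) + d) - g * X / 2)" .
        have "2 powr (\<beta> * s * n - 2 * real s ^ 2 - K - 1) = 2 powr (\<beta> * card S * card V - 2 * real (card S) ^ 2 - K) / 2"
          by (simp add: powr_diff n_def s_def)
        also note big
        also note up'
        finally have ineq: "\<beta> * s * n - 2 * real s ^ 2 - K - 1 \<le> log 2 p + s + (s * (real (2 * d) + n - card (P i)) + d) - g * X / 2"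
          by simp
        \<comment> \<open>The main terms s (n - X) cancel; the factor 2^(- g X / 2) competes only
          with multiples of \<epsilon> n and constants.\<close>
        have "\<beta> * s * n = s * (n - X)" using \<beta>n by (simp add: mult_ac)
        moreover have "s * (real (2 * d) + n - card (P i)) \<le> s * (n - X) + s * (3 * En + 2)"
        proof -
          have "s * (real (2 * d) + n - card (P i)) \<le> s * (n - X + (3 * En + 2))"
            using size'(1)[OF i] dE by (intro mult_left_mono) auto
          then show ?thesis by (simp add: distrib_left)
        qed
        moreover have "s * (3 * En + 2) \<le> q * (3 * En + 2)" using sr(1) En0 by (intro mult_right_mono) auto
        moreover have "q * (3 * En + 2) = 3 * qE + 2 * q" unfolding qE_def by (simp add: distrib_left)
        moreover have "real s ^ 2 \<le> real q ^ 2" using sr by (intro power_mono) auto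
        moreover have "c6 \<le> g * X / 4" using t6[rule_format, OF n_ge(8)] unfolding X_def by simp
        ultimately show False using ineq qEg qE0 En0 sr dE unfolding c6_def by linarith
      qed
    qed
  qed
  then show ?thesis by blast
qed

end

section \<open>Turan numbers, the encoding of orientations and relabelling of vertices\<close>

section \<open>Turan numbers and extremal functions\<close>

text \<open>The number of edges of the balanced complete p-partite graph in incremental form: in
  \<open>turan_edges\<close> the vertex \<open>k\<close> is joined to k - k div p smaller
  vertices.\<close>

definition turan :: "nat \<Rightarrow> nat \<Rightarrow> nat" where
  "turan p n = (\<Sum>k<n. k - k div p)"

lemma turan_step: "p > 0 \<Longrightarrow> (1 - 1 / real p) * k \<le> real (k - k div p)"
proof -
  assume p: "p > 0"
  have "k div p * p \<le> k" by (rule div_times_less_eq_dividend)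
  then have "real (k div p * p) \<le> real k" by (simp only: of_nat_le_iff)
  then have "real (k div p) \<le> real k / p" using p by (simp add: pos_le_divide_eq)
  moreover have "k div p \<le> k" by (rule div_le_dividend)
  ultimately show ?thesis by (simp add: of_nat_diff left_diff_distrib)
qed

lemma turan_diff:
  assumes "p > 0"
  shows "real (turan p m) + (1 - 1 / real p) * s * m \<le> turan p (m + s)"
proof (induction s)
  case (Suc s)
  have "1 / real p \<le> 1" using assms by simp
  then have "(1 - 1 / real p) * m \<le> (1 - 1 / real p) * (m + s)" by (intro mult_left_mono) auto
  also have "\<dots> \<le> real ((m + s) - (m + s) div p)" using turan_step[OF assms, of "m + s"] by simp
  finally have "(1 - 1 / real p) * m \<le> real ((m + s) - (m + s) div p)" .
  moreover have "turan p (m + Suc s) = turan p (m + s) + ((m + s) - (m + s) div p)" by (simp add: turan_def)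
  then have "real (turan p (m + Suc s)) = real (turan p (m + s)) + real ((m + s) - (m + s) div p)"
    by (simp only: of_nat_add)
  moreover have "(1 - 1 / real p) * Suc s * m = (1 - 1 / real p) * s * m + (1 - 1 / real p) * m"
    by (simp add: distrib_left distrib_right)
  ultimately show ?case using Suc by linarith
qed simp

lemma turan_lower:
  assumes "p > 0"
  shows "(1 - 1 / real p) * real n ^ 2 / 2 - n \<le> turan p n"
proof (induction n)
  case 0
  then show ?case by (simp add: turan_def)
next
  case (Suc n)
  define c where "c = 1 - 1 / real p"
  have c: "c \<le> 1" unfolding c_def using assms by simp
  have "turan p (Suc n) = turan p n + (n - n div p)" by (simp add: turan_def)
  then have f1: "real (turan p (Suc n)) \<ge> c * real n ^ 2 / 2 - n + c * n"
    using Suc turan_step[OF assms, of n] unfolding c_def[symmetric] by simp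
  have f2: "c * real (Suc n) ^ 2 / 2 = c * real n ^ 2 / 2 + c * n + c / 2"
    by (simp add: power2_eq_square field_simps)
  have f3: "real (Suc n) = real n + 1" by simp
  have comb: "T - u \<le> t" if "X - m + Y \<le> t" "T = X + Y + c / 2" "u = m + 1" for T X Y t u m :: real
    using that c by linarith
  show ?case unfolding c_def[symmetric] by (rule comb[OF f1 f2 f3])
qed

text \<open>The unordered cross pairs of any p classes number at most the Turan number. Of n + 1
  elements, a class of at least average size contains more than n div p, so removing one of its
  elements destroys at most n - n div p cross pairs.\<close>

lemma square_le_sum_squares_turan:
  assumes "p > 0"
  shows "(\<Sum>i<p. a i) = n \<Longrightarrow> n ^ 2 \<le> (\<Sum>i<p. a i ^ 2) + 2 * turan p n"
proof (induction n arbitrary: a)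
  case (Suc n)
  have "\<exists>j<p. Suc n \<le> p * a j"
  proof (rule ccontr)
    assume "\<not> ?thesis"
    then have lt: "p * a i < Suc n" if "i < p" for i using that not_less by blast
    have "(\<Sum>i<p. p * a i) < (\<Sum>i<p. Suc n)"
      by (rule sum_strict_mono) (use lt assms in \<open>auto simp: lessThan_empty_iff\<close>)
    then show False using Suc.prems by (simp add: sum_distrib_left[symmetric])
  qed
  then obtain j where j: "j < p" "Suc n \<le> p * a j" by blast
  have aj: "a j \<ge> 1" using j(2) by (cases "a j") auto
  define b where "b = a(j := a j - 1)"
  have split: "(\<Sum>i<p. f i) = f j + (\<Sum>i\<in>{..<p} - {j}. f i)" for f :: "nat \<Rightarrow> nat"
    using j(1) by (simp add: sum.remove)
  have rest: "(\<Sum>i\<in>{..<p} - {j}. b i) = (\<Sum>i\<in>{..<p} - {j}. a i)"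
    "(\<Sum>i\<in>{..<p} - {j}. b i ^ 2) = (\<Sum>i\<in>{..<p} - {j}. a i ^ 2)"
    unfolding b_def by (auto intro!: sum.cong)
  have bj: "b j = a j - 1" unfolding b_def by simp
  have "(\<Sum>i<p. b i) = n" using Suc.prems aj rest(1) bj split[of a] split[of b] by linarith
  from Suc.IH[OF this] have IH: "n ^ 2 \<le> (\<Sum>i<p. b i ^ 2) + 2 * turan p n" .
  have ajn: "n div p < a j"
    using j(2) by (metis Suc_le_lessD div_less_iff_less_mult assms mult.commute)
  obtain c where c: "a j = Suc c" using aj by (cases "a j") auto
  have sq: "(\<Sum>i<p. a i ^ 2) = (\<Sum>i<p. b i ^ 2) + 2 * c + 1"
    using split[of "\<lambda>i. a i ^ 2"] split[of "\<lambda>i. b i ^ 2"] rest(2) bj c by (simp add: power2_eq_square)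
  have t: "turan p (Suc n) = turan p n + (n - n div p)" by (simp add: turan_def)
  have "n div p \<le> n" by (rule div_le_dividend)
  then have "2 * n \<le> 2 * c + 2 * (n - n div p)" using ajn c by linarith
  moreover have "Suc n ^ 2 = n ^ 2 + 2 * n + 1" by (simp add: power2_eq_square)
  ultimately show ?case using IH sq t by linarith
qed simp

lemma card_edges_le_turan:
  fixes E :: "nat set set"
  assumes G: "graph (V, E)" and part: "is_partition (V, E) p P" and p: "p > 0"
  shows "card E \<le> turan p (card V) + part_cost (V, E) p P"
proof -
  define C where "C = {(u, v). \<exists>i<p. \<exists>j<p. i \<noteq> j \<and> u \<in> P i \<and> v \<in> P j}"
  note cp = cross_pairs[OF G part, folded C_def]
  have "card {(u, v) \<in> C. {u, v} \<in> E} \<le> card C" by (rule card_mono[OF cp(1)]) auto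
  moreover have "card V ^ 2 \<le> (\<Sum>i<p. card (P i) ^ 2) + 2 * turan p (card V)"
    by (rule square_le_sum_squares_turan[OF p sum_card_partition[OF part]]) (use graph_finite[OF G] in simp)
  ultimately show ?thesis using cp(2,3) by linarith
qed

lemma card_turan_edges:
  assumes "p > 0"
  shows "card (turan_edges p n) = turan p n"
proof (induction n)
  case 0
  have "turan_edges p 0 = {}" by (auto simp: turan_edges_def)
  then show ?case by (simp add: turan_def)
next
  case (Suc n)
  let ?N = "{u. u < n \<and> u mod p \<noteq> n mod p}" and ?M = "{u. u < n \<and> u mod p = n mod p}"
  have "?M = (\<lambda>j. p * j + n mod p) ` {..<n div p}"
  proof safe
    fix u assume u: "u < n" "u mod p = n mod p"
    have "u = p * (u div p) + n mod p" using u(2) by (metis mult_div_mod_eq)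
    moreover have "u div p < n div p"
    proof (rule ccontr)
      assume "\<not> u div p < n div p"
      then have "p * (n div p) \<le> p * (u div p)" by simp
      then have "n \<le> u" using u(2) by (metis add_le_mono1 mult_div_mod_eq)
      then show False using u(1) by simp
    qed
    ultimately show "u \<in> (\<lambda>j. p * j + n mod p) ` {..<n div p}" by blast
  next
    fix j assume "j < n div p"
    then have "p * j < p * (n div p)" using assms by (intro mult_strict_left_mono)
    then have "p * j + n mod p < p * (n div p) + n mod p" by (rule add_strict_right_mono)
    also have "p * (n div p) + n mod p = n" by simp
    finally show "p * j + n mod p < n" .
  qed (use assms in auto)
  moreover have "inj_on (\<lambda>j. p * j + n mod p) {..<n div p}" using assms by (auto simp: inj_on_def)
  ultimately have "card ?M = n div p" by (simp add: card_image)
  moreover have "card ?N = n - card ?M"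
  proof -
    have "?N = {..<n} - ?M" by auto
    moreover have "?M \<subseteq> {..<n}" by auto
    ultimately show ?thesis by (simp add: card_Diff_subset finite_subset)
  qed
  ultimately have cN: "card ?N = n - n div p" by simp
  have "turan_edges p (Suc n) = turan_edges p n \<union> (\<lambda>u. {u, n}) ` ?N"
  proof (intro equalityI subsetI)
    fix e assume "e \<in> turan_edges p (Suc n)"
    then obtain u v where uv: "e = {u, v}" "u < Suc n" "v < Suc n" "u mod p \<noteq> v mod p"
      unfolding turan_edges_def by blast
    then consider "u < n" "v < n" | "u = n" "v < n" | "v = n" "u < n" by (metis less_SucE)
    then show "e \<in> turan_edges p n \<union> (\<lambda>u. {u, n}) ` ?N"
    proof cases
      case 1
      then show ?thesis using uv unfolding turan_edges_def by blast
    next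
      case 2
      then have "v \<in> ?N" "e = {v, n}" using uv by auto
      then show ?thesis by blast
    next
      case 3
      then have "u \<in> ?N" "e = {u, n}" using uv by auto
      then show ?thesis by blast
    qed
  next
    fix e assume "e \<in> turan_edges p n \<union> (\<lambda>u. {u, n}) ` ?N"
    then obtain u v where "e = {u, v}" "u < Suc n" "v < Suc n" "u mod p \<noteq> v mod p"
    proof
      assume "e \<in> turan_edges p n"
      then obtain u v where "e = {u, v}" "u < n" "v < n" "u mod p \<noteq> v mod p"
        unfolding turan_edges_def by blast
      then show ?thesis using that[of u v] by simp
    next
      assume "e \<in> (\<lambda>u. {u, n}) ` ?N"
      then obtain u where "e = {u, n}" "u < n" "u mod p \<noteq> n mod p" by blast
      then show ?thesis using that[of u n] by simp
    qed
    then show "e \<in> turan_edges p (Suc n)" unfolding turan_edges_def by blast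
  qed
  moreover have "turan_edges p n \<inter> (\<lambda>u. {u, n}) ` ?N = {}"
    unfolding turan_edges_def by (auto simp: doubleton_eq_iff)
  moreover have "card ((\<lambda>u. {u, n}) ` ?N) = card ?N"
    by (rule card_image) (auto simp: inj_on_def doubleton_eq_iff)
  ultimately have "card (turan_edges p (Suc n)) = card (turan_edges p n) + card ?N"
    by (simp add: card_Un_disjoint finite_turan_edges)
  then show ?case using Suc cN by (simp add: turan_def)
qed

text \<open>An orientation and the set of its upward edges determine each other; this passes from
  the sets of arcs in \<open>Dg\<close> to the encoding by \<open>F\<close>.\<close>

lemma Dg_eq_card:
  assumes G: "graph (V, E)"
  shows "Dg (V, E) vH = card {F. F \<subseteq> E \<and> \<not> emb V E F (fst vH) (snd vH)}"
proof -
  let ?A = "\<lambda>F. {(x, y). arc E F x y}"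
  have emb: "dcontains (V, ?A F) vH \<longleftrightarrow> emb V E F (fst vH) (snd vH)" for F
    unfolding dcontains_def emb_def by auto
  have ne: "x \<noteq> y" "x \<in> V" "y \<in> V" if "{x, y} \<in> E" for x y
    using graph_edgeD[OF G that] by (auto simp: doubleton_eq_iff)
  have or: "orientation (V, ?A F) (V, E)" if "F \<subseteq> E" for F
    unfolding orientation_def
  proof
    show "digraph (V, ?A F)"
      unfolding digraph_def using graph_finite[OF G] ne by (auto simp: arc_def insert_commute)
    show "underlying (V, ?A F) = (V, E)"
      unfolding underlying_def
    proof (simp, intro equalityI subsetI)
      fix e assume "e \<in> E"
      then obtain x y where xy: "x \<noteq> y" "e = {x, y}" using graph_edgeD[OF G] by metis
      then have "arc E F x y \<or> arc E F y x" using \<open>e \<in> E\<close> arc_flip[of x y E F] by blast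
      then show "e \<in> {{x, y} |x y. arc E F x y}" using xy by (auto simp: insert_commute)
    qed (auto simp: arc_def)
  qed
  have "bij_betw ?A {F. F \<subseteq> E \<and> \<not> emb V E F (fst vH) (snd vH)}
      {A. orientation (fst (V, E), A) (V, E) \<and> \<not> dcontains (fst (V, E), A) vH}"
  proof (rule bij_betw_imageI)
    show "inj_on ?A {F. F \<subseteq> E \<and> \<not> emb V E F (fst vH) (snd vH)}"
    proof (rule inj_onI)
      fix F F' assume F: "F \<in> {F. F \<subseteq> E \<and> \<not> emb V E F (fst vH) (snd vH)}"
        "F' \<in> {F. F \<subseteq> E \<and> \<not> emb V E F (fst vH) (snd vH)}" and eq: "?A F = ?A F'"
      have arcs: "arc E F x y \<longleftrightarrow> arc E F' x y" for x y using eq by (auto dest: equalityD1 equalityD2)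
      show "F = F'"
      proof (rule set_eqI)
        fix e show "e \<in> F \<longleftrightarrow> e \<in> F'"
        proof (cases "e \<in> E")
          case True
          then obtain x y where "x \<noteq> y" "e = {x, y}" using graph_edgeD[OF G] by metis
          then show ?thesis using arcs[of x y] True unfolding arc_def by auto
        qed (use F in auto)
      qed
    qed
    show "?A ` {F. F \<subseteq> E \<and> \<not> emb V E F (fst vH) (snd vH)}
      = {A. orientation (fst (V, E), A) (V, E) \<and> \<not> dcontains (fst (V, E), A) vH}"
    proof (intro equalityI subsetI)
      fix A assume "A \<in> {A. orientation (fst (V, E), A) (V, E) \<and> \<not> dcontains (fst (V, E), A) vH}"
      then have A: "digraph (V, A)" "{{x, y} |x y. (x, y) \<in> A} = E" "\<not> dcontains (V, A) vH"
        unfolding orientation_def underlying_def by auto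
      have anti: "x \<noteq> y \<and> (y, x) \<notin> A" if "(x, y) \<in> A" for x y using A(1) that unfolding digraph_def by auto
      define F where "F = {{x, y} |x y. (x, y) \<in> A \<and> x < y}"
      have AE: "{x, y} \<in> E" if "(x, y) \<in> A" for x y using A(2) that by auto
      have inF: "{x, y} \<in> F \<longleftrightarrow> x < y" if "(x, y) \<in> A" for x y
        using that anti[OF that] unfolding F_def by (auto simp: doubleton_eq_iff)
      have "(x, y) \<in> A \<longleftrightarrow> arc E F x y" for x y
      proof
        assume "(x, y) \<in> A"
        then show "arc E F x y" using AE inF anti unfolding arc_def by auto
      next
        assume a: "arc E F x y"
        then have "{x, y} \<in> E" unfolding arc_def by simp
        then obtain u v where uv: "{x, y} = {u, v}" "(u, v) \<in> A" using A(2) by auto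
        show "(x, y) \<in> A"
        proof (rule ccontr)
          assume "(x, y) \<notin> A"
          then have "(y, x) \<in> A" using uv by (auto simp: doubleton_eq_iff)
          then have "arc E F y x" using AE inF anti unfolding arc_def by auto
          then show False using a arc_flip[of x y E F] unfolding arc_def by blast
        qed
      qed
      then have eq: "A = ?A F" by auto
      have "F \<subseteq> E" using A(2) unfolding F_def by auto
      moreover have "\<not> emb V E F (fst vH) (snd vH)" using A(3) emb[of F] eq by simp
      ultimately show "A \<in> ?A ` {F. F \<subseteq> E \<and> \<not> emb V E F (fst vH) (snd vH)}" using eq by blast
    qed (use or emb in auto)
  qed
  then show ?thesis unfolding Dg_def by (simp add: bij_betw_same_card)
qed

lemma finite_Dg_set: "finite {Dg G vH | G :: nat graph. graph G \<and> fst G = {..<n}}"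
proof (rule finite_subset)
  show "{Dg G vH | G :: nat graph. graph G \<and> fst G = {..<n}} \<subseteq> (\<lambda>E. Dg ({..<n}, E) vH) ` Pow (Pow {..<n})"
  proof
    fix k assume "k \<in> {Dg G vH | G :: nat graph. graph G \<and> fst G = {..<n}}"
    then obtain G :: "nat graph" where k: "k = Dg G vH" "graph G" "fst G = {..<n}" by auto
    then have "G = ({..<n}, snd G)" by (metis prod.collapse)
    then obtain E where E: "k = Dg ({..<n}, E) vH" "graph ({..<n}, E)" using k(1,2) by metis
    have "E \<in> Pow (Pow {..<n})" using E(2) unfolding graph_def by fastforce
    then show "k \<in> (\<lambda>E. Dg ({..<n}, E) vH) ` Pow (Pow {..<n})" using E(1) by blast
  qed
qed simp

lemma graph_relabel:
  assumes "graph (V, E)" "bij_betw h V V'"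
  shows "graph (V', (`) h ` E)"
  unfolding graph_def fst_conv snd_conv
proof (intro conjI ballI)
  show "finite V'" using assms graph_finite bij_betw_finite by blast
  fix e assume "e \<in> (`) h ` E"
  then obtain f where f: "f \<in> E" "e = h ` f" by auto
  obtain x y where "x \<noteq> y" "x \<in> V" "y \<in> V" "f = {x, y}" using graph_edgeD[OF assms(1) f(1)] by metis
  then show "\<exists>x y. x \<noteq> y \<and> x \<in> V' \<and> y \<in> V' \<and> e = {x, y}"
    using assms(2) f(2) by (intro exI[of _ "h x"] exI[of _ "h y"]) (auto simp: bij_betw_def dest: inj_onD)
qed

text \<open>The encoding depends on the order of the vertex names, so the image of \<open>F\<close>
  under \<open>h\<close> would in general encode another orientation; \<open>F'\<close> is read off
  from the relabelled arcs instead.\<close>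

lemma emb_relabel:
  fixes E :: "nat set set" and h :: "nat \<Rightarrow> nat"
  assumes G: "graph (V, E)" and h: "bij_betw h V V'" and F: "F \<subseteq> E"
  shows "\<exists>F'\<subseteq>(`) h ` E. (\<forall>x\<in>V. \<forall>y\<in>V. arc ((`) h ` E) F' (h x) (h y) \<longleftrightarrow> arc E F x y)"
proof -
  define F' where "F' = {{h x, h y} |x y. arc E F x y \<and> h x < h y}"
  have inj: "inj_on h V" using h unfolding bij_betw_def by simp
  have ne: "x \<noteq> y" "x \<in> V" "y \<in> V" if "{x, y} \<in> E" for x y
    using graph_edgeD[OF G that] by (auto simp: doubleton_eq_iff)
  have hE: "{h x, h y} \<in> (`) h ` E \<longleftrightarrow> {x, y} \<in> E" if "x \<in> V" "y \<in> V" for x y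
  proof
    assume "{h x, h y} \<in> (`) h ` E"
    then obtain e where e: "e \<in> E" "{h x, h y} = h ` e" by auto
    obtain u v where uv: "u \<in> V" "v \<in> V" "e = {u, v}" using graph_edgeD[OF G e(1)] by metis
    have "h ` {x, y} = h ` {u, v}" using e(2) uv(3) by simp
    then have "{x, y} = {u, v}" using inj that uv(1,2) by (metis empty_subsetI inj_on_image_eq_iff insert_subset)
    then show "{x, y} \<in> E" using e(1) uv(3) by simp
  next
    assume "{x, y} \<in> E"
    then have "h ` {x, y} \<in> (`) h ` E" by (rule imageI)
    then show "{h x, h y} \<in> (`) h ` E" by simp
  qed
  have "arc ((`) h ` E) F' (h x) (h y) \<longleftrightarrow> arc E F x y" if xy: "x \<in> V" "y \<in> V" for x y
  proof (cases "{x, y} \<in> E")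
    case True
    have xne: "x \<noteq> y" using ne(1)[OF True] .
    have hne: "h x \<noteq> h y" using inj xy xne by (auto dest: inj_onD)
    have key: "{h x, h y} \<in> F' \<longleftrightarrow> (arc E F x y \<and> h x < h y) \<or> (arc E F y x \<and> h y < h x)"
    proof
      assume "{h x, h y} \<in> F'"
      then obtain u v where uv: "{h x, h y} = {h u, h v}" "arc E F u v" "h u < h v" unfolding F'_def by auto
      then have V: "u \<in> V" "v \<in> V" using ne unfolding arc_def by auto
      from uv(1) consider "h x = h u" "h y = h v" | "h x = h v" "h y = h u" by (auto simp: doubleton_eq_iff)
      then show "(arc E F x y \<and> h x < h y) \<or> (arc E F y x \<and> h y < h x)"
      proof cases
        case 1
        then have "x = u" "y = v" using inj xy V by (auto dest: inj_onD)
        then show ?thesis using uv by simp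
      next
        case 2
        then have "x = v" "y = u" using inj xy V by (auto dest: inj_onD)
        then show ?thesis using uv by simp
      qed
    qed (auto simp: F'_def insert_commute)
    have "arc ((`) h ` E) F' (h x) (h y) \<longleftrightarrow> ({h x, h y} \<in> F' \<longleftrightarrow> h x < h y)"
      unfolding arc_def using hE[OF xy] True hne by simp
    also have "\<dots> \<longleftrightarrow> arc E F x y" using key arc_flip[OF True xne, of F] hne by (cases "h x < h y") auto
    finally show ?thesis .
  next
    case False
    then show ?thesis using hE[OF xy] unfolding arc_def by simp
  qed
  moreover have "F' \<subseteq> (`) h ` E"
  proof
    fix e assume "e \<in> F'"
    then obtain x y where "e = h ` {x, y}" "{x, y} \<in> E" unfolding F'_def arc_def by auto
    then show "e \<in> (`) h ` E" by blast
  qed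
  ultimately show ?thesis by blast
qed

text \<open>\<open>Dn\<close> refers to graphs on \<open>{..<n}\<close> only; the relabelling along
  a bijection \<open>h\<close> extends the bound to every finite vertex set.\<close>

lemma Dg_le_Dn:
  fixes E :: "nat set set"
  assumes G: "graph (V, E)" and vH: "snd vH \<subseteq> fst vH \<times> fst vH"
  shows "Dg (V, E) vH \<le> Dn (card V) vH"
proof -
  have fin: "finite V" "finite E" using graph_finite[OF G] by auto
  obtain h where h: "bij_betw h V {..<card V}"
    using ex_bij_betw_finite_nat[OF fin(1)] by (auto simp: atLeast0LessThan)
  let ?V = "{..<card V}" and ?E = "(`) h ` E"
  have G': "graph (?V, ?E)" by (rule graph_relabel[OF G h])
  have inj: "inj_on h V" using h unfolding bij_betw_def by simp
  have "\<forall>F. F \<subseteq> E \<longrightarrow> (\<exists>F'\<subseteq>?E. (\<forall>x\<in>V. \<forall>y\<in>V. arc ?E F' (h x) (h y) \<longleftrightarrow> arc E F x y))"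
    using emb_relabel[OF G h] by blast
  then obtain r where r: "\<And>F. F \<subseteq> E \<Longrightarrow> r F \<subseteq> ?E"
    "\<And>F x y. F \<subseteq> E \<Longrightarrow> x \<in> V \<Longrightarrow> y \<in> V \<Longrightarrow> arc ?E (r F) (h x) (h y) \<longleftrightarrow> arc E F x y" by metis
  have "card {F. F \<subseteq> E \<and> \<not> emb V E F (fst vH) (snd vH)} \<le> card {F. F \<subseteq> ?E \<and> \<not> emb ?V ?E F (fst vH) (snd vH)}"
  proof (rule card_inj_on_le)
    show "inj_on r {F. F \<subseteq> E \<and> \<not> emb V E F (fst vH) (snd vH)}"
    proof (rule inj_onI)
      fix F F' assume "F \<in> {F. F \<subseteq> E \<and> \<not> emb V E F (fst vH) (snd vH)}"
        "F' \<in> {F. F \<subseteq> E \<and> \<not> emb V E F (fst vH) (snd vH)}" and eq: "r F = r F'"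
      then have FE: "F \<subseteq> E" "F' \<subseteq> E" by auto
      show "F = F'"
      proof (rule set_eqI)
        fix e show "e \<in> F \<longleftrightarrow> e \<in> F'"
        proof (cases "e \<in> E")
          case True
          then obtain x y where xy: "x \<noteq> y" "x \<in> V" "y \<in> V" "e = {x, y}" using graph_edgeD[OF G] by metis
          have "arc E F x y \<longleftrightarrow> arc E F' x y" using r(2)[OF FE(1) xy(2,3)] r(2)[OF FE(2) xy(2,3)] eq by simp
          then show ?thesis using xy True unfolding arc_def by auto
        qed (use FE in auto)
      qed
    qed
    show "r ` {F. F \<subseteq> E \<and> \<not> emb V E F (fst vH) (snd vH)} \<subseteq> {F. F \<subseteq> ?E \<and> \<not> emb ?V ?E F (fst vH) (snd vH)}"
    proof safe
      fix F assume FE: "F \<subseteq> E" and no: "\<not> emb V E F (fst vH) (snd vH)"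
      show "x \<in> ?E" if "x \<in> r F" for x using r(1)[OF FE] that by auto
      assume "emb ?V ?E (r F) (fst vH) (snd vH)"
      then obtain f where f12: "inj_on f (fst vH)" "f ` fst vH \<subseteq> ?V" and f3: "\<forall>(x, y)\<in>snd vH. arc ?E (r F) (f x) (f y)"
        unfolding emb_def by blast
      have f: "inj_on f (fst vH)" "f ` fst vH \<subseteq> ?V" "\<And>x y. (x, y) \<in> snd vH \<Longrightarrow> arc ?E (r F) (f x) (f y)"
        using f12 f3 by auto
      let ?g = "\<lambda>l. inv_into V h (f l)"
      have hV: "h ` V = ?V" using h unfolding bij_betw_def by simp
      have g: "?g l \<in> V" "h (?g l) = f l" if "l \<in> fst vH" for l
        using f(2) that hV inv_into_into[of "f l" h V] f_inv_into_f[of "f l" h V] by auto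
      have "inj_on ?g (fst vH)"
        by (rule inj_onI) (metis f(1) g(2) inj_onD)
      moreover have "arc E F (?g x) (?g y)" if xy: "(x, y) \<in> snd vH" for x y
      proof -
        have "x \<in> fst vH" "y \<in> fst vH" using vH xy by auto
        then show ?thesis using r(2)[OF FE g(1) g(1)] g(2) f(3)[OF xy] by simp
      qed
      ultimately have "emb V E F (fst vH) (snd vH)" unfolding emb_def using g(1) by blast
      then show False using no by simp
    qed
    show "finite {F. F \<subseteq> ?E \<and> \<not> emb ?V ?E F (fst vH) (snd vH)}" using fin by simp
  qed
  then have "Dg (V, E) vH \<le> Dg (?V, ?E) vH" by (simp only: Dg_eq_card[OF G] Dg_eq_card[OF G'])
  also have "\<dots> \<le> Dn (card V) vH" unfolding Dn_def
    by (rule Max_ge[OF finite_Dg_set]) (use G' in auto)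
  finally show ?thesis .
qed

lemma Dn_attained:
  obtains E where "graph ({..<n}, E)" "Dg ({..<n}, E) vH = Dn n vH"
proof -
  let ?S = "{Dg G vH | G :: nat graph. graph G \<and> fst G = {..<n}}"
  have "graph ({..<n}, {})" by (simp add: graph_def)
  then have "?S \<noteq> {}" by force
  then have "Dn n vH \<in> ?S" unfolding Dn_def by (rule Max_in[OF finite_Dg_set])
  then obtain G :: "nat graph" where "Dn n vH = Dg G vH" "graph G" "fst G = {..<n}" by auto
  then show ?thesis using that[of "snd G"] by (metis prod.collapse)
qed

text \<open>The same transfer for \<open>ex\<close>: a copy in the relabelled graph is pulled back
  along the inverse of \<open>h\<close>.\<close>

lemma card_edges_le_ex:
  fixes E :: "nat set set"
  assumes G: "graph (V, E)" and free: "\<And>M. M \<in> L \<Longrightarrow> \<not> contains (V, E) M"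
    and L: "\<And>M. M \<in> L \<Longrightarrow> graph M"
  shows "card E \<le> ex (card V) L"
proof -
  have fin: "finite V" "finite E" using graph_finite[OF G] by auto
  obtain h where h: "bij_betw h V {..<card V}"
    using ex_bij_betw_finite_nat[OF fin(1)] by (auto simp: atLeast0LessThan)
  let ?V = "{..<card V}" and ?E = "(`) h ` E"
  have G': "graph (?V, ?E)" by (rule graph_relabel[OF G h])
  have inj: "inj_on h V" and hV: "h ` V = ?V" using h unfolding bij_betw_def by auto
  have EV: "e \<subseteq> V" if "e \<in> E" for e using graph_edgeD[OF G that] by auto
  have "inj_on ((`) h) E" using inj EV by (intro inj_onI) (metis inj_on_image_eq_iff)
  then have cE: "card ?E = card E" by (rule card_image)
  have "\<not> contains (?V, ?E) M" if M: "M \<in> L" for M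
  proof
    assume "contains (?V, ?E) M"
    then obtain f where f: "inj_on f (fst M)" "f ` fst M \<subseteq> ?V" "\<And>e. e \<in> snd M \<Longrightarrow> f ` e \<in> ?E"
      unfolding contains_def by auto
    let ?g = "\<lambda>l. inv_into V h (f l)"
    have g: "?g l \<in> V" "h (?g l) = f l" if "l \<in> fst M" for l
      using f(2) that hV inv_into_into[of "f l" h V] f_inv_into_f[of "f l" h V] by auto
    have "inj_on ?g (fst M)" by (rule inj_onI) (metis f(1) g(2) inj_onD)
    moreover have "?g ` e \<in> E" if e: "e \<in> snd M" for e
    proof -
      have eM: "e \<subseteq> fst M" using L[OF M] e unfolding graph_def by fastforce
      obtain e' where e': "e' \<in> E" "f ` e = h ` e'" using f(3)[OF e] by auto
      have "inv_into V h ` (h ` e') = e'" by (rule inv_into_image_cancel[OF inj EV[OF e'(1)]])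
      then show ?thesis using e' by (metis image_image)
    qed
    ultimately have "contains (V, E) M" unfolding contains_def using g(1) by (intro exI[of _ ?g]) auto
    then show False using free[OF M] by simp
  qed
  then have "card ?E \<in> {card (snd G) | G :: nat graph. graph G \<and> fst G = ?V \<and> (\<forall>F\<in>L. \<not> contains G F)}"
    using G' by (intro CollectI exI[of _ "(?V, ?E)"]) auto
  moreover have "finite {card (snd G) | G :: nat graph. graph G \<and> fst G = ?V \<and> (\<forall>F\<in>L. \<not> contains G F)}"
  proof (rule finite_subset)
    show "{card (snd G) | G :: nat graph. graph G \<and> fst G = ?V \<and> (\<forall>F\<in>L. \<not> contains G F)} \<subseteq> card ` Pow (Pow ?V)"
      unfolding graph_def by fastforce
  qed simp
  ultimately show ?thesis unfolding ex_def cE[symmetric] by (intro Max_ge)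
qed

section \<open>Colourings of H obtained from its placement in a blow-up\<close>

section \<open>Colourings from the decomposition families\<close>

text \<open>The parts of \<open>gm\<close>: M with its isolated vertices is part 0, and the classes
  of the complete multipartite graph are numbered from 1. The only edges inside a part are those of
  M.\<close>

fun blowup_part :: "(('a + nat) + nat \<times> nat) \<Rightarrow> nat" where
  "blowup_part (Inl v) = 0"
| "blowup_part (Inr (j, i)) = Suc j"

lemma gm_edge_in_part:
  assumes M: "graph M" and e: "{a, b} \<in> snd (gm M p t)" and eq: "blowup_part a = blowup_part b"
  shows "a \<in> (Inl \<circ> Inl) ` fst M \<and> b \<in> (Inl \<circ> Inl) ` fst M"
proof -
  from e consider e' where "e' \<in> snd M" "{a, b} = (Inl \<circ> Inl) ` e'"
    | u w where "{a, b} = {Inl u, Inr w}"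
    | j i j' i' where "{a, b} = {Inr (j, i), Inr (j', i')}" "j \<noteq> j'"
    unfolding gm_def by auto
  then show ?thesis
  proof cases
    case 1
    then have "e' \<subseteq> fst M" using M unfolding graph_def by fastforce
    then have "{a, b} \<subseteq> (Inl \<circ> Inl) ` fst M" using 1(2) by blast
    then show ?thesis by blast
  next
    case 2
    obtain j i where "w = (j, i)" by force
    then show ?thesis using 2 eq by (auto simp: doubleton_eq_iff)
  next
    case 3
    then show ?thesis using eq by (auto simp: doubleton_eq_iff)
  qed
qed

lemma gm_vertex_part:
  assumes "a \<in> fst (gm M p t)" "p \<ge> 1"
  shows "blowup_part a < p"
  using assms unfolding gm_def by auto

text \<open>A vertex of H receives the number of the part of the blow-up that contains its image.
  Monochromatic arcs then lie in the copy of \<open>vM\<close>, and \<open>Q\<close> is the set of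
  vertices placed there.\<close>

lemma M_dfam_colouring:
  assumes or: "orientation vH H" and chi: "chi H = p + 1" and p: "p \<ge> 1" and vM: "vM \<in> M_dfam vH"
  obtains c :: "'a \<Rightarrow> nat" and Q g where "Q \<subseteq> fst vH" "\<forall>l\<in>fst vH. c l < p" "\<forall>l\<in>Q. c l = 0" "inj_on g Q"
    "g ` Q \<subseteq> fst vM" "\<forall>(x, y)\<in>snd vH. c x = c y \<longrightarrow> x \<in> Q \<and> y \<in> Q \<and> (g x, g y) \<in> snd vM"
proof -
  let ?M = "underlying vM"
  have H: "underlying vH = H" using or unfolding orientation_def by simp
  have AH: "snd vH \<subseteq> fst vH \<times> fst vH" using or unfolding orientation_def digraph_def by simp
  obtain t vG W where vG: "orientation vG (gm ?M (chi (underlying vH) - 1) t)" and W: "W \<subseteq> fst vG"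
    and dc: "dcontains (induce vG W) vH" and iso: "diso (induce vG ((Inl \<circ> Inl) ` fst vM)) vM"
    using vM unfolding M_dfam_def by auto
  have M: "graph ?M" using vM unfolding M_dfam_def M_fam_def by auto
  have fM: "fst ?M = fst vM" unfolding underlying_def by simp
  let ?G = "gm ?M p t"
  have uG: "underlying vG = ?G" using vG chi unfolding orientation_def H by simp
  have "fst (underlying vG) = fst vG" by (simp add: underlying_def)
  then have fG: "fst vG = fst ?G" unfolding uG by simp
  have eG: "{a, b} \<in> snd ?G" if ab: "(a, b) \<in> snd vG" for a b
  proof -
    have "{a, b} \<in> snd (underlying vG)" using ab unfolding underlying_def by auto
    then show ?thesis unfolding uG .
  qed
  obtain f where f: "inj_on f (fst vH)" "f ` fst vH \<subseteq> W" and fa: "\<forall>(x, y)\<in>snd vH. (f x, f y) \<in> snd (induce vG W)"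
    using dc unfolding dcontains_def by (auto simp: induce_def)
  let ?S = "(Inl \<circ> Inl) ` fst vM :: (((nat + nat) + nat \<times> nat) set)"
  obtain h where h: "bij_betw h ?S (fst vM)"
    and ha: "\<forall>x\<in>?S. \<forall>y\<in>?S. (x, y) \<in> snd (induce vG ?S) \<longleftrightarrow> (h x, h y) \<in> snd vM"
    using iso unfolding diso_def by (auto simp: induce_def)
  define c where "c l = blowup_part (f l)" for l
  define Q where "Q = {l \<in> fst vH. f l \<in> ?S}"
  have hinj: "inj_on h ?S" and him: "h ` ?S = fst vM" using h unfolding bij_betw_def by auto
  show ?thesis
  proof (rule that)
    show "Q \<subseteq> fst vH" unfolding Q_def by auto
    show "\<forall>l\<in>fst vH. c l < p"
      using f(2) W fG p unfolding c_def by (auto intro!: gm_vertex_part)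
    show "\<forall>l\<in>Q. c l = 0" unfolding Q_def c_def by auto
    show "inj_on (\<lambda>l. h (f l)) Q"
    proof (rule inj_onI)
      fix x y assume xy: "x \<in> Q" "y \<in> Q" "h (f x) = h (f y)"
      then have "f x = f y" using hinj unfolding Q_def by (auto dest: inj_onD)
      then show "x = y" using f(1) xy unfolding Q_def by (auto dest: inj_onD)
    qed
    show "(\<lambda>l. h (f l)) ` Q \<subseteq> fst vM" using him unfolding Q_def by blast
    show "\<forall>(x, y)\<in>snd vH. c x = c y \<longrightarrow> x \<in> Q \<and> y \<in> Q \<and> (h (f x), h (f y)) \<in> snd vM"
    proof (intro ballI, clarify)
      fix x y assume xy: "(x, y) \<in> snd vH" and cc: "c x = c y"
      have V: "x \<in> fst vH" "y \<in> fst vH" using xy AH by auto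
      have G: "(f x, f y) \<in> snd vG" using fa xy unfolding induce_def by auto
      have S: "f x \<in> ?S" "f y \<in> ?S"
        using gm_edge_in_part[OF M eG[OF G]] cc unfolding c_def fM by auto
      then have "(f x, f y) \<in> snd (induce vG ?S)" using G unfolding induce_def by simp
      then have "(h (f x), h (f y)) \<in> snd vM" using ha S by blast
      then show "x \<in> Q \<and> y \<in> Q \<and> (h (f x), h (f y)) \<in> snd vM" using S V unfolding Q_def by simp
    qed
  qed
qed

lemma not_colourable:
  fixes c :: "'a \<Rightarrow> nat"
  assumes or: "orientation vH H" and chi: "chi H = p + 1"
    and c: "\<forall>l\<in>fst vH. c l < p" "\<forall>(x, y)\<in>snd vH. c x \<noteq> c y"
  shows False
proof -
  have H: "underlying vH = H" using or unfolding orientation_def by simp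
  have "(\<forall>v\<in>fst H. c v < p) \<and> (\<forall>e\<in>snd H. \<forall>x\<in>e. \<forall>y\<in>e. x \<noteq> y \<longrightarrow> c x \<noteq> c y)"
    unfolding H[symmetric] underlying_def using c by fastforce
  then have "\<exists>c :: 'a \<Rightarrow> nat. (\<forall>v\<in>fst H. c v < p) \<and> (\<forall>e\<in>snd H. \<forall>x\<in>e. \<forall>y\<in>e. x \<noteq> y \<longrightarrow> c x \<noteq> c y)"
    by blast
  then have "chi H \<le> p" unfolding chi_def by (rule Least_le)
  then show False using chi by simp
qed

text \<open>Composing with a transposition of the colours moves the centre of the star to any given part.\<close>
lemma recolour:
  fixes c :: "'a \<Rightarrow> nat"
  assumes "\<forall>l\<in>VH. c l < p" "c z = 0" "i < p"
  defines "c' \<equiv> \<lambda>l. Transposition.transpose 0 i (c l)"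
  shows "\<forall>l\<in>VH. c' l < p" "c' z = i" "c' x = c' y \<longleftrightarrow> c x = c y"
proof -
  show "\<forall>l\<in>VH. c' l < p" using assms(1,3) unfolding c'_def Transposition.transpose_def by auto
  show "c' z = i" using assms(2) unfolding c'_def by simp
  show "c' x = c' y \<longleftrightarrow> c x = c y" unfolding c'_def by (metis transpose_involutory)
qed

text \<open>The tail of every monochromatic arc is mapped to the centre of the star, so by
  injectivity all these tails are one vertex. At least one such arc exists because H has no proper
  colouring with p colours; it provides \<open>z\<close>.\<close>

lemma out_star_colouring:
  assumes or: "orientation vH H" and chi: "chi H = p + 1" and p: "p \<ge> 1" and vM: "out_star t \<in> M_dfam vH" and i: "i < p"
  shows "\<exists>z\<in>fst vH. \<exists>c. (\<forall>l\<in>fst vH. c l < p) \<and> c z = i \<and> (\<forall>(x, y)\<in>snd vH. c x = c y \<longrightarrow> x = z)"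
proof -
  obtain c :: "'a \<Rightarrow> nat" and Q g where c: "Q \<subseteq> fst vH" "\<forall>l\<in>fst vH. c l < p" "\<forall>l\<in>Q. c l = 0" "inj_on g Q"
    and mono: "\<forall>(x, y)\<in>snd vH. c x = c y \<longrightarrow> x \<in> Q \<and> y \<in> Q \<and> (g x, g y) \<in> snd (out_star t)"
    by (rule M_dfam_colouring[OF or chi p vM])
  have mono': "x \<in> Q \<and> g x = 0" if "(x, y) \<in> snd vH" "c x = c y" for x y
    using mono that unfolding out_star_def by auto
  obtain z z' where z: "(z, z') \<in> snd vH" "c z = c z'" using not_colourable[OF or chi c(2)] by blast
  have zQ: "z \<in> Q" "g z = 0" using mono'[OF z] by auto
  have uniq: "x = z" if "(x, y) \<in> snd vH" "c x = c y" for x y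
    by (rule inj_onD[OF c(4)]) (use mono'[OF that] zQ in auto)
  have cz: "c z = 0" using c(3) zQ by simp
  note r = recolour[OF c(2) cz i]
  show ?thesis
  proof (intro bexI exI conjI)
    show "z \<in> fst vH" using zQ c(1) by auto
    show "\<forall>(x, y)\<in>snd vH. Transposition.transpose 0 i (c x) = Transposition.transpose 0 i (c y) \<longrightarrow> x = z"
      using uniq r(3) by blast
  qed (rule r(1,2))+
qed

lemma in_star_colouring:
  assumes or: "orientation vH H" and chi: "chi H = p + 1" and p: "p \<ge> 1" and vM: "in_star t \<in> M_dfam vH" and i: "i < p"
  shows "\<exists>z\<in>fst vH. \<exists>c. (\<forall>l\<in>fst vH. c l < p) \<and> c z = i \<and> (\<forall>(x, y)\<in>snd vH. c x = c y \<longrightarrow> y = z)"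
proof -
  obtain c :: "'a \<Rightarrow> nat" and Q g where c: "Q \<subseteq> fst vH" "\<forall>l\<in>fst vH. c l < p" "\<forall>l\<in>Q. c l = 0" "inj_on g Q"
    and mono: "\<forall>(x, y)\<in>snd vH. c x = c y \<longrightarrow> x \<in> Q \<and> y \<in> Q \<and> (g x, g y) \<in> snd (in_star t)"
    by (rule M_dfam_colouring[OF or chi p vM])
  have mono': "y \<in> Q \<and> g y = 0" if "(x, y) \<in> snd vH" "c x = c y" for x y
    using mono that unfolding in_star_def by auto
  obtain z' z where z: "(z', z) \<in> snd vH" "c z' = c z" using not_colourable[OF or chi c(2)] by blast
  have zQ: "z \<in> Q" "g z = 0" using mono'[OF z] by auto
  have uniq: "y = z" if "(x, y) \<in> snd vH" "c x = c y" for x y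
    by (rule inj_onD[OF c(4)]) (use mono'[OF that] zQ in auto)
  have cz: "c z = 0" using c(3) zQ by simp
  note r = recolour[OF c(2) cz i]
  show ?thesis
  proof (intro bexI exI conjI)
    show "z \<in> fst vH" using zQ c(1) by auto
    show "\<forall>(x, y)\<in>snd vH. Transposition.transpose 0 i (c x) = Transposition.transpose 0 i (c y) \<longrightarrow> y = z"
      using uniq r(3) by blast
  qed (rule r(1,2))+
qed

text \<open>The orientation \<open>F\<close> is pulled back along the copy \<open>f\<close> to an
  orientation of M. Membership in \<open>M'_fam\<close> places it in \<open>M_dfam\<close>, whatever
  \<open>F\<close> is.\<close>

lemma M'_fam_colouring:
  assumes or: "orientation vH H" and chi: "chi H = p + 1" and p: "p \<ge> 1" and M: "M \<in> M'_fam vH"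
    and G: "graph (V, E)" and f: "inj_on f (fst M)" "\<And>e. e \<in> snd M \<Longrightarrow> f ` e \<in> E"
  shows "\<exists>(c :: 'a \<Rightarrow> nat) Q g. Q \<subseteq> fst vH \<and> (\<forall>l\<in>fst vH. c l < p) \<and> (\<forall>l\<in>Q. c l = 0) \<and> inj_on g Q \<and>
    g ` Q \<subseteq> f ` fst M \<and> (\<forall>(x, y)\<in>snd vH. c x = c y \<longrightarrow> x \<in> Q \<and> y \<in> Q \<and> arc E F (g x) (g y))"
proof -
  have gM: "graph M" using M unfolding M'_fam_def M_fam_def by auto
  define vM where "vM = (fst M, {(u, v). {u, v} \<in> snd M \<and> arc E F (f u) (f v)})"
  have ends: "u \<in> fst M" "v \<in> fst M" "u \<noteq> v" if "{u, v} \<in> snd M" for u v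
    using graph_edgeD[of "fst M" "snd M" "{u, v}"] gM that by (auto simp: doubleton_eq_iff)
  have "orientation vM M"
    unfolding orientation_def
  proof
    show "digraph vM"
      unfolding digraph_def vM_def using gM ends by (auto simp: graph_def arc_def insert_commute)
    show "underlying vM = M"
    proof (rule prod_eqI)
      show "fst (underlying vM) = fst M" unfolding underlying_def vM_def by simp
      show "snd (underlying vM) = snd M"
      proof (intro equalityI subsetI)
        fix e assume e: "e \<in> snd M"
        obtain u v where uv: "u \<noteq> v" "u \<in> fst M" "v \<in> fst M" "e = {u, v}"
          using graph_edgeD[of "fst M" "snd M" e] gM e by auto
        have "{f u, f v} \<in> E" using f(2)[OF e] uv(4) by simp
        moreover have "f u \<noteq> f v" using f(1) uv by (auto dest: inj_onD)
        ultimately have "arc E F (f u) (f v) \<or> arc E F (f v) (f u)" using arc_flip by blast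
        then have "(u, v) \<in> snd vM \<or> (v, u) \<in> snd vM"
          using e uv(4) unfolding vM_def by (auto simp: insert_commute)
        then show "e \<in> snd (underlying vM)" unfolding underlying_def using uv(4) by (auto simp: insert_commute)
      qed (auto simp: underlying_def vM_def)
    qed
  qed
  then have "vM \<in> M_dfam vH" using M unfolding M'_fam_def by blast
  then obtain c :: "'a \<Rightarrow> nat" and Q g where c: "Q \<subseteq> fst vH" "\<forall>l\<in>fst vH. c l < p" "\<forall>l\<in>Q. c l = 0" "inj_on g Q"
    "g ` Q \<subseteq> fst vM" and mono: "\<forall>(x, y)\<in>snd vH. c x = c y \<longrightarrow> x \<in> Q \<and> y \<in> Q \<and> (g x, g y) \<in> snd vM"
    by (rule M_dfam_colouring[OF or chi p])
  have gM: "g ` Q \<subseteq> fst M" using c(5) unfolding vM_def by simp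
  show ?thesis
  proof (intro exI conjI)
    show "inj_on (\<lambda>l. f (g l)) Q"
    proof (rule inj_onI)
      fix x y assume xy: "x \<in> Q" "y \<in> Q" "f (g x) = f (g y)"
      then have "g x = g y" using f(1) gM by (auto dest: inj_onD)
      then show "x = y" using c(4) xy by (auto dest: inj_onD)
    qed
    show "(\<lambda>l. f (g l)) ` Q \<subseteq> f ` fst M" using gM by auto
    show "\<forall>(x, y)\<in>snd vH. c x = c y \<longrightarrow> x \<in> Q \<and> y \<in> Q \<and> arc E F (f (g x)) (f (g y))"
      using mono unfolding vM_def by auto
  qed (rule c(1-3))+
qed

text \<open>The vertices of M not met by the copy of H can be deleted without losing the copy, so by
  minimality there are none.\<close>

lemma M_fam_card_le:
  assumes H: "graph H" and M: "M \<in> M_fam H"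
  shows "card (fst M) \<le> card (fst H)"
proof -
  have gM: "graph M" and min: "\<And>M0. subgraph_of M0 M \<Longrightarrow> M0 \<noteq> M \<Longrightarrow> \<not> M_prop H M0"
    using M unfolding M_fam_def by auto
  obtain t where "contains (gm M (chi H - 1) t) H" using M unfolding M_fam_def M_prop_def by auto
  then obtain f where f: "inj_on f (fst H)" "f ` fst H \<subseteq> fst (gm M (chi H - 1) t)"
    and fe: "\<forall>e\<in>snd H. f ` e \<in> snd (gm M (chi H - 1) t)" unfolding contains_def by blast
  define S where "S = f ` fst H"
  define U where "U = {v \<in> fst M. Inl (Inl v) \<in> S}"
  define M0 where "M0 = (U, {e \<in> snd M. e \<subseteq> U})"
  have "graph M0"
    unfolding graph_def M0_def fst_conv snd_conv
  proof (intro conjI ballI)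
    show "finite U" using gM unfolding U_def graph_def by auto
    fix e assume e: "e \<in> {e \<in> snd M. e \<subseteq> U}"
    then obtain x y where "x \<noteq> y" "e = {x, y}" using gM unfolding graph_def by blast
    then show "\<exists>x y. x \<noteq> y \<and> x \<in> U \<and> y \<in> U \<and> e = {x, y}" using e by auto
  qed
  then have sub: "subgraph_of M0 M" unfolding subgraph_of_def M0_def U_def by auto
  have "contains (gm M0 (chi H - 1) t) H"
    unfolding contains_def
  proof (intro exI[of _ f] conjI ballI)
    have vert: "a \<in> fst (gm M0 (chi H - 1) t)" if a: "a \<in> S" for a
    proof -
      have "a \<in> fst (gm M (chi H - 1) t)" using a f(2) unfolding S_def by auto
      then show ?thesis using a unfolding gm_def M0_def U_def by auto
    qed
    then show "f ` fst H \<subseteq> fst (gm M0 (chi H - 1) t)" unfolding S_def by blast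
    fix e assume e: "e \<in> snd H"
    have eH: "e \<subseteq> fst H" using H e unfolding graph_def by fastforce
    have im: "f ` e \<subseteq> S" using eH unfolding S_def by auto
    have "f ` e \<in> snd (gm M (chi H - 1) t)" using fe e by blast
    then consider e' where "e' \<in> snd M" "f ` e = (Inl \<circ> Inl) ` e'"
      | u w where "f ` e = {Inl u, Inr w}" "u \<in> Inl ` fst M \<union> Inr ` {..<t}" "w \<in> {..<chi H - 1 - 1} \<times> {..<t}"
      | "f ` e \<in> {{Inr (j, i), Inr (j', i')} | j i j' i'. j < chi H - 1 - 1 \<and> j' < chi H - 1 - 1 \<and> j \<noteq> j' \<and> i < t \<and> i' < t}"
      unfolding gm_def by auto
    then show "f ` e \<in> snd (gm M0 (chi H - 1) t)"
    proof cases
      case 1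
      have "e' \<subseteq> fst M" using gM 1(1) unfolding graph_def by fastforce
      moreover have "Inl (Inl v) \<in> S" if "v \<in> e'" for v using im 1(2) that by auto
      ultimately have "e' \<in> snd M0" using 1(1) unfolding M0_def U_def by auto
      then show ?thesis unfolding gm_def 1(2) by auto
    next
      case 2
      have "Inl u \<in> S" using im 2(1) by auto
      then have "u \<in> Inl ` fst M0 \<union> Inr ` {..<t}" using 2(2) unfolding M0_def U_def by auto
      then show ?thesis using 2(3) unfolding gm_def 2(1) snd_conv by blast
    next
      case 3
      then show ?thesis unfolding gm_def snd_conv by (rule UnI2)
    qed
  qed (rule f(1))
  then have "M_prop H M0" unfolding M_prop_def by blast
  then have "M0 = M" using min[OF sub] by blast
  then have "fst M = U" unfolding M0_def by (metis fst_conv)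
  moreover have "(Inl \<circ> Inl) ` U \<subseteq> f ` fst H" unfolding U_def S_def by auto
  ultimately have "card ((Inl \<circ> Inl) ` fst M :: (((nat + nat) + nat \<times> nat) set)) \<le> card (f ` fst H)"
    using H by (intro card_mono) (auto simp: graph_def)
  also have "card ((Inl \<circ> Inl) ` fst M :: (((nat + nat) + nat \<times> nat) set)) = card (fst M)"
    by (rule card_image) (auto simp: inj_on_def)
  also have "card (f ` fst H) = card (fst H)" by (rule card_image[OF f(1)])
  finally show ?thesis .
qed

text \<open>Simonovits' progressive induction: below a bad \<open>n\<close> the nonnegative quantity \<open>\<Delta>\<close> would have to grow
  without bound.\<close>
lemma progressive_induction:
  fixes \<Delta> :: "nat \<Rightarrow> real"
  assumes nonneg: "\<And>n. 0 \<le> \<Delta> n" and B: "0 \<le> B"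
    and ok: "\<And>n. n \<ge> n1 \<Longrightarrow> R n \<Longrightarrow> \<Delta> n \<le> B"
    and bad: "\<And>n. n \<ge> n1 + s0 \<Longrightarrow> \<not> R n \<Longrightarrow> \<exists>s. 1 \<le> s \<and> s \<le> s0 \<and> \<Delta> n < \<Delta> (n - s) - (B + 1)"
  shows "\<exists>n2. \<forall>n\<ge>n2. R n"
proof -
  \<comment> \<open>From \<open>n1\<close> on this bounds \<Delta>: by \<open>B\<close> where
    \<open>R\<close> holds, by the maximum over an initial window, and elsewhere through a smaller
    argument, where \<Delta> is larger.\<close>
  define C where "C = max B (Max (\<Delta> ` {n1..n1 + s0}))"
  have bound: "\<Delta> n \<le> C" if "n \<ge> n1" for n
    using that
  proof (induction n rule: less_induct)
    case (less n)
    consider "R n" | "n \<le> n1 + s0" | "n \<ge> n1 + s0" "\<not> R n" by linarith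
    then show ?case
    proof cases
      case 1
      then show ?thesis using ok[OF less.prems] unfolding C_def by simp
    next
      case 2
      then have "\<Delta> n \<le> Max (\<Delta> ` {n1..n1 + s0})" using less.prems by (intro Max_ge) auto
      then show ?thesis unfolding C_def by simp
    next
      case 3
      then obtain s where s: "1 \<le> s" "s \<le> s0" "\<Delta> n < \<Delta> (n - s) - (B + 1)" using bad by blast
      have "\<Delta> (n - s) \<le> C" using less.IH[of "n - s"] s 3(1) by simp
      then show ?thesis using s(3) B by linarith
    qed
  qed
  have drop: "\<Delta> n \<le> C - (real j + 1)" if "n \<ge> n1 + s0 + j * s0" "\<not> R n" for n j
    using that
  proof (induction j arbitrary: n)
    case 0
    then obtain s where s: "1 \<le> s" "s \<le> s0" "\<Delta> n < \<Delta> (n - s) - (B + 1)" using bad[of n] by auto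
    have "\<Delta> (n - s) \<le> C" using bound[of "n - s"] s 0 by simp
    then show ?case using s(3) B by simp
  next
    case (Suc j)
    then obtain s where s: "1 \<le> s" "s \<le> s0" "\<Delta> n < \<Delta> (n - s) - (B + 1)" using bad[of n] by auto
    have ge: "n - s \<ge> n1 + s0 + j * s0" using Suc.prems(1) s(2) by simp
    \<comment> \<open>Otherwise \<Delta> n would lie below B - (B + 1), hence be negative.\<close>
    have "\<not> R (n - s)"
    proof
      assume "R (n - s)"
      then have "\<Delta> (n - s) \<le> B" using ok[of "n - s"] ge by simp
      then show False using s(3) nonneg[of n] by linarith
    qed
    then have "\<Delta> (n - s) \<le> C - (real j + 1)" using Suc.IH[OF ge] by simp
    then show ?case using s(3) B by simp
  qed
  have "R n" if n: "n \<ge> n1 + s0 + nat \<lceil>C\<rceil> * s0" for n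
  proof (rule ccontr)
    assume "\<not> R n"
    from drop[OF n this] have "\<Delta> n \<le> C - (real (nat \<lceil>C\<rceil>) + 1)" .
    then show False using nonneg[of n] by linarith
  qed
  then show ?thesis by blast
qed

section \<open>Progressive induction for the excess over the Turan number, and the
  conclusion\<close>

theorem mainTheorem2:
  fixes H :: "'a graph" and vH :: "'a digraph" and p t a :: nat
  assumes "graph H"
    and "chi H = p + 1" and "p + 1 \<ge> 3"
    and "orientation vH H"
    and "t \<ge> 1"
    and "star t \<in> M_fam H"
    and "in_star t \<in> M_dfam vH" and "out_star t \<in> M_dfam vH"
    and "\<exists>n0. \<forall>n\<ge>n0. ex n (M'_fam vH) = a"
  shows "\<exists>n0. \<forall>n\<ge>n0. \<forall>(G :: nat graph) P.
           graph G \<and> card (fst G) = n \<and> Dg G vH = Dn n vH \<and> optimal_partition G p P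
           \<longrightarrow> (\<Sum>i<p. card (E_in G (P i))) \<le> p * a"
proof -
  note H = assms(1) and chi = assms(2) and or = assms(4)
  have p2: "p \<ge> 2" and p1: "p \<ge> 1" and p0: "p > 0" using assms(3) by auto
  have Hu: "underlying vH = H" using or unfolding orientation_def by simp
  have fH: "fst H = fst vH" unfolding Hu[symmetric] underlying_def by simp
  have dig: "finite (fst vH)" "snd vH \<subseteq> fst vH \<times> fst vH" "\<And>x y. (x, y) \<in> snd vH \<Longrightarrow> (y, x) \<notin> snd vH"
    using or unfolding orientation_def digraph_def by auto
  \<comment> \<open>A failure of goodness has to lower the excess by more than B + 1, where B = p a
    is the bound available at good n.\<close>
  define K where "K = real (p * a) + 1"
  \<comment> \<open>Every orientation of the Turan graph avoids H, since H is not
    p-colourable.\<close>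
  have Dn_ge: "2 ^ turan p n \<le> Dn n vH" for n
  proof -
    let ?E = "turan_edges p n"
    have G: "graph ({..<n}, ?E)"
      unfolding graph_def fst_conv snd_conv
    proof (intro conjI ballI)
      fix e assume "e \<in> ?E"
      then obtain u v where "u < n" "v < n" "u mod p \<noteq> v mod p" "e = {u, v}" unfolding turan_edges_def by blast
      then show "\<exists>x y. x \<noteq> y \<and> x \<in> {..<n} \<and> y \<in> {..<n} \<and> e = {x, y}" by (intro exI[of _ u] exI[of _ v]) auto
    qed simp
    have none: "\<not> emb {..<n} ?E F (fst vH) (snd vH)" for F
    proof
      assume "emb {..<n} ?E F (fst vH) (snd vH)"
      then obtain f where f: "\<forall>(x, y)\<in>snd vH. arc ?E F (f x) (f y)" unfolding emb_def by blast
      show False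
      proof (rule not_colourable[OF or chi, of "\<lambda>l. f l mod p"])
        show "\<forall>l\<in>fst vH. f l mod p < p" using p0 by simp
        show "\<forall>(x, y)\<in>snd vH. f x mod p \<noteq> f y mod p"
          using f unfolding arc_def turan_edges_def by (fastforce simp: doubleton_eq_iff)
      qed
    qed
    then have "{F. F \<subseteq> ?E \<and> \<not> emb {..<n} ?E F (fst vH) (snd vH)} = Pow ?E" by auto
    then have "Dg ({..<n}, ?E) vH = 2 ^ turan p n"
      using Dg_eq_card[OF G, of vH] card_turan_edges[OF p0, of n] by (simp add: card_Pow finite_turan_edges)
    then show ?thesis using Dg_le_Dn[OF G dig(2)] by simp
  qed
  have Dn_ge': "2 powr (turan p n) \<le> Dn n vH" for n
  proof -
    have "real (2 ^ turan p n) \<le> real (Dn n vH)" using Dn_ge by (simp only: of_nat_le_iff)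
    then show ?thesis by (simp add: powr_realpow)
  qed
  interpret OP: oriented_pattern "fst vH" "snd vH" p "\<lambda>n. Dn n vH" K
  proof
    show "card {F. F \<subseteq> E \<and> \<not> emb V E F (fst vH) (snd vH)} \<le> Dn (card V) vH" if "graph (V, E)" for V E
      using Dg_le_Dn[OF that dig(2)] Dg_eq_card[OF that, of vH] by simp
    show "2 powr ((1 - 1 / p) * real n ^ 2 / 2 - n) \<le> Dn n vH" for n
    proof -
      have "2 powr ((1 - 1 / p) * real n ^ 2 / 2 - n) \<le> 2 powr (turan p n)"
        using turan_lower[OF p0, of n] by (intro powr_mono) auto
      then show ?thesis using Dn_ge'[of n] by linarith
    qed
  qed (use dig p2 out_star_colouring[OF or chi p1 assms(8)] in_star_colouring[OF or chi p1 assms(7)] in auto)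
  obtain s0 n0 where struct: "\<And>V E P. n0 \<le> card V \<Longrightarrow> OP.good s0 (card V) \<Longrightarrow> OP.extremal V E \<Longrightarrow>
      optimal_partition (V, E) p P \<Longrightarrow> (\<forall>i<p. real (card V) / (2 * p) \<le> card (P i)) \<and>
     (\<forall>i<p. \<forall>S\<subseteq>P i. S \<noteq> {} \<longrightarrow> card S \<le> card (fst vH) \<longrightarrow> \<not> OP.forcing E S)"
    using OP.optimal_structure by blast
  obtain n' where ex: "\<And>n. n \<ge> n' \<Longrightarrow> ex n (M'_fam vH) = a" using assms(9) by blast
  \<comment> \<open>Classes have at least n / (2 p) vertices, so from \<open>2 * p * n'\<close> on
    they are large enough for \<open>ex\<close> to equal \<open>a\<close>.\<close>
  define n1 where "n1 = max n0 (2 * p * n')"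
  have ext: "OP.extremal V E" if "graph (V, E)" "Dg (V, E) vH = Dn (card V) vH" for V E
    unfolding OP.extremal_def OP.hfree_def using that Dg_eq_card[OF that(1), of vH] by simp
  \<comment> \<open>Needed twice, to bound the excess at good n within the progressive induction and
    for the conclusion, and for arbitrary vertex sets in the latter.\<close>
  have cost: "part_cost (V, E) p P \<le> p * a"
    if n: "n1 \<le> card V" and good: "OP.good s0 (card V)" and G: "graph (V, E)" and D: "Dg (V, E) vH = Dn (card V) vH"
      and opt: "optimal_partition (V, E) p P" for V :: "nat set" and E P
  proof -
    have part: "is_partition (V, E) p P" using opt unfolding optimal_partition_def by simp
    have n0: "n0 \<le> card V" using n unfolding n1_def by simp
    note st = struct[OF n0 good ext[OF G D] opt]
    have fin: "finite V" "finite E" using graph_finite[OF G] by auto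
    have "card (E_in (V, E) (P i)) \<le> a" if i: "i < p" for i
    proof -
      have sub: "P i \<subseteq> V" by (rule partition_subset[OF part i])
      have Gi: "graph (P i, E_in (V, E) (P i))"
        unfolding graph_def fst_conv snd_conv
      proof (intro conjI ballI)
        show "finite (P i)" using sub fin finite_subset by blast
        fix e assume "e \<in> E_in (V, E) (P i)"
        then have e: "e \<in> E" "e \<subseteq> P i" unfolding E_in_def by auto
        obtain x y where "x \<noteq> y" "e = {x, y}" using graph_edgeD[OF G e(1)] by metis
        then show "\<exists>x y. x \<noteq> y \<and> x \<in> P i \<and> y \<in> P i \<and> e = {x, y}" using e(2) by auto
      qed
      have "\<not> contains (P i, E_in (V, E) (P i)) M" if M: "M \<in> M'_fam vH" for M
      proof
        assume "contains (P i, E_in (V, E) (P i)) M"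
        then obtain f where f: "inj_on f (fst M)" "f ` fst M \<subseteq> P i" "\<forall>e\<in>snd M. f ` e \<in> E_in (V, E) (P i)"
          unfolding contains_def by auto
        have fe: "\<And>e. e \<in> snd M \<Longrightarrow> f ` e \<in> E" using f(3) unfolding E_in_def by auto
        have col: "\<exists>(c :: 'a \<Rightarrow> nat) Q g. Q \<subseteq> fst vH \<and> (\<forall>l\<in>fst vH. c l < p) \<and> (\<forall>l\<in>Q. c l = 0) \<and>
            inj_on g Q \<and> g ` Q \<subseteq> f ` fst M \<and>
            (\<forall>(x, y)\<in>snd vH. c x = c y \<longrightarrow> x \<in> Q \<and> y \<in> Q \<and> arc E F (g x) (g y))" for F
          by (rule M'_fam_colouring[OF or chi p1 M G f(1) fe])
        have forc: "OP.forcing E (f ` fst M)" unfolding OP.forcing_def using col by blast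
        have "card (f ` fst M) = card (fst M)" by (rule card_image[OF f(1)])
        also have "\<dots> \<le> card (fst vH)"
          using M_fam_card_le[OF H, of M] M unfolding M'_fam_def Hu fH by auto
        finally have "f ` fst M = {}" using st i f(2) forc by blast
        \<comment> \<open>The structural result excludes only nonempty forcing sets. A member of the
          family without vertices would yield a proper colouring of H with p colours.\<close>
        then have empty: "f ` fst M \<subseteq> {}" by simp
        obtain c :: "'a \<Rightarrow> nat" and Q g where c: "\<forall>l\<in>fst vH. c l < p" "g ` Q \<subseteq> f ` fst M"
          and mono: "\<forall>(x, y)\<in>snd vH. c x = c y \<longrightarrow> x \<in> Q \<and> y \<in> Q \<and> arc E {} (g x) (g y)"
          using col[of "{}"] by (elim exE conjE) (rule that)
        have "Q = {}" using c(2) empty by blast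
        then have "\<forall>(x, y)\<in>snd vH. c x \<noteq> c y" using mono by auto
        then show False using not_colourable[OF or chi c(1)] by blast
      qed
      then have "card (E_in (V, E) (P i)) \<le> ex (card (P i)) (M'_fam vH)"
        by (rule card_edges_le_ex[OF Gi]) (auto simp: M'_fam_def M_fam_def)
      also have "\<dots> = a"
      proof (rule ex)
        have "2 * p * n' \<le> card V" using n unfolding n1_def by simp
        then have "real (2 * p * n') \<le> card V" by (simp only: of_nat_le_iff)
        then have "real n' \<le> real (card V) / (2 * p)" using p0 by (simp add: field_simps)
        also have "\<dots> \<le> card (P i)" using st i by blast
        finally show "n' \<le> card (P i)" by simp
      qed
      finally show ?thesis .
    qed
    then have "part_cost (V, E) p P \<le> (\<Sum>i<p. a)" unfolding part_cost_def by (intro sum_mono) auto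
    then show ?thesis by simp
  qed
  \<comment> \<open>Nonnegative because of the Turan graph, and at most p a at good n, where an
    extremal graph has at most p a edges more than the Turan number.\<close>
  define \<Delta> where "\<Delta> n = log 2 (Dn n vH) - turan p n" for n
  have Dpos: "real (Dn n vH) > 0" for n using OP.D_pos .
  have "\<exists>n2. \<forall>n\<ge>n2. OP.good s0 n"
  proof (rule progressive_induction[where \<Delta> = \<Delta> and B = "real (p * a)" and ?n1.0 = n1 and ?s0.0 = s0])
    show "0 \<le> \<Delta> n" for n
      using Dn_ge'[of n] Dpos[of n] unfolding \<Delta>_def by (simp add: le_log_iff)
    show "\<Delta> n \<le> real (p * a)" if n: "n \<ge> n1" and good: "OP.good s0 n" for n
    proof -
      obtain E where E: "graph ({..<n}, E)" "Dg ({..<n}, E) vH = Dn n vH" by (rule Dn_attained)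
      have "is_partition ({..<n}, E) p (\<lambda>i. if i = 0 then {..<n} else {})"
        unfolding is_partition_def using p0 by auto
      then obtain P where P: "is_partition ({..<n}, E) p P"
        "\<And>Q. is_partition ({..<n}, E) p Q \<Longrightarrow> part_cost ({..<n}, E) p P \<le> part_cost ({..<n}, E) p Q"
        using ex_has_least_nat[of "is_partition ({..<n}, E) p" _ "part_cost ({..<n}, E) p"] by blast
      then have opt: "optimal_partition ({..<n}, E) p P" unfolding optimal_partition_def by blast
      have "part_cost ({..<n}, E) p P \<le> p * a"
        by (rule cost[OF _ _ E(1) _ opt]) (use n good E(2) in auto)
      moreover have "card E \<le> turan p n + part_cost ({..<n}, E) p P"
        using card_edges_le_turan[OF E(1) P(1) p0] by simp
      ultimately have cE: "card E \<le> turan p n + p * a" by linarith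
      have fE: "finite E" using graph_finite[OF E(1)] by simp
      have "card {F. F \<subseteq> E \<and> \<not> emb {..<n} E F (fst vH) (snd vH)} \<le> card (Pow E)"
        by (rule card_mono) (use fE in auto)
      then have "Dn n vH \<le> 2 ^ card E" using E(2) Dg_eq_card[OF E(1), of vH] fE by (simp add: card_Pow)
      then have "real (Dn n vH) \<le> real (2 ^ card E)" by (simp only: of_nat_le_iff)
      then have "real (Dn n vH) \<le> 2 powr (card E)" by (simp add: powr_realpow)
      then have "log 2 (Dn n vH) \<le> card E" using Dpos[of n] by (simp add: log_le_iff)
      then show ?thesis using cE unfolding \<Delta>_def by linarith
    qed
    show "\<exists>s. 1 \<le> s \<and> s \<le> s0 \<and> \<Delta> n < \<Delta> (n - s) - (real (p * a) + 1)" if n: "n \<ge> n1 + s0" and bad: "\<not> OP.good s0 n" for n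
    proof -
      obtain s where s: "1 \<le> s" "s \<le> s0"
        and "\<not> (s \<le> n \<and> real (Dn (n - s) vH) * 2 powr (OP.\<beta> * s * n - real s ^ 2) \<le> 2 powr K * Dn n vH)"
        using bad unfolding OP.good_def by blast
      then have lt: "2 powr K * Dn n vH < real (Dn (n - s) vH) * 2 powr (OP.\<beta> * s * n - real s ^ 2)" and sn: "s \<le> n"
        using n s(2) by auto
      \<comment> \<open>The failed inequality in logarithms. The exponent \<beta> s n - s^2 is at
        most the growth of the Turan number from n - s to n, so the excess drops by more than
        \<open>K\<close>.\<close>
      have "log 2 (2 powr K * Dn n vH) < log 2 (real (Dn (n - s) vH) * 2 powr (OP.\<beta> * s * n - real s ^ 2))"
        using lt Dpos[of n] by (intro log_less) auto
      then have "K + log 2 (Dn n vH) < log 2 (Dn (n - s) vH) + (OP.\<beta> * s * n - real s ^ 2)"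
        using Dpos[of n] Dpos[of "n - s"] by (simp add: log_mult)
      moreover have "OP.\<beta> * s * n - real s ^ 2 \<le> real (turan p n) - turan p (n - s)"
      proof -
        have "real (turan p (n - s)) + OP.\<beta> * s * (n - s) \<le> turan p n"
          using turan_diff[OF p0, of "n - s" s] sn unfolding OP.\<beta>_def by simp
        moreover have "OP.\<beta> * s * real (n - s) = OP.\<beta> * s * n - OP.\<beta> * (real s ^ 2)"
          using sn by (simp add: of_nat_diff right_diff_distrib power2_eq_square)
        moreover have "OP.\<beta> * (real s ^ 2) \<le> 1 * real s ^ 2"
          by (rule mult_right_mono) (auto simp: OP.\<beta>_def)
        ultimately show ?thesis by linarith
      qed
      ultimately show ?thesis using s unfolding \<Delta>_def K_def by (intro exI[of _ s]) auto
    qed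
  qed simp
  then obtain n2 where n2: "\<And>n. n \<ge> n2 \<Longrightarrow> OP.good s0 n" by blast
  show ?thesis
  proof (intro exI[of _ "max n1 n2"] allI impI)
    fix n and G :: "nat graph" and P
    assume n: "n \<ge> max n1 n2" and G: "graph G \<and> card (fst G) = n \<and> Dg G vH = Dn n vH \<and> optimal_partition G p P"
    have "part_cost (fst G, snd G) p P \<le> p * a"
      by (rule cost) (use n n2[of n] G in auto)
    then show "(\<Sum>i<p. card (E_in G (P i))) \<le> p * a" unfolding part_cost_def by simp
  qed
qed

end
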